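(* Let $P^1,P^2$ be two almost-surely terminating, integrable probabilistic programs (possibly with conditioning), with the same set of output variables $V_{\mathrm{out}}$, satisfying the bounded cumulative weight property. Let $P^1_{\mathrm{res}},P^2_{\mathrm{res}}$ be the conditioning-free programs obtained from them by weighted restarting, and let the initial states of $\mathcal{C}(P^1_{\mathrm{res}})$ and $\mathcal{C}(P^2_{\mathrm{res}})$ be $(\ell^1_{\mathrm{in}},\mathbf{x}^1_{\mathrm{in}})$ and $(\ell^2_{\mathrm{in}},\mathbf{x}^2_{\mathrm{in}})$, respectively. Assume that there exist a Borel-measurable function $f:\mathbb{R}^{|V_{\mathrm{out}}|}\to\mathbb{R}$ and two state functions, $U_f$ for $\mathcal{C}(P^1_{\mathrm{res}})$ and $L_f$ for $\mathcal{C}(P^2_{\mathrm{res}})$, such that: (i) $U_f$ is a UESM for $f$ in $\mathcal{C}(P^1_{\mathrm{res}})$ (with respect to some invariant) and $(\mathcal{C}(P^1_{\mathrm{res}}),U_f,f)$ is OST-sound; (ii) $L_f$ is an LESM for $f$ in $\mathcal{C}(P^2_{\mathrm{res}})$ (with respect to some invariant) and $(\mathcal{C}(P^2_{\mathrm{res}}),L_f,f)$ is OST-sound; (iii) $U_f(\ell^1_{\mathrm{in}},\mathbf{x}^1_{\mathrm{in}})+f((\mathbf{x}^1_{\mathrm{in}})^{\mathrm{out}})<L_f(\ell^2_{\mathrm{in}},\mathbf{x}^2_{\mathrm{in}})+f((\mathbf{x}^2_{\mathrm{in}})^{\mathrm{out}})$. Then $P^1,P^2$ are not output equivalent, i.e.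 $\mu^{\mathcal{C}(P^1)}\neq\mu^{\mathcal{C}(P^2)}$. Moreover, if $f$ is $1$-Lipschitz continuous under a metric $d$ over $\mathbb{R}^{|V_{\mathrm{out}}|}$ with respect to which $\mu^{\mathcal{C}(P^1)}$ and $\mu^{\mathcal{C}(P^2)}$ have finite first moments, then $$\mathcal{K}_d\big(\mu^{\mathcal{C}(P^1)},\mu^{\mathcal{C}(P^2)}\big)\ \ge\ L_f(\ell^2_{\mathrm{in}},\mathbf{x}^2_{\mathrm{in}})+f((\mathbf{x}^2_{\mathrm{in}})^{\mathrm{out}})-U_f(\ell^1_{\mathrm{in}},\mathbf{x}^1_{\mathrm{in}})-f((\mathbf{x}^1_{\mathrm{in}})^{\mathrm{out}}).$$
   Context: **Programs and pCFGs.** A probabilistic program (PP) is an imperative program over finitely many integer- or real-valued variables with assignments, if-branching, loops, sequential composition, go-to, sampling assignments $x:=\mathbf{sample}(d)$ ($d$ a probability distribution on $\mathbb{R}$, discrete or continuous), and conditioning instructions $\mathbf{observe}(\phi)$ ($\phi$ a predicate over program variables) and $\mathbf{score}(e)$ ($e$ a non-negative expression over program variables). All expressions are Borel-measurable. A PP is conditioning-free if it has no observe/score instructions. Probabilistic branching $\mathbf{if\ prob}(p)$ is syntactic sugar for sampling followed by conditional branching. All notions for a PP $P$ are defined via its probabilistic control-flow graph (pCFG) $\mathcal{C}(P)$. A pCFG is a tuple $\mathcal{C}=(L,V,V_{\mathrm{out}},\ell_{\mathrm{in}},\mathbf{x}_{\mathrm{in}},\mapsto,G,Up,w,\ell_{\mathrm{out}})$: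 $L$ a finite set of locations; $V$ a finite set of variables; $V_{\mathrm{out}}\subseteq V$ the output variables; $\ell_{\mathrm{in}}\in L$ the initial location; $\mathbf{x}_{\mathrm{in}}\in\mathbb{R}^{|V|}$ the initial valuation; $\mapsto\,\subseteq L\times L$ the transitions; $G$ assigns each transition a guard (a predicate over $V$); $Up$ assigns each transition and each variable either $\bot$ (no change), a Borel-measurable expression $u:\mathbb{R}^{|V|}\to\mathbb{R}$ (deterministic update), or a probability distribution on $\mathbb{R}$ (fresh independent sample); $w:\,\mapsto\times\mathbb{R}^{|V|}\to[0,\infty)$ is the weighting function; $\ell_{\mathrm{out}}\in L$ is the terminal location. At each state $(\ell,\mathbf{x})\in L\times\mathbb{R}^{|V|}$ exactly one transition $\tau=(\ell,\ell')$ is enabled (i.e. satisfies $\mathbf{x}\models G(\tau)$); the only transition out of $\ell_{\mathrm{out}}$ is a self-loop with no variable update and weight $1$. In $\mathcal{C}(P)$, locations correspond to instructions and transitions encode their effect; $w(\tau,\mathbf{x})=e(\mathbf{x})$ if $\tau$ encodes $\mathbf{score}(e)$; $w(\tau,\mathbf{x})=1$ if $\mathbf{x}\models\phi$ and $0$ otherwise if $\tau$ encodes $\mathbf{observe}(\phi)$; $w(\tau,\mathbf{x})=1$ for all other $\tau$. **Runs and semantics.** A state $(\ell',\mathbf{x}')$ is a successor of $(\ell,\mathbf{x})$ if $\mathbf{x}'$ is a possible result of applying the update of the enabled transition $(\ell,\ell')$ to $\mathbf{x}$. A state is reachable if it is the last state of a finite sequence of successive states starting in $(\ell_{\mathrm{in}},\mathbf{x}_{\mathrm{in}})$.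 A run is an infinite sequence of successive states starting in $(\ell_{\mathrm{in}},\mathbf{x}_{\mathrm{in}})$. The pCFG defines a discrete-time Markov process on states started in $(\ell_{\mathrm{in}},\mathbf{x}_{\mathrm{in}})$, giving a probability measure $\mathbb{P}^{\mathcal{C}}$ on runs with expectation $\mathbb{E}^{\mathcal{C}}$. A run is terminating if it reaches $\ell_{\mathrm{out}}$; its termination time $T(\rho)$ is the first index $i$ with $\ell_i=\ell_{\mathrm{out}}$ ($\infty$ if none). The cumulative weight of a terminating run $\rho=(\ell_0,\mathbf{x}_0),(\ell_1,\mathbf{x}_1),\dots$ is $W(\rho)=\prod_{i=0}^{T(\rho)-1}w((\ell_i,\ell_{i+1}),\mathbf{x}_i)$. $\mathcal{C}$ (or $P$) is: almost-surely (a.s.) terminating if $\mathbb{P}^{\mathcal{C}}[T<\infty]=1$; integrable if $0<\mathbb{E}^{\mathcal{C}}[W]<\infty$; it satisfies the bounded cumulative weight property (with bound $M$) if there is $M>0$ with $W(\rho)\le M$ for every terminating run $\rho$. **Normalized output distribution (NOD).** For a valuation $\mathbf{x}$, $\mathbf{x}^{\mathrm{out}}$ is its projection to the variables in $V_{\mathrm{out}}$. For Borel $B\subseteq\mathbb{R}^{|V_{\mathrm{out}}|}$ let $\mathrm{Output}(B)$ be the set of runs reaching some terminal state $(\ell_{\mathrm{out}},\mathbf{x})$ with $\mathbf{x}^{\mathrm{out}}\in B$. For $\mathcal{C}$ a.s. terminating and integrable, $\mu^{\mathcal{C}}[B]=\mathbb{E}^{\mathcal{C}}[\mathbf{1}_{\mathrm{Output}(B)}\cdot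 W]/\mathbb{E}^{\mathcal{C}}[W]$. **Kantorovich distance.** Let $d$ be a metric on $\mathbb{R}^{|V_{\mathrm{out}}|}$. A probability measure $\mu$ on $\mathbb{R}^{|V_{\mathrm{out}}|}$ has finite first moment w.r.t. $d$ if $\mathbb{E}_\mu[d(\mathbf{x}_0,\cdot)]<\infty$ for some $\mathbf{x}_0$. For $\mu_1,\mu_2$ with finite first moments w.r.t. $d$, $\mathcal{K}_d(\mu_1,\mu_2)=\sup_g|\mathbb{E}_{\mu_1}[g]-\mathbb{E}_{\mu_2}[g]|$, the supremum being over all (measurable) $1$-Lipschitz functions $g:\mathbb{R}^{|V_{\mathrm{out}}|}\to\mathbb{R}$, i.e. $|g(x)-g(y)|\le d(x,y)$ for all $x,y$. **Weighted restarting.** Given $P$ with bound $M$, the PP $P_{\mathrm{res}}$ is obtained by: (1) adding a fresh non-output variable $\omega$ (the weight variable), initially $1$; (2) replacing each $\mathbf{observe}(\phi)$ by "if $\neg\phi$: $\omega:=0$"; (3) replacing each $\mathbf{score}(e)$ by $\omega:=\omega\cdot e$; (4) adding at the end of the program: "$\mathbf{if\ prob}(1-\omega/M)$: $\mathbf{x}:=\mathbf{x}_{\mathrm{in}}$; $\omega:=1$; go-to $\ell_{\mathrm{in}}$" (otherwise the program terminates). On the level of pCFGs this can be realized as follows: every transition $\tau$ of $\mathcal{C}(P)$ not leaving $\ell_{\mathrm{out}}$ is kept, with the additional update $\omega:=\omega\cdot w(\tau,\mathbf{x})$; the old terminal location is no longer terminal, and from it a fresh non-output variable $u$ is sampled uniformly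 from $[0,1]$; then if $u<1-\omega/M$ the run moves to $\ell_{\mathrm{in}}$ with all variables reset to $\mathbf{x}_{\mathrm{in}}$ and $\omega:=1$, and otherwise moves to a new terminal location with variables unchanged; all transition weights are $1$. The output variables are unchanged. **State functions, invariants, UESM, LESM.** A state function $\eta$ in $\mathcal{C}$ assigns to each location $\ell$ a Borel-measurable function $\eta(\ell,\cdot):\mathbb{R}^{|V|}\to\mathbb{R}$. An invariant $I$ assigns to each location a predicate $I(\ell)$ over $V$ such that $\mathbf{x}\models I(\ell)$ for each reachable state $(\ell,\mathbf{x})$. Let $\mathcal{C}$ be a.s. terminating and $f:\mathbb{R}^{|V_{\mathrm{out}}|}\to\mathbb{R}$ Borel-measurable. An upper expectation supermartingale (UESM) for $f$ with respect to $I$ is a state function $U_f$ such that: (1) $U_f(\ell_{\mathrm{out}},\mathbf{x})=0$ for every $\mathbf{x}\models I(\ell_{\mathrm{out}})$; (2) for every transition $\tau=(\ell,\ell')$ and every $\mathbf{x}\models I(\ell)\wedge G(\tau)$, writing $\mathbf{N}$ for the random valuation resulting from performing $\tau$ from $(\ell,\mathbf{x})$, $U_f(\ell,\mathbf{x})+f(\mathbf{x}^{\mathrm{out}})\ge\mathbb{E}[U_f(\ell',\mathbf{N})+f(\mathbf{N}^{\mathrm{out}})]$. A lower expectation submartingale (LESM) $L_f$ for $f$ is defined in the same way with (2) replaced by $L_f(\ell,\mathbf{x})+f(\mathbf{x}^{\mathrm{out}})\le\mathbb{E}[L_f(\ell',\mathbf{N})+f(\mathbf{N}^{\mathrm{out}})]$.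 The expectations are understood to be well defined. **OST-soundness.** Here $\mathbb{N}=\{1,2,\dots\}$. For a pCFG $\mathcal{C}$, a state function $\eta$ in $\mathcal{C}$ and a Borel-measurable function $f:\mathbb{R}^{|V_{\mathrm{out}}|}\to\mathbb{R}$, let $S_i$ and $\mathbf{x}_i$ be the $i$-th state and $i$-th valuation along a run, $Y_i=\eta(S_i)+f(\mathbf{x}_i^{\mathrm{out}})$ for $i\ge0$, and $\mathcal{F}_t$ the $\sigma$-algebra generated by the first $t$ steps. $(\mathcal{C},\eta,f)$ is OST-sound if $\mathbb{E}[|Y_i|]<\infty$ for every $i\ge0$ and at least one of the following holds: (C1) there is a constant $c$ with $T\le c$ with probability $1$; (C2) there is a constant $c$ such that $|Y_{\min\{t,T(\rho)\}}(\rho)|\le c$ for each $t\in\mathbb{N}$ and each run $\rho$; (C3) $\mathbb{E}[T]<\infty$ and there is a constant $c$ such that $\mathbb{E}[|Y_{t+1}-Y_t|\mid\mathcal{F}_t]\le c$ for every $t\in\mathbb{N}$; (C4) there are real numbers $M,c_1,c_2,d$ with $c_2>0$ such that $\mathbb{P}(T>n)\le c_1e^{-c_2n}$ for all sufficiently large $n\in\mathbb{N}$, and $|Y_{n+1}-Y_n|\le M\cdot n^d$ for all $n\in\mathbb{N}$. *)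

theory Defs
  imports "HOL-Probability.Probability"
begin

section \<open>Probabilistic control-flow graphs\<close>

text \<open>
  Valuations over a finite set \<open>V\<close> of variables are the points of \<open>space (real_vals V)\<close>, that is,
  functions that are \<open>undefined\<close> outside \<open>V\<close>. This is \<open>\<real>\<^sup>V\<close> with its Borel sigma-algebra, and
  \<open>restrict x W\<close> is the projection of \<open>x\<close> to the variables in \<open>W\<close>.
\<close>

abbreviation real_vals :: "'v set \<Rightarrow> ('v \<Rightarrow> real) measure" where
  "real_vals V \<equiv> PiM V (\<lambda>_. borel)"

datatype 'v var_update =
    Unchanged
  | Assigned "('v \<Rightarrow> real) \<Rightarrow> real"
  | is_Sampled: Sampled (sample_law: "real measure")

record ('l, 'v) pcfg =
  locs :: "'l set"
  vars :: "'v set"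
  out_vars :: "'v set"
  init_loc :: 'l
  init_val :: "'v \<Rightarrow> real"
  trans_rel :: "('l \<times> 'l) set"
  guard :: "'l \<times> 'l \<Rightarrow> ('v \<Rightarrow> real) \<Rightarrow> bool"
  upd :: "'l \<times> 'l \<Rightarrow> 'v \<Rightarrow> 'v var_update"
  weight :: "'l \<times> 'l \<Rightarrow> ('v \<Rightarrow> real) \<Rightarrow> real"
  out_loc :: 'l

abbreviation val_space :: "('l, 'v, 'z) pcfg_scheme \<Rightarrow> ('v \<Rightarrow> real) measure" where
  "val_space C \<equiv> real_vals (vars C)"

abbreviation out_space :: "('l, 'v, 'z) pcfg_scheme \<Rightarrow> ('v \<Rightarrow> real) measure" where
  "out_space C \<equiv> real_vals (out_vars C)"

fun wf_update :: "'v set \<Rightarrow> 'v var_update \<Rightarrow> bool" where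
  "wf_update V Unchanged \<longleftrightarrow> True"
| "wf_update V (Assigned e) \<longleftrightarrow> e \<in> borel_measurable (real_vals V)"
| "wf_update V (Sampled d) \<longleftrightarrow> prob_space d \<and> sets d = sets borel"

definition wf_pcfg :: "('l, 'v, 'z) pcfg_scheme \<Rightarrow> bool" where
  "wf_pcfg C \<longleftrightarrow>
     finite (locs C) \<and> finite (vars C) \<and> out_vars C \<subseteq> vars C \<and>
     init_loc C \<in> locs C \<and> out_loc C \<in> locs C \<and> init_val C \<in> space (val_space C) \<and>
     trans_rel C \<subseteq> locs C \<times> locs C \<and>
     (\<forall>\<tau>\<in>trans_rel C.
        Measurable.pred (val_space C) (guard C \<tau>) \<and>
        (\<forall>v\<in>vars C. wf_update (vars C) (upd C \<tau> v)) \<and>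
        weight C \<tau> \<in> borel_measurable (val_space C) \<and>
        (\<forall>x\<in>space (val_space C). 0 \<le> weight C \<tau> x)) \<and>
     (\<forall>l\<in>locs C. \<forall>x\<in>space (val_space C). \<exists>!l'. (l, l') \<in> trans_rel C \<and> guard C (l, l') x) \<and>
     (\<forall>l'. (out_loc C, l') \<in> trans_rel C \<longleftrightarrow> l' = out_loc C) \<and>
     (\<forall>v\<in>vars C. upd C (out_loc C, out_loc C) v = Unchanged) \<and>
     (\<forall>x\<in>space (val_space C). weight C (out_loc C, out_loc C) x = 1)"

lemma wf_pcfgD:
  assumes "wf_pcfg C"
  shows "finite (locs C)" "finite (vars C)" "trans_rel C \<subseteq> locs C \<times> locs C"
    and "init_loc C \<in> locs C" "init_val C \<in> space (val_space C)"
    and "\<tau> \<in> trans_rel C \<Longrightarrow> Measurable.pred (val_space C) (guard C \<tau>)"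
    and "\<tau> \<in> trans_rel C \<Longrightarrow> v \<in> vars C \<Longrightarrow> wf_update (vars C) (upd C \<tau> v)"
    and "l \<in> locs C \<Longrightarrow> x \<in> space (val_space C) \<Longrightarrow> \<exists>!l'. (l, l') \<in> trans_rel C \<and> guard C (l, l') x"
  using assms unfolding wf_pcfg_def by blast+


subsection \<open>Successors, runs, and the induced Markov process\<close>

abbreviation state_space :: "('l, 'v, 'z) pcfg_scheme \<Rightarrow> ('l \<times> ('v \<Rightarrow> real)) measure" where
  "state_space C \<equiv> count_space (locs C) \<Otimes>\<^sub>M val_space C"

definition sampled_vars :: "('l, 'v, 'z) pcfg_scheme \<Rightarrow> 'l \<times> 'l \<Rightarrow> 'v set" where
  "sampled_vars C \<tau> = {v \<in> vars C. is_Sampled (upd C \<tau> v)}"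

text \<open>The effect of a transition on the valuation \<open>x\<close>, given the vector \<open>z\<close> of sampled values.\<close>

definition apply_upd ::
    "('l, 'v, 'z) pcfg_scheme \<Rightarrow> 'l \<times> 'l \<Rightarrow> ('v \<Rightarrow> real) \<Rightarrow> ('v \<Rightarrow> real) \<Rightarrow> 'v \<Rightarrow> real" where
  "apply_upd C \<tau> x z =
     (\<lambda>v\<in>vars C. case upd C \<tau> v of Unchanged \<Rightarrow> x v | Assigned e \<Rightarrow> e x | Sampled d \<Rightarrow> z v)"

text \<open>The distribution of the random valuation \<open>N\<close> that results from performing a transition.\<close>

definition next_val :: "('l, 'v, 'z) pcfg_scheme \<Rightarrow> 'l \<times> 'l \<Rightarrow> ('v \<Rightarrow> real) \<Rightarrow> ('v \<Rightarrow> real) measure" where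
  "next_val C \<tau> x =
     distr (PiM (sampled_vars C \<tau>) (\<lambda>v. sample_law (upd C \<tau> v))) (val_space C) (apply_upd C \<tau> x)"

definition next_loc :: "('l, 'v, 'z) pcfg_scheme \<Rightarrow> 'l \<times> ('v \<Rightarrow> real) \<Rightarrow> 'l" where
  "next_loc C = (\<lambda>(l, x). THE l'. (l, l') \<in> trans_rel C \<and> guard C (l, l') x)"

definition step :: "('l, 'v, 'z) pcfg_scheme \<Rightarrow> 'l \<times> ('v \<Rightarrow> real) \<Rightarrow> ('l \<times> ('v \<Rightarrow> real)) measure" where
  "step C s = distr (next_val C (fst s, next_loc C s) (snd s)) (state_space C) (Pair (next_loc C s))"

text \<open>
  The law of the Markov process on \<open>nat \<Rightarrow> state\<close> with initial state \<open>(init_loc C, init_val C)\<close> and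
  transition kernel \<open>step C\<close>, as given by the theorem of Ionescu-Tulcea.
\<close>

definition init_state :: "('l, 'v, 'z) pcfg_scheme \<Rightarrow> 'l \<times> ('v \<Rightarrow> real)" where
  "init_state C = (init_loc C, init_val C)"

definition process_kernel ::
    "('l, 'v, 'z) pcfg_scheme \<Rightarrow> nat \<Rightarrow> (nat \<Rightarrow> 'l \<times> ('v \<Rightarrow> real)) \<Rightarrow> ('l \<times> ('v \<Rightarrow> real)) measure" where
  "process_kernel C n \<rho> =
     (case n of 0 \<Rightarrow> return (state_space C) (init_state C) | Suc i \<Rightarrow> step C (\<rho> i))"

definition run_measure :: "('l, 'v, 'z) pcfg_scheme \<Rightarrow> (nat \<Rightarrow> 'l \<times> ('v \<Rightarrow> real)) measure" where
  "run_measure C =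
     projective_family.lim UNIV
       (Ionescu_Tulcea.CI (process_kernel C) (\<lambda>_. state_space C)) (\<lambda>_. state_space C)"

lemma measurable_next_loc:
  assumes C: "wf_pcfg C" and l: "l \<in> locs C"
  shows "(\<lambda>x. next_loc C (l, x)) \<in> measurable (val_space C) (count_space {l'. (l, l') \<in> trans_rel C})"
proof -
  have ex: "\<exists>!l'. (l, l') \<in> trans_rel C \<and> guard C (l, l') x" if "x \<in> space (val_space C)" for x
    using wf_pcfgD(8)[OF C l that] .
  have fin: "finite {l'. (l, l') \<in> trans_rel C}"
    using wf_pcfgD(1,3)[OF C] by (auto intro: finite_subset)
  have n: "(l, next_loc C (l, x)) \<in> trans_rel C" "guard C (l, next_loc C (l, x)) x"
    and uniq: "(l, l') \<in> trans_rel C \<Longrightarrow> guard C (l, l') x \<Longrightarrow> next_loc C (l, x) = l'"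
    if "x \<in> space (val_space C)" for x l'
    using theI'[OF ex[OF that]] the1_equality[OF ex[OF that], of l'] by (simp_all add: next_loc_def)
  show ?thesis
    unfolding measurable_count_space_eq2[OF fin]
  proof (intro conjI ballI)
    show "(\<lambda>x. next_loc C (l, x)) \<in> space (val_space C) \<rightarrow> {l'. (l, l') \<in> trans_rel C}"
      using n by simp
    fix l' assume "l' \<in> {l'. (l, l') \<in> trans_rel C}"
    then have l': "(l, l') \<in> trans_rel C" by simp
    have "next_loc C (l, x) = l' \<longleftrightarrow> guard C (l, l') x" if "x \<in> space (val_space C)" for x
      using n(2)[OF that] uniq[OF that l'] by metis
    then have "(\<lambda>x. next_loc C (l, x)) -` {l'} \<inter> space (val_space C) = {x \<in> space (val_space C). guard C (l, l') x}"
      by auto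
    also have "\<dots> \<in> sets (val_space C)"
      using wf_pcfgD(6)[OF C l'] by (simp add: pred_def)
    finally show "(\<lambda>x. next_loc C (l, x)) -` {l'} \<inter> space (val_space C) \<in> sets (val_space C)" .
  qed
qed

lemma measurable_next_val:
  assumes C: "wf_pcfg C" and \<tau>: "\<tau> \<in> trans_rel C"
  shows "next_val C \<tau> \<in> measurable (val_space C) (subprob_algebra (val_space C))"
    and "x \<in> space (val_space C) \<Longrightarrow> prob_space (next_val C \<tau> x)"
proof -
  let ?S = "sampled_vars C \<tau>" and ?d = "\<lambda>v. sample_law (upd C \<tau> v)"
  let ?d' = "\<lambda>v. if v \<in> ?S then ?d v else return borel 0"
  have wf: "wf_update (vars C) (upd C \<tau> v)" if "v \<in> vars C" for v
    using wf_pcfgD(7)[OF C \<tau> that] .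
  have d: "prob_space (?d v)" "sets (?d v) = sets borel" if "v \<in> ?S" for v
    using wf[of v] that by (cases "upd C \<tau> v"; simp add: sampled_vars_def)+
  have d': "prob_space (?d' v)" for v
    using d prob_space_return[of 0 borel] by auto
  interpret product_prob_space ?d' ?S
    using d' by (auto simp: product_prob_space_def product_sigma_finite_def prob_space_imp_sigma_finite product_prob_space_axioms_def)
  have "PiM ?S ?d = PiM ?S ?d'" by (intro PiM_cong) auto
  then have ps: "prob_space (PiM ?S ?d)" using prob_space_axioms by simp
  have s: "sets (PiM ?S ?d) = sets (real_vals ?S)" using d by (intro sets_PiM_cong) auto
  have ap: "case_prod (apply_upd C \<tau>) \<in> measurable (val_space C \<Otimes>\<^sub>M PiM ?S ?d) (val_space C)"
    unfolding apply_upd_def split_beta' 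
  proof (rule measurable_restrict)
    fix v assume v: "v \<in> vars C"
    have m: "(\<lambda>z. z v) \<in> borel_measurable (PiM ?S ?d)" if "v \<in> ?S"
      using measurable_component_singleton[OF that, of ?d] d(2)[OF that] by (simp cong: measurable_cong_sets)
    show "(\<lambda>p. case upd C \<tau> v of Unchanged \<Rightarrow> fst p v | Assigned e \<Rightarrow> e (fst p) | Sampled d \<Rightarrow> snd p v)
        \<in> borel_measurable (val_space C \<Otimes>\<^sub>M PiM ?S ?d)"
    proof (cases "upd C \<tau> v")
      case Unchanged
      with v show ?thesis 
        by (auto intro: measurable_compose[OF measurable_fst measurable_component_singleton])
    next
      case (Assigned e)
      with wf[OF v] show ?thesis by (auto intro: measurable_compose[OF measurable_fst])
    next
      case (Sampled d)
      with v have "v \<in> ?S" by (simp add: sampled_vars_def)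
      with Sampled show ?thesis by (auto intro: measurable_compose[OF measurable_snd m])
    qed
  qed
  have "(\<lambda>x. distr (PiM ?S ?d) (val_space C) (apply_upd C \<tau> x)) \<in> measurable (val_space C) (subprob_algebra (val_space C))"
    by (rule measurable_distr2[OF ap], rule measurable_const)
       (simp add: space_subprob_algebra prob_space_imp_subprob_space ps)
  then show "next_val C \<tau> \<in> measurable (val_space C) (subprob_algebra (val_space C))"
    by (simp add: next_val_def[abs_def])
  show "prob_space (next_val C \<tau> x)" if "x \<in> space (val_space C)"
    unfolding next_val_def
    using measurable_compose[OF measurable_Pair1'[OF that] ap] by (intro prob_space.prob_space_distr ps) simp
qed

lemma next_loc_trans:
  assumes "wf_pcfg C" "l \<in> locs C" "x \<in> space (val_space C)"
  shows "(l, next_loc C (l, x)) \<in> trans_rel C" "next_loc C (l, x) \<in> locs C"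
  using measurable_space[OF measurable_next_loc[OF assms(1,2)] assms(3)] wf_pcfgD(3)[OF assms(1)]
  by auto

lemma measurable_step:
  assumes C: "wf_pcfg C"
  shows "step C \<in> measurable (state_space C) (subprob_algebra (state_space C))"
    and "s \<in> space (state_space C) \<Longrightarrow> prob_space (step C s)"
proof -
  have fin: "finite (locs C)" and tr: "trans_rel C \<subseteq> locs C \<times> locs C"
    using wf_pcfgD[OF C] by auto
  show "step C \<in> measurable (state_space C) (subprob_algebra (state_space C))"
  proof (rule measurable_pair_measure_countable1)
    show "countable (locs C)" using fin by (rule countable_finite)
    fix l assume l: "l \<in> locs C"
    have "(\<lambda>x. distr (next_val C (l, next_loc C (l, x)) x) (state_space C) (Pair (next_loc C (l, x))))
      \<in> measurable (val_space C) (subprob_algebra (state_space C))"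
    proof (rule measurable_compose_countable'[OF _ measurable_next_loc[OF C l],
        where f = "\<lambda>l' x. distr (next_val C (l, l') x) (state_space C) (Pair l')"])
      show "countable {l'. (l, l') \<in> trans_rel C}"
        by (rule countable_finite, rule finite_subset[OF _ fin]) (use tr in auto)
      fix l' assume l': "l' \<in> {l'. (l, l') \<in> trans_rel C}"
      then have "Pair l' \<in> measurable (val_space C) (state_space C)"
        using tr by auto
      then show "(\<lambda>x. distr (next_val C (l, l') x) (state_space C) (Pair l'))
          \<in> measurable (val_space C) (subprob_algebra (state_space C))"
        using measurable_next_val(1)[OF C, of "(l, l')"] l'
        by (intro measurable_compose[OF _ measurable_distr]) auto
    qed
    then show "(\<lambda>x. step C (l, x)) \<in> measurable (val_space C) (subprob_algebra (state_space C))"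
      by (simp add: step_def)
  qed
  assume s: "s \<in> space (state_space C)"
  then obtain l x where s': "s = (l, x)" "l \<in> locs C" "x \<in> space (val_space C)"
    by (auto simp: space_pair_measure)
  note n = next_loc_trans[OF C s'(2,3)]
  show "prob_space (step C s)"
    unfolding step_def s' fst_conv snd_conv
  proof (rule prob_space.prob_space_distr[OF measurable_next_val(2)[OF C n(1) s'(3)]])
    have "Pair (next_loc C (l, x)) \<in> measurable (val_space C) (state_space C)"
      using n(2) by auto
    then show "Pair (next_loc C (l, x)) \<in> measurable (next_val C (l, next_loc C (l, x)) x) (state_space C)"
      by (simp add: next_val_def)
  qed
qed

lemma Ionescu_Tulcea_pcfg:
  assumes C: "wf_pcfg C"
  shows "Ionescu_Tulcea (process_kernel C) (\<lambda>_. state_space C)"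
proof -
  have i: "init_state C \<in> space (state_space C)"
    using wf_pcfgD(4,5)[OF C] by (auto simp: init_state_def space_pair_measure)
  have "process_kernel C n \<in> measurable (PiM {0..<n} (\<lambda>_. state_space C)) (subprob_algebra (state_space C))" for n
  proof (cases n)
    case 0
    with i show ?thesis
      by (auto simp: process_kernel_def[abs_def] intro!: measurable_const return_measurable[THEN measurable_space])
  next
    case (Suc k)
    have "(\<lambda>\<rho>. \<rho> k) \<in> measurable (PiM {0..<n} (\<lambda>_. state_space C)) (state_space C)"
      using Suc by (intro measurable_component_singleton) simp
    from measurable_compose[OF this measurable_step(1)[OF C]] Suc show ?thesis
      by (simp add: process_kernel_def[abs_def])
  qed
  moreover have "prob_space (process_kernel C n \<rho>)" if "\<rho> \<in> space (PiM {0..<n} (\<lambda>_. state_space C))" for n \<rho>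
    using that i measurable_step(2)[OF C]
    by (cases n) (auto simp: process_kernel_def space_PiM PiE_iff intro!: prob_space_return)
  ultimately show ?thesis by (simp add: Ionescu_Tulcea_def)
qed

text \<open>
  The possible results of sampling: the atoms if the distribution is discrete, and the
  topological support otherwise.
\<close>

definition possible_values :: "real measure \<Rightarrow> real set" where
  "possible_values d =
     (if \<exists>A. countable A \<and> emeasure d A = emeasure d UNIV
      then {a. 0 < emeasure d {a}}
      else {a. \<forall>S. open S \<longrightarrow> a \<in> S \<longrightarrow> 0 < emeasure d S})"

definition successor ::
    "('l, 'v, 'z) pcfg_scheme \<Rightarrow> 'l \<times> ('v \<Rightarrow> real) \<Rightarrow> 'l \<times> ('v \<Rightarrow> real) \<Rightarrow> bool" where
  "successor C = (\<lambda>(l, x) (l', x').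
     (l, l') \<in> trans_rel C \<and> guard C (l, l') x \<and>
     (\<exists>z. (\<forall>v\<in>sampled_vars C (l, l'). z v \<in> possible_values (sample_law (upd C (l, l') v))) \<and>
          x' = apply_upd C (l, l') x z))"

definition reachable :: "('l, 'v, 'z) pcfg_scheme \<Rightarrow> 'l \<times> ('v \<Rightarrow> real) \<Rightarrow> bool" where
  "reachable C = (successor C)\<^sup>*\<^sup>* (init_state C)"

definition is_run :: "('l, 'v, 'z) pcfg_scheme \<Rightarrow> (nat \<Rightarrow> 'l \<times> ('v \<Rightarrow> real)) \<Rightarrow> bool" where
  "is_run C \<rho> \<longleftrightarrow> \<rho> 0 = init_state C \<and> (\<forall>i. successor C (\<rho> i) (\<rho> (Suc i)))"


subsection \<open>Termination, weights, and the normalized output distribution\<close>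

definition term_time :: "('l, 'v, 'z) pcfg_scheme \<Rightarrow> (nat \<Rightarrow> 'l \<times> ('v \<Rightarrow> real)) \<Rightarrow> enat" where
  "term_time C \<rho> =
     (if \<exists>i. fst (\<rho> i) = out_loc C then enat (LEAST i. fst (\<rho> i) = out_loc C) else \<infinity>)"

text \<open>The value \<open>0\<close> on non-terminating runs is a convention without relevance.\<close>

definition cum_weight :: "('l, 'v, 'z) pcfg_scheme \<Rightarrow> (nat \<Rightarrow> 'l \<times> ('v \<Rightarrow> real)) \<Rightarrow> real" where
  "cum_weight C \<rho> =
     (case term_time C \<rho> of
        enat n \<Rightarrow> (\<Prod>i<n. weight C (fst (\<rho> i), fst (\<rho> (Suc i))) (snd (\<rho> i)))
      | \<infinity> \<Rightarrow> 0)"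

definition as_terminating :: "('l, 'v, 'z) pcfg_scheme \<Rightarrow> bool" where
  "as_terminating C \<longleftrightarrow> \<P>(\<rho> in run_measure C. term_time C \<rho> < \<infinity>) = 1"

definition expected_weight :: "('l, 'v, 'z) pcfg_scheme \<Rightarrow> ennreal" where
  "expected_weight C = (\<integral>\<^sup>+\<rho>. ennreal (cum_weight C \<rho>) \<partial>run_measure C)"

definition integrable_pcfg :: "('l, 'v, 'z) pcfg_scheme \<Rightarrow> bool" where
  "integrable_pcfg C \<longleftrightarrow> 0 < expected_weight C \<and> expected_weight C < \<infinity>"

definition bounded_cum_weight :: "('l, 'v, 'z) pcfg_scheme \<Rightarrow> real \<Rightarrow> bool" where
  "bounded_cum_weight C M \<longleftrightarrow>
     0 < M \<and> (\<forall>\<rho>. is_run C \<rho> \<and> term_time C \<rho> < \<infinity> \<longrightarrow> cum_weight C \<rho> \<le> M)"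

definition output_runs ::
    "('l, 'v, 'z) pcfg_scheme \<Rightarrow> ('v \<Rightarrow> real) set \<Rightarrow> (nat \<Rightarrow> 'l \<times> ('v \<Rightarrow> real)) set" where
  "output_runs C B =
     {\<rho> \<in> space (run_measure C). \<exists>i. fst (\<rho> i) = out_loc C \<and> restrict (snd (\<rho> i)) (out_vars C) \<in> B}"

definition nod :: "('l, 'v, 'z) pcfg_scheme \<Rightarrow> ('v \<Rightarrow> real) measure" where
  "nod C = measure_of (space (out_space C)) (sets (out_space C))
     (\<lambda>B. (\<integral>\<^sup>+\<rho>. indicator (output_runs C B) \<rho> * ennreal (cum_weight C \<rho>) \<partial>run_measure C)
            / expected_weight C)"


subsection \<open>Kantorovich distance\<close>

definition lipschitz1 :: "'a set \<Rightarrow> ('a \<Rightarrow> 'a \<Rightarrow> real) \<Rightarrow> ('a \<Rightarrow> real) \<Rightarrow> bool" where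
  "lipschitz1 S d g \<longleftrightarrow> (\<forall>x\<in>S. \<forall>y\<in>S. \<bar>g x - g y\<bar> \<le> d x y)"

definition finite_first_moment :: "('a \<Rightarrow> 'a \<Rightarrow> real) \<Rightarrow> 'a measure \<Rightarrow> bool" where
  "finite_first_moment d \<mu> \<longleftrightarrow> (\<exists>x0\<in>space \<mu>. integrable \<mu> (d x0))"

text \<open>To be used for measures with the same underlying measurable space.\<close>

definition kantorovich :: "('a \<Rightarrow> 'a \<Rightarrow> real) \<Rightarrow> 'a measure \<Rightarrow> 'a measure \<Rightarrow> ereal" where
  "kantorovich d \<mu>1 \<mu>2 =
     (SUP g \<in> {g \<in> borel_measurable \<mu>1. lipschitz1 (space \<mu>1) d g}.
        ereal \<bar>(\<integral>x. g x \<partial>\<mu>1) - (\<integral>x. g x \<partial>\<mu>2)\<bar>)"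


subsection \<open>Invariants, expectation super- and submartingales, OST-soundness\<close>

definition state_function :: "('l, 'v, 'z) pcfg_scheme \<Rightarrow> ('l \<Rightarrow> ('v \<Rightarrow> real) \<Rightarrow> real) \<Rightarrow> bool" where
  "state_function C \<eta> \<longleftrightarrow> (\<forall>l\<in>locs C. \<eta> l \<in> borel_measurable (val_space C))"

definition invariant :: "('l, 'v, 'z) pcfg_scheme \<Rightarrow> ('l \<Rightarrow> ('v \<Rightarrow> real) \<Rightarrow> bool) \<Rightarrow> bool" where
  "invariant C I \<longleftrightarrow> (\<forall>l x. reachable C (l, x) \<longrightarrow> I l x)"

text \<open>
  An expectation is well defined if the positive or the negative part has a finite integral;
  its value is then an extended real number.
\<close>

definition has_expectation :: "'a measure \<Rightarrow> ('a \<Rightarrow> real) \<Rightarrow> bool" where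
  "has_expectation M g \<longleftrightarrow>
     (\<integral>\<^sup>+x. ennreal (g x) \<partial>M) < \<infinity> \<or> (\<integral>\<^sup>+x. ennreal (- g x) \<partial>M) < \<infinity>"

definition ext_expectation :: "'a measure \<Rightarrow> ('a \<Rightarrow> real) \<Rightarrow> ereal" where
  "ext_expectation M g =
     enn2ereal (\<integral>\<^sup>+x. ennreal (g x) \<partial>M) - enn2ereal (\<integral>\<^sup>+x. ennreal (- g x) \<partial>M)"

definition plus_output ::
    "('l, 'v, 'z) pcfg_scheme \<Rightarrow> (('v \<Rightarrow> real) \<Rightarrow> real) \<Rightarrow> ('l \<Rightarrow> ('v \<Rightarrow> real) \<Rightarrow> real) \<Rightarrow>
     'l \<Rightarrow> ('v \<Rightarrow> real) \<Rightarrow> real" where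
  "plus_output C f \<eta> l x = \<eta> l x + f (restrict x (out_vars C))"

definition uesm ::
    "('l, 'v, 'z) pcfg_scheme \<Rightarrow> ('l \<Rightarrow> ('v \<Rightarrow> real) \<Rightarrow> bool) \<Rightarrow> (('v \<Rightarrow> real) \<Rightarrow> real) \<Rightarrow>
     ('l \<Rightarrow> ('v \<Rightarrow> real) \<Rightarrow> real) \<Rightarrow> bool" where
  "uesm C I f U \<longleftrightarrow>
     state_function C U \<and>
     (\<forall>x\<in>space (val_space C). I (out_loc C) x \<longrightarrow> U (out_loc C) x = 0) \<and>
     (\<forall>(l, l')\<in>trans_rel C. \<forall>x\<in>space (val_space C). I l x \<and> guard C (l, l') x \<longrightarrow>
        has_expectation (next_val C (l, l') x) (plus_output C f U l') \<and>
        ereal (plus_output C f U l x) \<ge> ext_expectation (next_val C (l, l') x) (plus_output C f U l'))"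

definition lesm ::
    "('l, 'v, 'z) pcfg_scheme \<Rightarrow> ('l \<Rightarrow> ('v \<Rightarrow> real) \<Rightarrow> bool) \<Rightarrow> (('v \<Rightarrow> real) \<Rightarrow> real) \<Rightarrow>
     ('l \<Rightarrow> ('v \<Rightarrow> real) \<Rightarrow> real) \<Rightarrow> bool" where
  "lesm C I f L \<longleftrightarrow>
     state_function C L \<and>
     (\<forall>x\<in>space (val_space C). I (out_loc C) x \<longrightarrow> L (out_loc C) x = 0) \<and>
     (\<forall>(l, l')\<in>trans_rel C. \<forall>x\<in>space (val_space C). I l x \<and> guard C (l, l') x \<longrightarrow>
        has_expectation (next_val C (l, l') x) (plus_output C f L l') \<and>
        ereal (plus_output C f L l x) \<le> ext_expectation (next_val C (l, l') x) (plus_output C f L l'))"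

definition run_value ::
    "('l, 'v, 'z) pcfg_scheme \<Rightarrow> (('v \<Rightarrow> real) \<Rightarrow> real) \<Rightarrow> ('l \<Rightarrow> ('v \<Rightarrow> real) \<Rightarrow> real) \<Rightarrow>
     nat \<Rightarrow> (nat \<Rightarrow> 'l \<times> ('v \<Rightarrow> real)) \<Rightarrow> real" where
  "run_value C f \<eta> i \<rho> = plus_output C f \<eta> (fst (\<rho> i)) (snd (\<rho> i))"

text \<open>The sigma-algebra generated by the states \<open>\<rho> 0, \<dots>, \<rho> t\<close>.\<close>

definition run_filtration ::
    "('l, 'v, 'z) pcfg_scheme \<Rightarrow> nat \<Rightarrow> (nat \<Rightarrow> 'l \<times> ('v \<Rightarrow> real)) measure" where
  "run_filtration C t =
     vimage_algebra (space (run_measure C)) (\<lambda>\<rho>. restrict \<rho> {..t}) (PiM {..t} (\<lambda>_. state_space C))"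

text \<open>In the conditions below, the times \<open>t\<close> and \<open>n\<close> range over the positive integers.\<close>

definition ost_sound ::
    "('l, 'v, 'z) pcfg_scheme \<Rightarrow> ('l \<Rightarrow> ('v \<Rightarrow> real) \<Rightarrow> real) \<Rightarrow> (('v \<Rightarrow> real) \<Rightarrow> real) \<Rightarrow> bool" where
  "ost_sound C \<eta> f \<longleftrightarrow>
    (let R = run_measure C; T = term_time C; Y = run_value C f \<eta> in
     (\<forall>i. integrable R (Y i)) \<and>
     ((\<exists>c::nat. AE \<rho> in R. T \<rho> \<le> enat c) \<or>
      (\<exists>c. \<forall>t\<ge>1. \<forall>\<rho>. is_run C \<rho> \<longrightarrow> \<bar>Y (the_enat (min (enat t) (T \<rho>))) \<rho>\<bar> \<le> c) \<or>
      ((\<integral>\<^sup>+\<rho>. ennreal_of_enat (T \<rho>) \<partial>R) < \<infinity> \<and>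
       (\<exists>c. \<forall>t\<ge>1. AE \<rho> in R.
          real_cond_exp R (run_filtration C t) (\<lambda>\<rho>. \<bar>Y (t + 1) \<rho> - Y t \<rho>\<bar>) \<rho> \<le> c)) \<or>
      (\<exists>M c1 c2 d :: real. 0 < c2 \<and>
         (\<forall>\<^sub>F n in sequentially. \<P>(\<rho> in R. T \<rho> > enat n) \<le> c1 * exp (- c2 * real n)) \<and>
         (\<forall>n\<ge>1. AE \<rho> in R. \<bar>Y (n + 1) \<rho> - Y n \<rho>\<bar> \<le> M * real n powr d))))"


subsection \<open>Weighted restarting\<close>

datatype 'l restart_loc = Orig 'l | Flip | Done

fun lift_update :: "'v set \<Rightarrow> 'v var_update \<Rightarrow> 'v var_update" where
  "lift_update V Unchanged = Unchanged"
| "lift_update V (Assigned e) = Assigned (\<lambda>x. e (restrict x V))"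
| "lift_update V (Sampled d) = Sampled d"

text \<open>
  \<open>\<omega>\<close> is the weight variable and \<open>u\<close> the variable sampled uniformly from \<open>[0,1]\<close> to decide about
  restarting; both are required to be fresh where \<open>restart\<close> is used. The sampling takes place on the
  transition from \<open>Orig (out_loc C)\<close> to \<open>Flip\<close>. The initial value of \<open>u\<close> is immaterial, as \<open>u\<close> is
  only read at \<open>Flip\<close>.
\<close>

definition restart_val :: "'v \<Rightarrow> 'v \<Rightarrow> ('l, 'v) pcfg \<Rightarrow> 'v \<Rightarrow> real" where
  "restart_val \<omega> u C = (init_val C)(\<omega> := 1, u := 0)"

fun restart_guard ::
    "real \<Rightarrow> 'v \<Rightarrow> 'v \<Rightarrow> ('l, 'v) pcfg \<Rightarrow> 'l restart_loc \<times> 'l restart_loc \<Rightarrow> ('v \<Rightarrow> real) \<Rightarrow> bool" where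
  "restart_guard M \<omega> u C (Orig l, Orig l') x = guard C (l, l') (restrict x (vars C))"
| "restart_guard M \<omega> u C (Flip, Orig l') x = (x u < 1 - x \<omega> / M)"
| "restart_guard M \<omega> u C (Flip, Done) x = (\<not> x u < 1 - x \<omega> / M)"
| "restart_guard M \<omega> u C _ x = True"

fun restart_upd ::
    "'v \<Rightarrow> 'v \<Rightarrow> ('l, 'v) pcfg \<Rightarrow> 'l restart_loc \<times> 'l restart_loc \<Rightarrow> 'v \<Rightarrow> 'v var_update" where
  "restart_upd \<omega> u C (Orig l, Orig l') v =
     (if v = \<omega> then Assigned (\<lambda>x. x \<omega> * weight C (l, l') (restrict x (vars C)))
      else if v = u then Unchanged
      else lift_update (vars C) (upd C (l, l') v))"
| "restart_upd \<omega> u C (Orig l, Flip) v =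
     (if v = u then Sampled (uniform_measure lborel {0..1}) else Unchanged)"
| "restart_upd \<omega> u C (Flip, Orig l') v = Assigned (\<lambda>_. restart_val \<omega> u C v)"
| "restart_upd \<omega> u C _ v = Unchanged"

definition restart :: "real \<Rightarrow> 'v \<Rightarrow> 'v \<Rightarrow> ('l, 'v) pcfg \<Rightarrow> ('l restart_loc, 'v) pcfg" where
  "restart M \<omega> u C =
    \<lparr> locs = insert Flip (insert Done (Orig ` locs C)),
      vars = insert \<omega> (insert u (vars C)),
      out_vars = out_vars C,
      init_loc = Orig (init_loc C),
      init_val = restart_val \<omega> u C,
      trans_rel =
        {(Orig l, Orig l') | l l'. (l, l') \<in> trans_rel C \<and> l \<noteq> out_loc C} \<union>
        {(Orig (out_loc C), Flip), (Flip, Orig (init_loc C)), (Flip, Done), (Done, Done)},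
      guard = restart_guard M \<omega> u C,
      upd = restart_upd \<omega> u C,
      weight = (\<lambda>_ _. 1),
      out_loc = Done \<rparr>"

lemma wf_restart:
  fixes C :: "('l, 'v) pcfg"
  assumes C: "wf_pcfg C" and fresh: "\<omega> \<notin> vars C" "u \<notin> vars C" "\<omega> \<noteq> u"
  shows "wf_pcfg (restart M \<omega> u C)"
proof -
  let ?V = "insert \<omega> (insert u (vars C))"
  have V: "(\<lambda>x. restrict x (vars C)) \<in> measurable (real_vals ?V) (val_space C)"
    by (rule measurable_restrict_subset) auto
  have V': "restrict x (vars C) \<in> space (val_space C)" for x :: "'v \<Rightarrow> real"
    by (simp add: space_PiM)
  have om: "(\<lambda>x. x \<omega>) \<in> borel_measurable (real_vals ?V)" and uu: "(\<lambda>x. x u) \<in> borel_measurable (real_vals ?V)"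
    by (rule measurable_component_singleton; simp)+
  have flip: "Measurable.pred (real_vals ?V) (\<lambda>x. x u < 1 - x \<omega> / M)"
    "Measurable.pred (real_vals ?V) (\<lambda>x. \<not> x u < 1 - x \<omega> / M)"
    using om uu by measurable
  have lift: "wf_update ?V (lift_update (vars C) a)" if "wf_update (vars C) a" for a :: "'v var_update"
    using that measurable_compose[OF V] by (cases a) auto
  have unif: "prob_space (uniform_measure lborel {0..1::real})"
    by (rule prob_space_uniform_measure) auto
  have old: "Measurable.pred (val_space C) (guard C \<tau>)" "weight C \<tau> \<in> borel_measurable (val_space C)"
      "\<And>v. v \<in> vars C \<Longrightarrow> wf_update (vars C) (upd C \<tau> v)" if "\<tau> \<in> trans_rel C" for \<tau>
    using C that by (auto simp: wf_pcfg_def)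
  have tr: "Measurable.pred (real_vals ?V) (restart_guard M \<omega> u C \<tau>) \<and>
      (\<forall>v\<in>?V. wf_update ?V (restart_upd \<omega> u C \<tau> v))"
    if "\<tau> \<in> trans_rel (restart M \<omega> u C)" for \<tau>
  proof -
    consider l l' where "\<tau> = (Orig l, Orig l')" "(l, l') \<in> trans_rel C"
      | "\<tau> = (Orig (out_loc C), Flip)" | "\<tau> = (Flip, Orig (init_loc C))" | "\<tau> = (Flip, Done)" | "\<tau> = (Done, Done)"
      using \<open>\<tau> \<in> _\<close> by (auto simp: restart_def)
    then show ?thesis
    proof cases
      case 1
      have w: "(\<lambda>x. x \<omega> * weight C (l, l') (restrict x (vars C))) \<in> borel_measurable (real_vals ?V)"
        by (intro borel_measurable_times om measurable_compose[OF V] old 1)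
      have g: "(\<lambda>x. guard C (l, l') (restrict x (vars C))) \<in> measurable (real_vals ?V) (count_space UNIV)"
        by (intro measurable_compose[OF V] old 1)
      moreover have "restart_guard M \<omega> u C (Orig l, Orig l') = (\<lambda>x. guard C (l, l') (restrict x (vars C)))"
        by auto
      ultimately show ?thesis using 1 w old(3)[OF 1(2)] lift by auto
    next
      case 2
      moreover have "restart_guard M \<omega> u C (Orig (out_loc C), Flip) = (\<lambda>_. True)"
        by (simp add: fun_eq_iff)
      ultimately show ?thesis using unif by auto
    next
      case 3
      then have "restart_guard M \<omega> u C \<tau> = (\<lambda>x. x u < 1 - x \<omega> / M)" by auto
      with 3 flip show ?thesis by auto
    next
      case 4
      then have "restart_guard M \<omega> u C \<tau> = (\<lambda>x. \<not> x u < 1 - x \<omega> / M)" by (auto simp: fun_eq_iff)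
      with 4 flip show ?thesis by auto
    next
      case 5
      moreover have "restart_guard M \<omega> u C (Done, Done) = (\<lambda>_. True)"
        by (simp add: fun_eq_iff)
      ultimately show ?thesis by auto
    qed
  qed
  have ex: "\<exists>!l'. (l, l') \<in> trans_rel (restart M \<omega> u C) \<and> restart_guard M \<omega> u C (l, l') x"
    if l: "l \<in> locs (restart M \<omega> u C)" for l x
  proof (cases l)
    case (Orig k)
    show ?thesis
    proof (cases "k = out_loc C")
      case True
      then show ?thesis using Orig by (auto simp: restart_def)
    next
      case False
      from l Orig have "k \<in> locs C" by (auto simp: restart_def)
      with C V' have "\<exists>!l'. (k, l') \<in> trans_rel C \<and> guard C (k, l') (restrict x (vars C))"
        by (auto simp: wf_pcfg_def)
      with False Orig show ?thesis by (auto simp: restart_def)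
    qed
  next
    case Flip
    then show ?thesis
      by (cases "x u < 1 - x \<omega> / M") (auto simp: restart_def)
  next
    case Done
    then show ?thesis by (auto simp: restart_def)
  qed
  have "init_val C \<in> space (val_space C)" using C by (auto simp: wf_pcfg_def)
  then have "init_val C \<in> extensional (vars C)" by (simp add: space_PiM PiE_iff)
  then have "restart_val \<omega> u C \<in> extensional ?V" unfolding restart_val_def extensional_def by simp
  then have "restart_val \<omega> u C \<in> space (real_vals ?V)" by (simp add: space_PiM PiE_iff)
  note init = this
  have basic: "finite (locs C)" "finite (vars C)" "out_vars C \<subseteq> vars C" "init_loc C \<in> locs C"
      "out_loc C \<in> locs C" "trans_rel C \<subseteq> locs C \<times> locs C"
    using C by (simp_all add: wf_pcfg_def)
  have sub: "trans_rel (restart M \<omega> u C) \<subseteq> locs (restart M \<omega> u C) \<times> locs (restart M \<omega> u C)"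
    using basic by (auto simp: restart_def)
  have self: "(Done, l') \<in> trans_rel (restart M \<omega> u C) \<longleftrightarrow> l' = Done" for l'
    by (auto simp: restart_def)
  have sel:
    "vars (restart M \<omega> u C) = ?V" "out_vars (restart M \<omega> u C) = out_vars C"
    "guard (restart M \<omega> u C) = restart_guard M \<omega> u C" "upd (restart M \<omega> u C) = restart_upd \<omega> u C"
    "weight (restart M \<omega> u C) = (\<lambda>_ _. 1)" "init_val (restart M \<omega> u C) = restart_val \<omega> u C"
    "out_loc (restart M \<omega> u C) = Done" "init_loc (restart M \<omega> u C) = Orig (init_loc C)"
    by (simp_all add: restart_def)
  have locs: "finite (locs (restart M \<omega> u C))" "Orig (init_loc C) \<in> locs (restart M \<omega> u C)"
      "Done \<in> locs (restart M \<omega> u C)"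
    using basic by (simp_all add: restart_def)
  have tr1: "Measurable.pred (real_vals ?V) (restart_guard M \<omega> u C \<tau>)"
    if "\<tau> \<in> trans_rel (restart M \<omega> u C)" for \<tau>
    using tr[OF that] by (rule conjunct1)
  have tr2: "wf_update ?V (restart_upd \<omega> u C \<tau> v)"
    if "\<tau> \<in> trans_rel (restart M \<omega> u C)" "v \<in> ?V" for \<tau> v
    by (rule bspec[OF conjunct2[OF tr[OF that(1)]] that(2)])
  have fin: "finite ?V" using basic(2) by simp
  have out: "out_vars C \<subseteq> ?V" using basic(3) by (rule subset_insertI2[OF subset_insertI2])
  have done_upd: "restart_upd \<omega> u C (Done, Done) v = Unchanged" for v
    by simp
  show ?thesis
    unfolding wf_pcfg_def sel
    apply (intro conjI)
    apply (rule locs fin out init sub)+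
    apply (intro ballI)
    subgoal for \<tau> apply (intro conjI) apply (rule tr1, assumption) apply (intro ballI) apply (rule tr2, assumption, assumption)
      by simp_all
    subgoal by (intro ballI ex)
    subgoal by (intro allI self)
    by simp_all
qed


section \<open>Probabilistic programs\<close>

text \<open>
  A statement \<open>Label k\<close> does nothing; it marks the target of \<open>Goto k\<close>. Probabilistic branching is
  \<open>Sample\<close> followed by \<open>Cond\<close>.
\<close>

datatype 'v stmt =
    Skip
  | Assign 'v "('v \<Rightarrow> real) \<Rightarrow> real"
  | Sample 'v "real measure"
  | Observe "('v \<Rightarrow> real) \<Rightarrow> bool"
  | Score "('v \<Rightarrow> real) \<Rightarrow> real"
  | Seq "'v stmt" "'v stmt"
  | Cond "('v \<Rightarrow> real) \<Rightarrow> bool" "'v stmt" "'v stmt"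
  | While "('v \<Rightarrow> real) \<Rightarrow> bool" "'v stmt"
  | Label nat
  | Goto nat

record 'v prog =
  prog_vars :: "'v set"
  prog_out :: "'v set"
  prog_init :: "'v \<Rightarrow> real"
  prog_body :: "'v stmt"

fun wf_stmt :: "'v set \<Rightarrow> 'v stmt \<Rightarrow> bool" where
  "wf_stmt V (Assign v e) \<longleftrightarrow> v \<in> V \<and> e \<in> borel_measurable (real_vals V)"
| "wf_stmt V (Sample v d) \<longleftrightarrow> v \<in> V \<and> prob_space d \<and> sets d = sets borel"
| "wf_stmt V (Observe \<phi>) \<longleftrightarrow> Measurable.pred (real_vals V) \<phi>"
| "wf_stmt V (Score e) \<longleftrightarrow> e \<in> borel_measurable (real_vals V) \<and> (\<forall>x\<in>space (real_vals V). 0 \<le> e x)"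
| "wf_stmt V (Seq s t) \<longleftrightarrow> wf_stmt V s \<and> wf_stmt V t"
| "wf_stmt V (Cond \<phi> s t) \<longleftrightarrow> Measurable.pred (real_vals V) \<phi> \<and> wf_stmt V s \<and> wf_stmt V t"
| "wf_stmt V (While \<phi> s) \<longleftrightarrow> Measurable.pred (real_vals V) \<phi> \<and> wf_stmt V s"
| "wf_stmt V _ \<longleftrightarrow> True"

text \<open>
  The control-flow graph of a statement has one location per instruction. Its \<open>code_len\<close> many
  locations are numbered consecutively, starting with a given \<open>n\<close>, which is the entry location.
\<close>

fun code_len :: "'v stmt \<Rightarrow> nat" where
  "code_len (Seq s t) = code_len s + code_len t"
| "code_len (Cond \<phi> s t) = 1 + code_len s + code_len t"
| "code_len (While \<phi> s) = 1 + code_len s"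
| "code_len _ = 1"

fun labels :: "nat \<Rightarrow> 'v stmt \<Rightarrow> (nat \<times> nat) list" where
  "labels n (Label k) = [(k, n)]"
| "labels n (Seq s t) = labels n s @ labels (n + code_len s) t"
| "labels n (Cond \<phi> s t) = labels (n + 1) s @ labels (n + 1 + code_len s) t"
| "labels n (While \<phi> s) = labels (n + 1) s"
| "labels n _ = []"

fun gotos :: "'v stmt \<Rightarrow> nat set" where
  "gotos (Goto k) = {k}"
| "gotos (Seq s t) = gotos s \<union> gotos t"
| "gotos (Cond \<phi> s t) = gotos s \<union> gotos t"
| "gotos (While \<phi> s) = gotos s"
| "gotos _ = {}"

definition wf_prog :: "'v prog \<Rightarrow> bool" where
  "wf_prog P \<longleftrightarrow>
     finite (prog_vars P) \<and> prog_out P \<subseteq> prog_vars P \<and>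
     prog_init P \<in> space (real_vals (prog_vars P)) \<and>
     wf_stmt (prog_vars P) (prog_body P) \<and>
     distinct (map fst (labels 0 (prog_body P))) \<and>
     gotos (prog_body P) \<subseteq> fst ` set (labels 0 (prog_body P))"

text \<open>
  A location carries either an update and a weight, with a single outgoing transition, or a test
  with one target for each truth value.
\<close>

datatype 'v node =
    Exec "'v \<Rightarrow> 'v var_update" "('v \<Rightarrow> real) \<Rightarrow> real" nat
  | Test "('v \<Rightarrow> real) \<Rightarrow> bool" nat nat

abbreviation no_upd :: "'v \<Rightarrow> 'v var_update" where
  "no_upd \<equiv> (\<lambda>_. Unchanged)"

abbreviation unit_weight :: "('v \<Rightarrow> real) \<Rightarrow> real" where
  "unit_weight \<equiv> (\<lambda>_. 1)"

text \<open>
  \<open>code lab n k s\<close> lists the nodes of \<open>s\<close>, where \<open>lab\<close> resolves labels to locations, \<open>n\<close> is the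
  location of the first node, and \<open>k\<close> is the location to be entered when \<open>s\<close> is completed.
\<close>

fun code :: "(nat \<Rightarrow> nat) \<Rightarrow> nat \<Rightarrow> nat \<Rightarrow> 'v stmt \<Rightarrow> 'v node list" where
  "code lab n k Skip = [Exec no_upd unit_weight k]"
| "code lab n k (Assign v e) = [Exec (no_upd(v := Assigned e)) unit_weight k]"
| "code lab n k (Sample v d) = [Exec (no_upd(v := Sampled d)) unit_weight k]"
| "code lab n k (Observe \<phi>) = [Exec no_upd (\<lambda>x. if \<phi> x then 1 else 0) k]"
| "code lab n k (Score e) = [Exec no_upd e k]"
| "code lab n k (Seq s t) = code lab n (n + code_len s) s @ code lab (n + code_len s) k t"
| "code lab n k (Cond \<phi> s t) =
     Test \<phi> (n + 1) (n + 1 + code_len s) # code lab (n + 1) k s @ code lab (n + 1 + code_len s) k t"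
| "code lab n k (While \<phi> s) = Test \<phi> (n + 1) k # code lab (n + 1) n s"
| "code lab n k (Label j) = [Exec no_upd unit_weight k]"
| "code lab n k (Goto j) = [Exec no_upd unit_weight (lab j)]"

fun node_targets :: "'v node \<Rightarrow> nat set" where
  "node_targets (Exec g w k) = {k}"
| "node_targets (Test \<phi> j k) = {j, k}"

fun node_guard :: "'v node \<Rightarrow> nat \<Rightarrow> ('v \<Rightarrow> real) \<Rightarrow> bool" where
  "node_guard (Exec g w k) l x \<longleftrightarrow> l = k"
| "node_guard (Test \<phi> j k) l x \<longleftrightarrow> l = (if \<phi> x then j else k)"

fun node_upd :: "'v node \<Rightarrow> 'v \<Rightarrow> 'v var_update" where
  "node_upd (Exec g w k) = g"
| "node_upd (Test \<phi> j k) = no_upd"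

fun node_weight :: "'v node \<Rightarrow> ('v \<Rightarrow> real) \<Rightarrow> real" where
  "node_weight (Exec g w k) = w"
| "node_weight (Test \<phi> j k) = unit_weight"

definition prog_node :: "'v prog \<Rightarrow> nat \<Rightarrow> 'v node" where
  "prog_node P l =
     (let s = prog_body P; n = code_len s in
      if l < n then code (\<lambda>j. the (map_of (labels 0 s) j)) 0 n s ! l
      else Exec no_upd unit_weight n)"

definition cfg :: "'v prog \<Rightarrow> (nat, 'v) pcfg" where
  "cfg P =
    \<lparr> locs = {..code_len (prog_body P)},
      vars = prog_vars P,
      out_vars = prog_out P,
      init_loc = 0,
      init_val = prog_init P,
      trans_rel = {(l, l'). l \<le> code_len (prog_body P) \<and> l' \<in> node_targets (prog_node P l)},
      guard = (\<lambda>(l, l'). node_guard (prog_node P l) l'),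
      upd = (\<lambda>(l, l'). node_upd (prog_node P l)),
      weight = (\<lambda>(l, l'). node_weight (prog_node P l)),
      out_loc = code_len (prog_body P) \<rparr>"

lemma length_code [simp]: "length (code lab n k s) = code_len s"
  by (induction s arbitrary: n k) auto

fun wf_node :: "'v set \<Rightarrow> nat \<Rightarrow> 'v node \<Rightarrow> bool" where
  "wf_node V m (Exec g w k) \<longleftrightarrow> k \<le> m \<and> (\<forall>v\<in>V. wf_update V (g v)) \<and>
     w \<in> borel_measurable (real_vals V) \<and> (\<forall>x\<in>space (real_vals V). 0 \<le> w x)"
| "wf_node V m (Test \<phi> j k) \<longleftrightarrow> j \<le> m \<and> k \<le> m \<and> Measurable.pred (real_vals V) \<phi>"

lemma code_len_pos: "0 < code_len s"
  by (induction s) auto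

lemma wf_code:
  assumes "wf_stmt V s" "\<And>j. j \<in> gotos s \<Longrightarrow> lab j \<le> m" "k \<le> m" "n + code_len s \<le> m"
  shows "\<forall>a\<in>set (code lab n k s). wf_node V m a"
  using assms
proof (induction s arbitrary: n k)
  case (Observe \<phi>)
  then show ?case by (auto intro!: measurable_If)
next
  case (Seq s t)
  have "\<forall>a\<in>set (code lab n (n + code_len s) s). wf_node V m a"
    using Seq.prems by (intro Seq.IH) auto
  moreover have "\<forall>a\<in>set (code lab (n + code_len s) k t). wf_node V m a"
    using Seq.prems by (intro Seq.IH) auto
  ultimately show ?case by auto
next
  case (Cond \<phi> s t)
  have "\<forall>a\<in>set (code lab (n + 1) k s). wf_node V m a"
    using Cond.prems by (intro Cond.IH) auto
  moreover have "\<forall>a\<in>set (code lab (n + 1 + code_len s) k t). wf_node V m a"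
    using Cond.prems by (intro Cond.IH) auto
  ultimately show ?case using Cond.prems by auto
next
  case (While \<phi> s)
  have "\<forall>a\<in>set (code lab (n + 1) n s). wf_node V m a"
    using While.prems by (intro While.IH) auto
  then show ?case using While.prems by auto
qed auto

lemma labels_bound: "(j, l) \<in> set (labels n s) \<Longrightarrow> n \<le> l \<and> l < n + code_len s"
  by (induction s arbitrary: n) fastforce+

lemma wf_cfg:
  assumes P: "wf_prog P"
  shows "wf_pcfg (cfg P)"
proof -
  let ?V = "prog_vars P" and ?m = "code_len (prog_body P)"
  let ?lab = "\<lambda>j. the (map_of (labels 0 (prog_body P)) j)"
  have lab: "?lab j \<le> ?m" if "j \<in> gotos (prog_body P)" for j
  proof -
    have "j \<in> fst ` set (labels 0 (prog_body P))"
      using P that by (auto simp: wf_prog_def)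
    then obtain l where "map_of (labels 0 (prog_body P)) j = Some l"
      by (metis map_of_eq_None_iff not_None_eq)
    with labels_bound[OF map_of_SomeD] show ?thesis by fastforce
  qed
  have node: "wf_node ?V ?m (prog_node P l)" for l
  proof (cases "l < ?m")
    case True
    then have "prog_node P l \<in> set (code ?lab 0 ?m (prog_body P))"
      by (simp add: prog_node_def Let_def)
    moreover have "\<forall>a\<in>set (code ?lab 0 ?m (prog_body P)). wf_node ?V ?m a"
      using P lab by (intro wf_code) (auto simp: wf_prog_def)
    ultimately show ?thesis by blast
  qed (simp add: prog_node_def)
  have tr: "Measurable.pred (real_vals ?V) (node_guard a l') \<and>
      (\<forall>v\<in>?V. wf_update ?V (node_upd a v)) \<and>
      node_weight a \<in> borel_measurable (real_vals ?V) \<and>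
      (\<forall>x\<in>space (real_vals ?V). 0 \<le> node_weight a x)" if "wf_node ?V ?m a" for a l'
  proof (cases a)
    case (Exec g w k)
    moreover have "node_guard (Exec g w k) l' = (\<lambda>_. l' = k)" by (simp add: fun_eq_iff)
    ultimately show ?thesis using that by simp
  next
    case (Test \<phi> j k)
    moreover have "Measurable.pred (real_vals ?V) (\<lambda>x. \<phi> x \<and> l' = j \<or> \<not> \<phi> x \<and> l' = k)"
      using that Test by (intro pred_intros_logic) auto
    moreover have "node_guard a l' = (\<lambda>x. \<phi> x \<and> l' = j \<or> \<not> \<phi> x \<and> l' = k)"
      using Test by (auto simp: fun_eq_iff)
    ultimately show ?thesis by simp
  qed
  have tg: "b \<le> ?m" if "wf_node ?V ?m a" "b \<in> node_targets a" for a b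
    using that by (cases a) auto
  have ex: "\<exists>!l'. l' \<in> node_targets a \<and> node_guard a l' x" for a :: "'a node" and x
    by (cases a) auto
  have last: "prog_node P ?m = Exec no_upd unit_weight ?m"
    by (simp add: prog_node_def)
  have sel: "locs (cfg P) = {..?m}" "vars (cfg P) = ?V" "out_vars (cfg P) = prog_out P"
    "init_loc (cfg P) = 0" "init_val (cfg P) = prog_init P" "out_loc (cfg P) = ?m"
    "trans_rel (cfg P) = {(l, l'). l \<le> ?m \<and> l' \<in> node_targets (prog_node P l)}"
    "guard (cfg P) (l, l') = node_guard (prog_node P l) l'"
    "upd (cfg P) (l, l') = node_upd (prog_node P l)"
    "weight (cfg P) (l, l') = node_weight (prog_node P l)" for l l'
    by (simp_all add: cfg_def)
  have "finite ?V" "prog_out P \<subseteq> ?V" "prog_init P \<in> space (real_vals ?V)"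
    using P by (simp_all add: wf_prog_def)
  moreover have "\<exists>!l'. (l, l') \<in> trans_rel (cfg P) \<and> node_guard (prog_node P l) l' x" if "l \<le> ?m" for l x
    using ex[of "prog_node P l" x] that by (simp add: sel)
  moreover have "trans_rel (cfg P) \<subseteq> {..?m} \<times> {..?m}"
    using tg[OF node] by (auto simp: sel)
  moreover have "(?m, l') \<in> trans_rel (cfg P) \<longleftrightarrow> l' = ?m" for l'
    by (simp add: sel last)
  ultimately show ?thesis
    unfolding wf_pcfg_def
    apply (simp only: sel(1-6) finite_atMost split_paired_Ball_Sigma)
    apply (intro conjI)
    subgoal by simp
    subgoal by simp
    subgoal by simp
    subgoal by simp
    subgoal by simp
    subgoal by simp
    subgoal by simp
    subgoal by (rule ballI, case_tac \<tau>, simp only: sel(8-10)) (rule tr[OF node])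
    subgoal by (simp add: sel)
    subgoal by simp
    subgoal by (simp add: sel last)
    subgoal by (simp add: sel last)
    done
qed

end

theory Submission
  imports Defs "HOL-Real_Asymp.Real_Asymp"
begin

text \<open>
  Let \<open>a\<close> be the probability that the restarted graph terminates with output in \<open>B\<close>. Up to the first
  restart, a run of the restarted graph is a run of the original graph whose weight \<open>W\<close> is recorded in
  the variable \<open>\<omega>\<close>; it then starts afresh with probability \<open>1 - W / M\<close>. Hence
  \<open>a = E[(1 - W / M) * a + W / M * 1\<^sub>B(output)]\<close>, and solving for \<open>a\<close> gives
  \<open>a = E[1\<^sub>B(output) * W] / E[W]\<close>. So the restarted graph terminates almost surely, and its output
  distribution is the normalized output distribution of the original one. On the restarted graph the
  process \<open>\<eta> + f\<close>, stopped at termination, is a supermartingale, and OST-soundness provides an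
  integrable bound for it. By dominated convergence, its initial value is an upper bound on the
  expectation of \<open>f\<close> at the output. The lower bound follows by negation, and \<open>f\<close> then separates the
  two output distributions.
\<close>

section \<open>The Markov property\<close>

text \<open>The run measures of the two graphs are never compared directly, and no run of the
  restarted graph is cut at its restarts. Instead, \<open>hit g\<close> is harmonic for the
  restarted step kernel. Composed with \<open>embed\<close>, it becomes a bounded function of an
  original state and a weight, whose expectation along original runs stays constant in time; the
  flip is evaluated only at the exit. Taking \<open>g \<le> 1\<close> keeps the unknown finite, so
  that the restart term can be cancelled in \<open>ennreal\<close>. The constant 1 then gives
  termination, and indicators give the output law.

  A second obstacle: the weight bound, (C2) and invariants speak about runs or reachable states,
  where samples are confined to \<open>possible_values\<close>, whereas the run measure lives on all
  sequences of states. Hence the proof that almost every sequence is a run.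

  In optional stopping, the four conditions serve one purpose only, a common integrable bound for
  the stopped process: (C1) and (C2) bound it directly, (C3) and (C4) through summability of the
  expected absolute increments before termination.\<close>

locale graph =
  fixes C :: "('l, 'v, 'z) pcfg_scheme"
  assumes wf: "wf_pcfg C"
begin

abbreviation "S \<equiv> state_space C"
abbreviation "R \<equiv> run_measure C"

sublocale IT: Ionescu_Tulcea "process_kernel C" "\<lambda>_. S"
  by (rule Ionescu_Tulcea_pcfg[OF wf])

lemma run_measure_lim: "R = IT.PF.lim"
  by (simp add: run_measure_def)

lemma sets_run [measurable_cong]: "sets R = sets (PiM UNIV (\<lambda>_. S))"
  by (simp add: run_measure_lim)

lemma space_run: "space R = space (PiM UNIV (\<lambda>_. S))"
  by (rule sets_eq_imp_space_eq[OF sets_run])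

lemma run_in_space: "\<rho> \<in> space R \<Longrightarrow> \<rho> i \<in> space S"
  by (simp add: space_run space_PiM PiE_iff)

lemma measurable_run_component [measurable]: "(\<lambda>\<rho>. \<rho> i) \<in> measurable R S"
  unfolding measurable_cong_sets[OF sets_run refl] by (rule measurable_component_singleton) simp

lemma init_state_space: "init_state C \<in> space S"
  using wf_pcfgD(4,5)[OF wf] by (auto simp: init_state_def space_pair_measure)

lemmas measurable_step' [measurable] = measurable_step(1)[OF wf]

lemma prob_space_step: "s \<in> space S \<Longrightarrow> prob_space (step C s)"
  by (rule measurable_step(2)[OF wf])

lemma sets_step [measurable_cong]: "sets (step C s) = sets S"
  by (simp add: step_def)

lemma space_step: "space (step C s) = space S"
  by (simp add: step_def)

text \<open>A marginal of the projective limit is given by \<open>IT.CI\<close>, which composes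
  kernels up to the bound \<open>IT.up_to\<close> of the index set and then restricts. On an initial
  segment that bound is \<open>n\<close> and the restriction is vacuous. This is the bridge from
  \<open>R\<close> to finitely many composed kernels.\<close>

lemma distr_run_restrict:
  "distr R (PiM {0..<n} (\<lambda>_. S)) (\<lambda>\<rho>. restrict \<rho> {0..<n}) = IT.C 0 n (\<lambda>_. undefined)"
proof -
  have "IT.up_to {0..<n} = n"
    using IT.up_to_iff_Ico[of "{0..<n}" n] IT.up_to[of "{0..<n}"] by auto
  then have "IT.CI {0..<n} = distr (IT.C 0 n (\<lambda>_. undefined)) (PiM {0..<0+n} (\<lambda>_. S)) (\<lambda>\<rho>. restrict \<rho> {0..<0+n})"
    by (simp add: IT.CI_def)
  also have "\<dots> = IT.C 0 n (\<lambda>_. undefined)"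
    by (rule IT.distr_C[symmetric]) (auto simp: space_PiM)
  finally show ?thesis
    by (simp add: run_measure_lim IT.distr_lim)
qed

text \<open>The marginal on the empty segment already carries the total mass.\<close>

sublocale R: prob_space R
proof -
  have "prob_space (IT.C 0 0 (\<lambda>_. undefined))"
    by (rule IT.prob_space_C) (simp add: space_PiM)
  then have "prob_space (distr R (PiM {0..<0} (\<lambda>_. S)) (\<lambda>\<rho>. restrict \<rho> {0..<0}))"
    by (simp only: distr_run_restrict)
  moreover have "(\<lambda>\<rho>. restrict \<rho> {0..<0}) \<in> measurable R (PiM {0..<0} (\<lambda>_. S))"
    unfolding measurable_cong_sets[OF sets_run refl] by (rule measurable_restrict_subset) simp
  ultimately show "prob_space R"
    by (rule prob_space_distrD[rotated])
qed

lemma nn_integral_run_restrict: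
  assumes [measurable]: "f \<in> borel_measurable (PiM {0..<n} (\<lambda>_. S))"
  shows "(\<integral>\<^sup>+\<rho>. f (restrict \<rho> {0..<n}) \<partial>R) = (\<integral>\<^sup>+\<rho>. f \<rho> \<partial>IT.C 0 n (\<lambda>_. undefined))"
proof -
  have [measurable]: "(\<lambda>\<rho>. restrict \<rho> {0..<n}) \<in> measurable R (PiM {0..<n} (\<lambda>_. S))"
    unfolding measurable_cong_sets[OF sets_run refl] by (rule measurable_restrict_subset) simp
  show ?thesis
    unfolding distr_run_restrict[symmetric] by (subst nn_integral_distr) auto
qed

text \<open>A state is determined by its location and finitely many coordinates, since valuations
  are extensional; each of these is a measurable test.\<close>

lemma sets_singleton_init: "{s \<in> space S. s = init_state C} \<in> sets S"
proof -
  have [measurable]: "(\<lambda>s. snd s v) \<in> borel_measurable S" if "v \<in> vars C" for v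
    by (rule measurable_compose[OF measurable_snd measurable_component_singleton[OF that]])
  have [measurable]: "fst \<in> measurable S (count_space (locs C))"
    by simp
  have "{s \<in> space S. fst s = init_loc C \<and> (\<forall>v\<in>vars C. snd s v = init_val C v)} \<in> sets S"
    using wf_pcfgD(2)[OF wf] by measurable
  also have "{s \<in> space S. fst s = init_loc C \<and> (\<forall>v\<in>vars C. snd s v = init_val C v)} = {s \<in> space S. s = init_state C}"
    using wf_pcfgD(5)[OF wf]
    by (auto simp: init_state_def space_pair_measure space_PiM PiE_iff intro!: extensionalityI)
  finally show ?thesis .
qed

lemma init_run: "AE \<rho> in R. \<rho> 0 = init_state C"
proof -
  let ?P = "\<lambda>n::nat. PiM {0..<n} (\<lambda>_. S)"
  let ?g = "\<lambda>\<rho>. indicator {s \<in> space S. s \<noteq> init_state C} (\<rho> (0::nat)) :: ennreal"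
  have und: "(\<lambda>_. undefined) \<in> space (?P 0)" by (auto simp: space_PiM PiE_iff extensional_def)
  have "{s \<in> space S. s \<noteq> init_state C} = space S - {s \<in> space S. s = init_state C}" by auto
  then have bad: "{s \<in> space S. s \<noteq> init_state C} \<in> sets S" using sets_singleton_init by simp
  have m: "?g \<in> borel_measurable (?P (Suc 0))"
    using measurable_compose[OF measurable_component_singleton[of 0 "{0..<Suc 0}" "\<lambda>_. S"] borel_measurable_indicator[OF bad]]
    by simp
  have "(\<integral>\<^sup>+\<rho>. ?g \<rho> \<partial>R) = (\<integral>\<^sup>+\<rho>. ?g (restrict \<rho> {0..<Suc 0}) \<partial>R)"
    by simp
  also have "\<dots> = (\<integral>\<^sup>+\<rho>. ?g \<rho> \<partial>IT.C 0 (Suc 0) (\<lambda>_. undefined))"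
    by (rule nn_integral_run_restrict[OF m])
  also have "IT.C 0 (Suc 0) (\<lambda>_. undefined) = IT.eP 0 (\<lambda>_. undefined)"
    unfolding IT.C.simps add_0 by (rule bind_return[OF IT.measurable_eP und])
  also have "(\<integral>\<^sup>+\<rho>. ?g \<rho> \<partial>\<dots>) = (\<integral>\<^sup>+s. ?g ((\<lambda>_. undefined)(0 := s)) \<partial>process_kernel C 0 (\<lambda>_. undefined))"
    by (rule IT.nn_integral_eP[OF und m])
  also have "\<dots> = (\<integral>\<^sup>+s. indicator {s \<in> space S. s \<noteq> init_state C} s \<partial>return S (init_state C))"
    by (simp add: process_kernel_def)
  also have "\<dots> = 0"
    by (subst nn_integral_return[OF init_state_space borel_measurable_indicator[OF bad]]) simp
  finally have "AE \<rho> in R. ?g \<rho> = 0"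
    using measurable_compose[OF measurable_run_component borel_measurable_indicator[OF bad]]
    by (subst (asm) nn_integral_0_iff_AE) auto
  then show ?thesis
    by (auto elim!: AE_mp intro!: AE_I2 simp: run_in_space indicator_def split: if_splits)
qed

text \<open>Dependence on the past is expressed pointwise by \<open>dep\<close> instead of through a
  sigma-algebra, so \<open>g\<close> may contain the weight accumulated so far or the event of not
  having terminated. The proof integrates out the last of the \<open>n + 2\<close> kernels that
  generate the states up to time \<open>Suc n\<close>.\<close>

lemma markov:
  fixes g :: "(nat \<Rightarrow> 'l \<times> ('v \<Rightarrow> real)) \<Rightarrow> 'l \<times> ('v \<Rightarrow> real) \<Rightarrow> ennreal"
  assumes g [measurable]: "case_prod g \<in> borel_measurable (PiM UNIV (\<lambda>_. S) \<Otimes>\<^sub>M S)"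
    and dep: "\<And>\<rho> \<rho>' s. (\<And>i. i \<le> n \<Longrightarrow> \<rho> i = \<rho>' i) \<Longrightarrow> g \<rho> s = g \<rho>' s"
  shows "(\<integral>\<^sup>+\<rho>. g \<rho> (\<rho> (Suc n)) \<partial>R) = (\<integral>\<^sup>+\<rho>. \<integral>\<^sup>+s. g \<rho> s \<partial>step C (\<rho> n) \<partial>R)"
proof -
  let ?P = "\<lambda>n::nat. PiM {0..<n} (\<lambda>_. S)"
  \<comment> \<open>Padding by the initial state turns a finite segment into a full trajectory, on
    which \<open>g\<close> can be evaluated; by \<open>dep\<close> the padding does not affect its
    value.\<close>
  define ext where "ext = (\<lambda>\<rho> i. if i < Suc n then \<rho> i else init_state C)"
  have ext [measurable]: "ext \<in> measurable (?P m) (PiM UNIV (\<lambda>_. S))" if "Suc n \<le> m" for m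
    unfolding ext_def
  proof (rule measurable_PiM_single')
    show "(\<lambda>\<rho>. if i < Suc n then \<rho> i else init_state C) \<in> measurable (?P m) S" for i
      using that init_state_space by (cases "i < Suc n") (auto intro!: measurable_component_singleton)
  qed (use that init_state_space in \<open>auto simp: space_PiM PiE_iff\<close>)
  have ge: "g (ext \<rho>) s = g \<rho> s" for \<rho> s
    by (rule dep) (simp add: ext_def)
  have e: "Suc n \<le> m \<Longrightarrow> ext (restrict \<rho> {0..<m}) = ext \<rho>" for \<rho> m
    by (auto simp: ext_def fun_eq_iff)
  have eu: "ext (\<rho>(Suc n := s)) = ext \<rho>" for \<rho> s
    by (auto simp: ext_def fun_eq_iff)
  have und: "(\<lambda>_. undefined) \<in> space (?P 0)" by (auto simp: space_PiM PiE_iff extensional_def)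
  have comp [measurable]: "(\<lambda>\<rho>. \<rho> i) \<in> measurable (?P m) S" if "i < m" for i m
    by (rule measurable_component_singleton) (use that in simp)
  have m: "(\<lambda>\<rho>. g (ext \<rho>) (\<rho> (Suc n))) \<in> borel_measurable (?P (Suc (Suc n)))"
    using measurable_compose[OF measurable_Pair[OF ext comp] g, of "Suc (Suc n)"] by simp
  have "(\<integral>\<^sup>+\<rho>. g \<rho> (\<rho> (Suc n)) \<partial>R) =
      (\<integral>\<^sup>+\<rho>. g (ext (restrict \<rho> {0..<Suc (Suc n)})) (restrict \<rho> {0..<Suc (Suc n)} (Suc n)) \<partial>R)"
    by (simp add: ge e)
  also have "\<dots> = (\<integral>\<^sup>+\<rho>. g (ext \<rho>) (\<rho> (Suc n)) \<partial>IT.C 0 (Suc (Suc n)) (\<lambda>_. undefined))"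
    by (rule nn_integral_run_restrict[OF m])
  also have "\<dots> = (\<integral>\<^sup>+\<rho>. \<integral>\<^sup>+\<rho>'. g (ext \<rho>') (\<rho>' (Suc n)) \<partial>IT.eP (Suc n) \<rho> \<partial>IT.C 0 (Suc n) (\<lambda>_. undefined))"
    unfolding IT.C.simps(2)[of 0 "Suc n"] add_0
  proof (rule nn_integral_bind[OF m])
    show "IT.eP (Suc n) \<in> measurable (IT.C 0 (Suc n) (\<lambda>_. undefined)) (subprob_algebra (?P (Suc (Suc n))))"
      unfolding measurable_cong_sets[OF IT.sets_C[OF und] refl] add_0 by (rule IT.measurable_eP)
  qed
  also have "\<dots> = (\<integral>\<^sup>+\<rho>. \<integral>\<^sup>+s. g (ext \<rho>) s \<partial>step C (\<rho> n) \<partial>IT.C 0 (Suc n) (\<lambda>_. undefined))"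
  proof (rule nn_integral_cong)
    fix \<rho> assume "\<rho> \<in> space (IT.C 0 (Suc n) (\<lambda>_. undefined))"
    then have "\<rho> \<in> space (?P (Suc n))" using IT.space_C[OF und, of "Suc n"] by simp
    from IT.nn_integral_eP[OF this m]
    show "(\<integral>\<^sup>+\<rho>'. g (ext \<rho>') (\<rho>' (Suc n)) \<partial>IT.eP (Suc n) \<rho>) = (\<integral>\<^sup>+s. g (ext \<rho>) s \<partial>step C (\<rho> n))"
      by (simp add: eu process_kernel_def)
  qed
  also have "\<dots> = (\<integral>\<^sup>+\<rho>. \<integral>\<^sup>+s. g (ext (restrict \<rho> {0..<Suc n})) s \<partial>step C (restrict \<rho> {0..<Suc n} n) \<partial>R)"
  proof (rule nn_integral_run_restrict[symmetric])
    have "(\<lambda>(\<rho>, s). g (ext \<rho>) s) \<in> borel_measurable (?P (Suc n) \<Otimes>\<^sub>M S)"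
      using measurable_compose[OF measurable_Pair[OF measurable_compose[OF measurable_fst ext[OF order_refl]] measurable_snd] g]
      by (simp add: split_beta')
    moreover have "(\<lambda>\<rho>. step C (\<rho> n)) \<in> measurable (?P (Suc n)) (subprob_algebra S)"
      by measurable
    ultimately show "(\<lambda>\<rho>. \<integral>\<^sup>+s. g (ext \<rho>) s \<partial>step C (\<rho> n)) \<in> borel_measurable (?P (Suc n))"
      by (rule nn_integral_measurable_subprob_algebra2)
  qed
  also have "\<dots> = (\<integral>\<^sup>+\<rho>. \<integral>\<^sup>+s. g \<rho> s \<partial>step C (\<rho> n) \<partial>R)"
    by (simp add: ge e)
  finally show ?thesis .
qed

end

section \<open>Almost every trajectory is a run\<close>

text \<open>In the discrete case, all atoms lie in a countable carrier, and the remaining points of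
  the carrier are countably many null points. Otherwise, the complement of the support is the union
  of the null sets in a countable base, hence open and null.\<close>

lemma possible_values_borel:
  assumes d: "prob_space d" "sets d = sets borel"
  shows "possible_values d \<in> sets borel" "AE a in d. a \<in> possible_values d"
proof -
  interpret prob_space d by (rule d)
  have sp: "space d = UNIV" using sets_eq_imp_space_eq[OF d(2)] by simp
  have "possible_values d \<in> sets borel \<and> (AE a in d. a \<in> possible_values d)"
  proof (cases "\<exists>A. countable A \<and> emeasure d A = emeasure d UNIV")
    case True
    then obtain A where A: "countable A" "emeasure d A = emeasure d UNIV" by auto
    have Am: "B \<in> sets d" if "B \<subseteq> A" for B
      using countable_subset[OF that A(1)] unfolding d(2) by (rule sets.countable[rotated]) simp
    have nA: "AE a in d. a \<in> A"
    proof (subst AE_in_set_eq_1)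
      show "A \<in> events" by (rule Am) simp
      show "prob A = 1" using A(2) emeasure_space_1 unfolding sp by (simp add: measure_def)
    qed
    have pv: "possible_values d = {a. 0 < emeasure d {a}}"
      using True by (auto simp: possible_values_def)
    have "possible_values d \<subseteq> A"
    proof
      fix a assume "a \<in> possible_values d"
      then have "0 < emeasure d {a}" by (simp add: pv)
      then have "\<not> (AE x in d. x \<noteq> a)"
        using AE_iff_measurable[of "{a}" d "\<lambda>x. x \<noteq> a"] d(2) by (auto simp: sp)
      moreover from nA have "AE x in d. x \<noteq> a" if "a \<notin> A"
        by eventually_elim (use that in auto)
      ultimately show "a \<in> A" by blast
    qed
    then have "possible_values d \<in> sets borel" using Am d(2) by auto
    moreover have "AE x in d. \<forall>a\<in>A - possible_values d. x \<noteq> a"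
    proof (subst AE_ball_countable)
      show "countable (A - possible_values d)" using A(1) by auto
      show "\<forall>a\<in>A - possible_values d. AE x in d. x \<noteq> a"
      proof
        fix a assume "a \<in> A - possible_values d"
        then have "{a} \<in> null_sets d" using d(2) by (auto simp: pv null_sets_def)
        from AE_not_in[OF this] show "AE x in d. x \<noteq> a" by simp
      qed
    qed
    with nA have "AE a in d. a \<in> possible_values d" by eventually_elim auto
    ultimately show ?thesis by simp
  next
    case False
    then have pv: "possible_values d = {a. \<forall>S. open S \<longrightarrow> a \<in> S \<longrightarrow> 0 < emeasure d S}"
      by (auto simp: possible_values_def)
    obtain B :: "real set set" where B: "countable B" "topological_basis B"
      using ex_countable_basis by auto
    define N where "N = {U \<in> B. emeasure d U = 0}"
    have N: "countable N" "\<And>U. U \<in> N \<Longrightarrow> open U" "\<And>U. U \<in> N \<Longrightarrow> U \<in> null_sets d"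
      using B topological_basis_open[OF B(2)] d(2) by (auto simp: N_def null_sets_def)
    have eq: "possible_values d = - (\<Union>N)"
    proof (intro equalityI subsetI)
      fix a assume "a \<in> possible_values d"
      then show "a \<in> - \<Union>N" using N(2,3) unfolding pv by (fastforce simp: null_sets_def)
    next
      fix a assume a: "a \<in> - \<Union>N"
      show "a \<in> possible_values d"
        unfolding pv
      proof (intro CollectI allI impI)
        fix S assume S: "open S" "a \<in> S"
        then obtain U where U: "U \<in> B" "a \<in> U" "U \<subseteq> S"
          using topological_basisE[OF B(2)] by metis
        then have "0 < emeasure d U" using a by (auto simp: N_def zero_less_iff_neq_zero)
        also have "\<dots> \<le> emeasure d S" using S U d by (intro emeasure_mono) auto
        finally show "0 < emeasure d S" .
      qed
    qed
    have "\<Union>N \<in> null_sets d"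
      using null_sets_UN'[OF N(1), of "\<lambda>U. U" d] N(3) by auto
    from AE_not_in[OF this] have "AE a in d. a \<in> possible_values d" by (simp add: eq)
    moreover have "possible_values d \<in> sets borel" unfolding eq using N(2) by (intro borel_open borel_comp) auto
    ultimately show ?thesis by simp
  qed
  then show "possible_values d \<in> sets borel" "AE a in d. a \<in> possible_values d" by auto
qed

context graph
begin

text \<open>The indicator of the violating pairs has integral 0 under each step kernel, hence under
  \<open>R\<close> by the Markov property.\<close>

lemma AE_run_step:
  assumes Q: "Measurable.pred (S \<Otimes>\<^sub>M S) (case_prod Q)"
    and AE: "\<And>s. s \<in> space S \<Longrightarrow> AE s' in step C s. Q s s'"
  shows "AE \<rho> in R. Q (\<rho> n) (\<rho> (Suc n))"
proof -
  let ?B = "{p \<in> space (S \<Otimes>\<^sub>M S). \<not> case_prod Q p}"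
  have B [measurable]: "?B \<in> sets (S \<Otimes>\<^sub>M S)" using Q by measurable
  have m: "case_prod (\<lambda>\<rho> s. indicator ?B (\<rho> n, s) :: ennreal) \<in> borel_measurable (PiM UNIV (\<lambda>_. S) \<Otimes>\<^sub>M S)"
    by measurable
  have "(\<integral>\<^sup>+\<rho>. indicator ?B (\<rho> n, \<rho> (Suc n)) \<partial>R) = (\<integral>\<^sup>+\<rho>. \<integral>\<^sup>+s. indicator ?B (\<rho> n, s) \<partial>step C (\<rho> n) \<partial>R)"
    by (rule markov[OF m]) simp
  also have "\<dots> = (\<integral>\<^sup>+\<rho>. 0 \<partial>R)"
  proof (rule nn_integral_cong)
    fix \<rho> assume "\<rho> \<in> space R"
    from AE[OF run_in_space[OF this, of n]]
    have "AE s in step C (\<rho> n). indicator ?B (\<rho> n, s) = (0::ennreal)"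
      by eventually_elim auto
    from nn_integral_cong_AE[OF this] show "(\<integral>\<^sup>+s. indicator ?B (\<rho> n, s) \<partial>step C (\<rho> n)) = 0"
      by simp
  qed
  finally have "(\<integral>\<^sup>+\<rho>. indicator ?B (\<rho> n, \<rho> (Suc n)) \<partial>R) = 0"
    by simp
  moreover have "(\<lambda>\<rho>. indicator ?B (\<rho> n, \<rho> (Suc n)) :: ennreal) \<in> borel_measurable R"
    by measurable
  ultimately have "AE \<rho> in R. indicator ?B (\<rho> n, \<rho> (Suc n)) = (0::ennreal)"
    by (simp add: nn_integral_0_iff_AE)
  with AE_space show ?thesis
  proof eventually_elim
    case (elim \<rho>)
    then show ?case
      using run_in_space[of \<rho> n] run_in_space[of \<rho> "Suc n"]
      by (auto simp: indicator_def space_pair_measure split: if_splits)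
  qed
qed

lemma finite_trans: "finite (trans_rel C)"
  using wf_pcfgD(1,3)[OF wf] by (auto intro: finite_subset)

lemma space_S: "s \<in> space S \<longleftrightarrow> fst s \<in> locs C \<and> snd s \<in> space (val_space C)"
  by (cases s) (simp add: space_pair_measure)

lemma next_loc_trans': "s \<in> space S \<Longrightarrow> (fst s, next_loc C s) \<in> trans_rel C"
  using next_loc_trans(1)[OF wf, of "fst s" "snd s"] by (simp add: space_S)

lemma next_loc_eq:
  assumes "s \<in> space S" "(fst s, l') \<in> trans_rel C" "guard C (fst s, l') (snd s)"
  shows "next_loc C s = l'"
  unfolding next_loc_def split_beta using wf_pcfgD(8)[OF wf, of "fst s" "snd s"] assms
  by (intro the1_equality) (auto simp: space_S)

lemma guard_next_loc: "s \<in> space S \<Longrightarrow> guard C (fst s, next_loc C s) (snd s)"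
  unfolding next_loc_def split_beta using theI'[OF wf_pcfgD(8)[OF wf, of "fst s" "snd s"]] by (simp add: space_S)

lemma measurable_fst_S [measurable]: "fst \<in> measurable S (count_space (locs C))"
  by simp

lemma measurable_next_loc' [measurable]: "next_loc C \<in> measurable S (count_space (locs C))"
proof (rule measurable_pair_measure_countable1)
  show "countable (locs C)" using wf_pcfgD(1)[OF wf] by (rule countable_finite)
  fix l assume l: "l \<in> locs C"
  show "(\<lambda>x. next_loc C (l, x)) \<in> measurable (val_space C) (count_space (locs C))"
    using measurable_compose[OF measurable_next_loc[OF wf l], of "\<lambda>l. l" "count_space (locs C)"] wf_pcfgD(3)[OF wf]
    by (auto simp: measurable_count_space_eq1)
qed

lemma measurable_snd_component [measurable]:
  "v \<in> vars C \<Longrightarrow> (\<lambda>s. snd s v) \<in> borel_measurable S"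
  by (rule measurable_compose[OF measurable_snd measurable_component_singleton])

text \<open>A form of \<open>successor\<close> without the existential quantifier over sample
  vectors: the sampled values are read off the target valuation. Only finite quantifiers over
  transitions and variables remain, which makes the relation measurable.\<close>

definition follows :: "'l \<times> ('v \<Rightarrow> real) \<Rightarrow> 'l \<times> ('v \<Rightarrow> real) \<Rightarrow> bool" where
  "follows s s' \<longleftrightarrow> (\<exists>\<tau>\<in>trans_rel C. fst s = fst \<tau> \<and> next_loc C s = snd \<tau> \<and> fst s' = snd \<tau> \<and>
     (\<forall>v\<in>vars C. case upd C \<tau> v of Unchanged \<Rightarrow> snd s' v = snd s v | Assigned e \<Rightarrow> snd s' v = e (snd s)
        | Sampled d \<Rightarrow> snd s' v \<in> possible_values d))"

lemma wf_upd: "\<tau> \<in> trans_rel C \<Longrightarrow> v \<in> vars C \<Longrightarrow> wf_update (vars C) (upd C \<tau> v)"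
  using wf_pcfgD(7)[OF wf] by auto

lemma measurable_follows: "Measurable.pred (S \<Otimes>\<^sub>M S) (case_prod follows)"
proof -
  have 1: "Measurable.pred (S \<Otimes>\<^sub>M S) (\<lambda>p. case upd C \<tau> v of Unchanged \<Rightarrow> snd (snd p) v = snd (fst p) v
      | Assigned e \<Rightarrow> snd (snd p) v = e (snd (fst p))
      | Sampled d \<Rightarrow> snd (snd p) v \<in> possible_values d)" if \<tau>: "\<tau> \<in> trans_rel C" and v: "v \<in> vars C" for \<tau> v
  proof -
    note v [measurable]
    show ?thesis
    proof (cases "upd C \<tau> v")
      case Unchanged
      then show ?thesis by simp
    next
      case (Assigned e)
      then have e [measurable]: "e \<in> borel_measurable (val_space C)" using wf_upd[OF \<tau> v] by simp
      show ?thesis using Assigned by simp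
    next
      case (Sampled d)
      then have [measurable]: "possible_values d \<in> sets borel"
        using wf_upd[OF \<tau> v] possible_values_borel(1)[of d] by simp
      show ?thesis using Sampled by simp
    qed
  qed
  show ?thesis
    unfolding follows_def split_beta'
    using finite_trans wf_pcfgD(2)[OF wf] 1
    by (intro pred_intros_finite pred_intros_logic) auto
qed

lemma follows_successor:
  assumes s: "s \<in> space S" and s': "s' \<in> space S"
  shows "follows s s' \<longleftrightarrow> successor C s s'"
proof
  assume "follows s s'"
  then obtain \<tau> where \<tau>: "\<tau> \<in> trans_rel C" "fst s = fst \<tau>" "next_loc C s = snd \<tau>" "fst s' = snd \<tau>"
    and v: "\<And>v. v \<in> vars C \<Longrightarrow> case upd C \<tau> v of Unchanged \<Rightarrow> snd s' v = snd s v | Assigned e \<Rightarrow> snd s' v = e (snd s)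
        | Sampled d \<Rightarrow> snd s' v \<in> possible_values d"
    unfolding follows_def by (elim bexE conjE) (rule that, assumption+, erule bspec)
  \<comment> \<open>The target valuation itself serves as the vector of sampled values.\<close>
  have "snd s' = apply_upd C \<tau> (snd s) (snd s')"
  proof
    fix w
    show "snd s' w = apply_upd C \<tau> (snd s) (snd s') w"
    proof (cases "w \<in> vars C")
      case True
      with v[OF this] show ?thesis by (cases "upd C \<tau> w") (simp_all add: apply_upd_def)
    next
      case False
      moreover have "snd s' \<in> extensional (vars C)" using s' by (simp add: space_S space_PiM PiE_def)
      ultimately show ?thesis by (simp add: apply_upd_def extensional_def)
    qed
  qed
  moreover have "\<forall>w\<in>sampled_vars C \<tau>. snd s' w \<in> possible_values (sample_law (upd C \<tau> w))"
  proof
    fix w assume "w \<in> sampled_vars C \<tau>"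
    then show "snd s' w \<in> possible_values (sample_law (upd C \<tau> w))"
      using v[of w] by (cases "upd C \<tau> w") (simp_all add: sampled_vars_def)
  qed
  moreover have eq: "(fst s, fst s') = \<tau>" and "next_loc C s = fst s'" using \<tau>(2-4) by simp_all
  moreover from this have "guard C \<tau> (snd s)" using guard_next_loc[OF s] by metis
  ultimately show "successor C s s'"
    using \<tau>(1) unfolding successor_def split_beta eq by blast
next
  assume "successor C s s'"
  then obtain z where 1: "(fst s, fst s') \<in> trans_rel C" "guard C (fst s, fst s') (snd s)"
    and z: "\<And>v. v \<in> sampled_vars C (fst s, fst s') \<Longrightarrow> z v \<in> possible_values (sample_law (upd C (fst s, fst s') v))"
    and s'': "snd s' = apply_upd C (fst s, fst s') (snd s) z"
    unfolding successor_def split_beta by (elim conjE exE) (rule that, assumption+, erule (1) bspec)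
  have "case upd C (fst s, fst s') v of Unchanged \<Rightarrow> snd s' v = snd s v | Assigned e \<Rightarrow> snd s' v = e (snd s)
        | Sampled d \<Rightarrow> snd s' v \<in> possible_values d" if "v \<in> vars C" for v
    using z[of v] that unfolding s'' by (cases "upd C (fst s, fst s') v") (simp_all add: apply_upd_def sampled_vars_def)
  with 1 next_loc_eq[OF s 1] show "follows s s'"
    unfolding follows_def by (intro bexI[of _ "(fst s, fst s')"]) simp_all
qed

lemma sample_law_prob:
  assumes "\<tau> \<in> trans_rel C" "v \<in> sampled_vars C \<tau>"
  shows "prob_space (sample_law (upd C \<tau> v))" "sets (sample_law (upd C \<tau> v)) = sets borel"
  using wf_upd[of \<tau> v] assms by (cases "upd C \<tau> v"; simp add: sampled_vars_def)+

lemma measurable_apply_upd: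
  assumes \<tau>: "\<tau> \<in> trans_rel C" and x: "x \<in> space (val_space C)"
  shows "apply_upd C \<tau> x \<in> measurable (PiM (sampled_vars C \<tau>) (\<lambda>v. sample_law (upd C \<tau> v))) (val_space C)"
  unfolding apply_upd_def
proof (rule measurable_restrict)
  fix v assume v: "v \<in> vars C"
  show "(\<lambda>z. case upd C \<tau> v of Unchanged \<Rightarrow> x v | Assigned e \<Rightarrow> e x | Sampled d \<Rightarrow> z v)
      \<in> borel_measurable (PiM (sampled_vars C \<tau>) (\<lambda>v. sample_law (upd C \<tau> v)))"
  proof (cases "upd C \<tau> v")
    case (Sampled d)
    then have "v \<in> sampled_vars C \<tau>" using v by (simp add: sampled_vars_def)
    from measurable_component_singleton[OF this, of "\<lambda>v. sample_law (upd C \<tau> v)"] sample_law_prob(2)[OF \<tau> this] Sampled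
    show ?thesis by (simp cong: measurable_cong_sets)
  qed auto
qed

lemma measurable_Pair_loc: "l \<in> locs C \<Longrightarrow> Pair l \<in> measurable (val_space C) S"
  by simp

lemma step_eq_distr:
  assumes s: "s \<in> space S"
  shows "step C s = distr (PiM (sampled_vars C (fst s, next_loc C s)) (\<lambda>v. sample_law (upd C (fst s, next_loc C s) v))) S
    (\<lambda>z. (next_loc C s, apply_upd C (fst s, next_loc C s) (snd s) z))"
proof -
  have t: "(fst s, next_loc C s) \<in> trans_rel C" using next_loc_trans'[OF s] .
  then have l: "next_loc C s \<in> locs C" using wf_pcfgD(3)[OF wf] by auto
  have x: "snd s \<in> space (val_space C)" using s by (simp add: space_S)
  show ?thesis
    unfolding step_def next_val_def
    by (subst distr_distr[OF measurable_Pair_loc[OF l] measurable_apply_upd[OF t x]]) (simp add: comp_def)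
qed

text \<open>Each sampled coordinate lies almost surely among its possible values, and there are only
  finitely many coordinates.\<close>

lemma AE_follows:
  assumes s: "s \<in> space S"
  shows "AE s' in step C s. follows s s'"
proof -
  let ?\<tau> = "(fst s, next_loc C s)"
  let ?N = "PiM (sampled_vars C ?\<tau>) (\<lambda>v. sample_law (upd C ?\<tau> v))"
  have t: "?\<tau> \<in> trans_rel C" using next_loc_trans'[OF s] .
  then have l: "next_loc C s \<in> locs C" using wf_pcfgD(3)[OF wf] by auto
  have x: "snd s \<in> space (val_space C)" using s by (simp add: space_S)
  have "(\<lambda>s'. case_prod follows (s, s')) \<in> measurable S (count_space UNIV)"
    by (rule measurable_compose[OF measurable_Pair1'[OF s] measurable_follows])
  then have m: "{s' \<in> space S. follows s s'} \<in> sets S" by (simp add: pred_def)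
  have "AE z in ?N. \<forall>v\<in>sampled_vars C ?\<tau>. z v \<in> possible_values (sample_law (upd C ?\<tau> v))"
  proof (subst AE_ball_countable)
    show "countable (sampled_vars C ?\<tau>)"
      using wf_pcfgD(2)[OF wf] by (intro countable_finite) (simp add: sampled_vars_def)
    show "\<forall>v\<in>sampled_vars C ?\<tau>. AE z in ?N. z v \<in> possible_values (sample_law (upd C ?\<tau> v))"
      using sample_law_prob[OF t] by (intro ballI AE_PiM_component possible_values_borel(2)) auto
  qed
  then have "AE z in ?N. follows s (next_loc C s, apply_upd C ?\<tau> (snd s) z)"
  proof eventually_elim
    case (elim z)
    have "case upd C ?\<tau> v of Unchanged \<Rightarrow> apply_upd C ?\<tau> (snd s) z v = snd s v
        | Assigned e \<Rightarrow> apply_upd C ?\<tau> (snd s) z v = e (snd s)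
        | Sampled d \<Rightarrow> apply_upd C ?\<tau> (snd s) z v \<in> possible_values d" if "v \<in> vars C" for v
      using that elim[rule_format, of v] by (cases "upd C ?\<tau> v") (auto simp: apply_upd_def sampled_vars_def)
    then show ?case
      unfolding follows_def fst_conv snd_conv using t by (intro bexI[of _ ?\<tau>]) simp_all
  qed
  moreover have "(\<lambda>z. (next_loc C s, apply_upd C ?\<tau> (snd s) z)) \<in> measurable ?N S"
    by (rule measurable_compose[OF measurable_apply_upd[OF t x] measurable_Pair_loc[OF l]])
  ultimately show ?thesis
    unfolding step_eq_distr[OF s] using m by (subst AE_distr_iff) auto
qed

text \<open>This makes hypotheses on runs usable under the run measure, whose underlying space
  contains arbitrary sequences of states.\<close>

lemma AE_is_run: "AE \<rho> in R. is_run C \<rho>"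
proof -
  have "AE \<rho> in R. \<forall>n. follows (\<rho> n) (\<rho> (Suc n))"
    unfolding AE_all_countable by (intro allI AE_run_step measurable_follows AE_follows)
  with init_run AE_space show ?thesis
    by eventually_elim (auto simp: is_run_def follows_successor run_in_space)
qed

section \<open>Termination and the normalized output distribution\<close>

lemma wf_out:
  shows out_loc_in: "out_loc C \<in> locs C" and out_vars_sub: "out_vars C \<subseteq> vars C"
    and trans_out: "(out_loc C, l') \<in> trans_rel C \<longleftrightarrow> l' = out_loc C"
    and upd_out: "v \<in> vars C \<Longrightarrow> upd C (out_loc C, out_loc C) v = Unchanged"
    and weight_out: "x \<in> space (val_space C) \<Longrightarrow> weight C (out_loc C, out_loc C) x = 1"
    and weight_nonneg: "\<tau> \<in> trans_rel C \<Longrightarrow> x \<in> space (val_space C) \<Longrightarrow> 0 \<le> weight C \<tau> x"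
    and weight_measurable: "\<tau> \<in> trans_rel C \<Longrightarrow> weight C \<tau> \<in> borel_measurable (val_space C)"
  using wf unfolding wf_pcfg_def by blast+

section \<open>Absorption at the terminal location, exit time, output and weight\<close>

lemma next_loc_out: "s \<in> space S \<Longrightarrow> fst s = out_loc C \<Longrightarrow> next_loc C s = out_loc C"
  using next_loc_trans'[of s] trans_out by simp

lemma next_loc_in: "s \<in> space S \<Longrightarrow> next_loc C s \<in> locs C"
  using next_loc_trans'[of s] wf_pcfgD(3)[OF wf] by auto

lemma successor_out:
  assumes s: "s \<in> space S" "fst s = out_loc C" and "successor C s s'"
  shows "s' = s"
proof -
  obtain l' x' where s': "s' = (l', x')" by fastforce
  have l': "l' = out_loc C"
    using assms trans_out by (auto simp: s' successor_def split_beta)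
  obtain z where "x' = apply_upd C (out_loc C, out_loc C) (snd s) z"
    using assms unfolding s' l' successor_def split_beta by auto
  moreover have "snd s \<in> extensional (vars C)" using s by (simp add: space_S space_PiM PiE_def)
  ultimately have "x' = snd s"
    using upd_out by (auto simp: apply_upd_def fun_eq_iff extensional_def)
  with s' l' s show ?thesis by (simp add: prod_eq_iff)
qed

lemma run_absorbed:
  assumes "is_run C \<rho>" "\<rho> \<in> space R" "fst (\<rho> n) = out_loc C" "n \<le> m"
  shows "\<rho> m = \<rho> n"
  using \<open>n \<le> m\<close>
proof (induction m rule: dec_induct)
  case (step k)
  then show ?case
    using assms successor_out[OF run_in_space[of \<rho> k], of "\<rho> (Suc k)"] unfolding is_run_def by metis
qed simp

text \<open>A natural number in place of the \<open>enat\<close> of \<open>term_time\<close>, so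
  that it can serve as an index. Its value is meaningful only together with
  \<open>exits\<close>.\<close>

definition exit_time :: "(nat \<Rightarrow> 'l \<times> ('v \<Rightarrow> real)) \<Rightarrow> nat" where
  "exit_time \<rho> = (LEAST i. fst (\<rho> i) = out_loc C)"

definition exits :: "(nat \<Rightarrow> 'l \<times> ('v \<Rightarrow> real)) \<Rightarrow> bool" where
  "exits \<rho> \<longleftrightarrow> (\<exists>i. fst (\<rho> i) = out_loc C)"

definition run_output :: "(nat \<Rightarrow> 'l \<times> ('v \<Rightarrow> real)) \<Rightarrow> 'v \<Rightarrow> real" where
  "run_output \<rho> = restrict (snd (\<rho> (exit_time \<rho>))) (out_vars C)"

text \<open>The enabled transition is determined by its source, so the weight can be treated as a
  measurable function of a single state.\<close>

definition step_weight :: "'l \<times> ('v \<Rightarrow> real) \<Rightarrow> real" where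
  "step_weight s = weight C (fst s, next_loc C s) (snd s)"

lemma term_time_exits: "term_time C \<rho> = (if exits \<rho> then enat (exit_time \<rho>) else \<infinity>)"
  by (simp add: term_time_def exits_def exit_time_def)

lemma at_exit_time: "exits \<rho> \<Longrightarrow> fst (\<rho> (exit_time \<rho>)) = out_loc C"
  unfolding exits_def exit_time_def by (rule LeastI_ex)

lemma before_exit_time: "i < exit_time \<rho> \<Longrightarrow> fst (\<rho> i) \<noteq> out_loc C"
  unfolding exit_time_def by (rule not_less_Least)

lemma exit_time_le: "fst (\<rho> i) = out_loc C \<Longrightarrow> exit_time \<rho> \<le> i"
  unfolding exit_time_def by (rule Least_le)

lemma exited_iff:
  assumes "is_run C \<rho>" "\<rho> \<in> space R"
  shows "fst (\<rho> n) = out_loc C \<longleftrightarrow> exits \<rho> \<and> exit_time \<rho> \<le> n"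
proof
  assume "exits \<rho> \<and> exit_time \<rho> \<le> n"
  then show "fst (\<rho> n) = out_loc C"
    using run_absorbed[OF assms, of "exit_time \<rho>" n] at_exit_time[of \<rho>] by simp
qed (auto simp: exits_def exit_time_le)

lemma output_eq:
  assumes "is_run C \<rho>" "\<rho> \<in> space R" "fst (\<rho> n) = out_loc C"
  shows "run_output \<rho> = restrict (snd (\<rho> n)) (out_vars C)"
  using run_absorbed[OF assms(1,2), of "exit_time \<rho>" n] at_exit_time[of \<rho>] exited_iff[OF assms(1,2), of n] assms(3)
  by (simp add: run_output_def)

lemma measurable_at_out [measurable]: "Measurable.pred R (\<lambda>\<rho>. fst (\<rho> i) = out_loc C)"
  using out_loc_in by measurable

lemma measurable_exits [measurable]: "Measurable.pred R exits"
  unfolding exits_def by measurable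

lemma measurable_exit_time [measurable]: "exit_time \<in> measurable R (count_space UNIV)"
  unfolding exit_time_def by measurable

lemma measurable_restrict_out [measurable]: "(\<lambda>s. restrict (snd s) (out_vars C)) \<in> measurable S (out_space C)"
  by (rule measurable_compose[OF measurable_snd measurable_restrict_subset[OF out_vars_sub]])

lemma measurable_output [measurable]: "run_output \<in> measurable R (out_space C)"
  unfolding run_output_def
  by (rule measurable_compose_countable[OF _ measurable_exit_time])
     (rule measurable_compose[OF measurable_run_component measurable_restrict_out])

lemma measurable_step_weight [measurable]: "step_weight \<in> borel_measurable S"
proof (rule measurable_pair_measure_countable1)
  show "countable (locs C)" using wf_pcfgD(1)[OF wf] by (rule countable_finite)
  fix l assume l: "l \<in> locs C"
  have "(\<lambda>x. weight C (l, next_loc C (l, x)) x) \<in> borel_measurable (val_space C)"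
  proof (rule measurable_compose_countable'[OF _ measurable_next_loc[OF wf l]])
    show "countable {l'. (l, l') \<in> trans_rel C}"
      by (rule countable_finite, rule finite_subset[OF _ wf_pcfgD(1)[OF wf]]) (use wf_pcfgD(3)[OF wf] in auto)
  qed (simp add: weight_measurable)
  then show "(\<lambda>x. step_weight (l, x)) \<in> borel_measurable (val_space C)"
    by (simp add: step_weight_def)
qed

lemma step_weight_nonneg: "s \<in> space S \<Longrightarrow> 0 \<le> step_weight s"
  unfolding step_weight_def by (rule weight_nonneg[OF next_loc_trans']) (simp_all add: space_S)

lemma step_weight_out: "s \<in> space S \<Longrightarrow> fst s = out_loc C \<Longrightarrow> step_weight s = 1"
  by (simp add: step_weight_def next_loc_out weight_out space_S)

text \<open>The factors beyond the exit time are 1, as the terminal self-loop has weight 1; so every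
  index at which the run has terminated may replace the exit time.\<close>

lemma cum_weight_eq:
  assumes \<rho>: "is_run C \<rho>" "\<rho> \<in> space R" and n: "fst (\<rho> n) = out_loc C"
  shows "cum_weight C \<rho> = (\<Prod>i<n. step_weight (\<rho> i))"
proof -
  from n have e: "exits \<rho>" and le: "exit_time \<rho> \<le> n" using exited_iff[OF \<rho>] by auto
  have nl: "next_loc C (\<rho> i) = fst (\<rho> (Suc i))" for i
  proof -
    have "successor C (\<rho> i) (\<rho> (Suc i))" using \<rho> by (simp add: is_run_def)
    then have "(fst (\<rho> i), fst (\<rho> (Suc i))) \<in> trans_rel C" "guard C (fst (\<rho> i), fst (\<rho> (Suc i))) (snd (\<rho> i))"
      by (auto simp: successor_def split_beta)
    from next_loc_eq[OF run_in_space[OF \<rho>(2)] this] show ?thesis .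
  qed
  have "cum_weight C \<rho> = (\<Prod>i<exit_time \<rho>. step_weight (\<rho> i))"
    using e by (simp add: cum_weight_def term_time_exits step_weight_def nl)
  also have "\<dots> = (\<Prod>i<n. step_weight (\<rho> i))"
    using le exited_iff[OF \<rho>] e \<rho>
    by (intro prod.mono_neutral_left) (auto simp: step_weight_out run_in_space)
  finally show ?thesis .
qed

lemma cum_weight_nonneg:
  assumes \<rho>: "is_run C \<rho>" "\<rho> \<in> space R"
  shows "0 \<le> cum_weight C \<rho>"
proof (cases "exits \<rho>")
  case True
  from cum_weight_eq[OF \<rho> at_exit_time[OF this]] show ?thesis
    using run_in_space[OF \<rho>(2)] by (simp add: prod_nonneg step_weight_nonneg)
qed (simp add: cum_weight_def term_time_exits)

lemma AE_exits:
  assumes "as_terminating C"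
  shows "AE \<rho> in R. exits \<rho>"
proof -
  have "{\<rho> \<in> space R. term_time C \<rho> < \<infinity>} = {\<rho> \<in> space R. exits \<rho>}"
    by (auto simp: term_time_exits)
  then have "R.prob {\<rho> \<in> space R. exits \<rho>} = 1"
    using assms by (simp add: as_terminating_def)
  then show ?thesis
    by (subst (asm) R.prob_Collect_eq_1) auto
qed

text \<open>A stand-in for \<open>cum_weight\<close> that is visibly measurable; the two agree on
  terminating runs.\<close>

definition run_weight :: "(nat \<Rightarrow> 'l \<times> ('v \<Rightarrow> real)) \<Rightarrow> real" where
  "run_weight \<rho> = (\<Prod>i<exit_time \<rho>. step_weight (\<rho> i))"

lemma measurable_run_weight [measurable]: "run_weight \<in> borel_measurable R"
  unfolding run_weight_def
  by (rule measurable_compose_countable[OF _ measurable_exit_time]) measurable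

lemma run_weight_eq:
  assumes "is_run C \<rho>" "\<rho> \<in> space R" "exits \<rho>"
  shows "cum_weight C \<rho> = run_weight \<rho>"
  unfolding run_weight_def using cum_weight_eq[OF assms(1,2) at_exit_time[OF assms(3)]] .

lemma AE_regular:
  assumes "as_terminating C"
  shows "AE \<rho> in R. is_run C \<rho> \<and> \<rho> \<in> space R \<and> exits \<rho>"
  using AE_is_run AE_exits[OF assms] AE_space by eventually_elim simp

lemma expected_weight_eq:
  assumes "as_terminating C"
  shows "expected_weight C = (\<integral>\<^sup>+\<rho>. ennreal (run_weight \<rho>) \<partial>R)"
  unfolding expected_weight_def using AE_regular[OF assms]
  by (intro nn_integral_cong_AE, eventually_elim) (simp add: run_weight_eq)

text \<open>\<open>nod\<close> is specified by a bare set function. Recognizing it as the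
  push-forward of the run measure reweighted by \<open>W / E[W]\<close> supplies countable
  additivity, so that \<open>nod\<close> really takes the prescribed values.\<close>

lemma nod_eq:
  assumes ast: "as_terminating C"
  shows "nod C = distr (density R (\<lambda>\<rho>. ennreal (run_weight \<rho>) / expected_weight C)) (out_space C) run_output"
    (is "_ = ?N")
proof -
  have "(\<integral>\<^sup>+\<rho>. indicator (output_runs C B) \<rho> * ennreal (cum_weight C \<rho>) \<partial>R) / expected_weight C = emeasure ?N B"
    if B [measurable]: "B \<in> sets (out_space C)" for B
  proof -
    have "(\<integral>\<^sup>+\<rho>. indicator (output_runs C B) \<rho> * ennreal (cum_weight C \<rho>) \<partial>R) =
        (\<integral>\<^sup>+\<rho>. ennreal (run_weight \<rho>) * indicator (run_output -` B \<inter> space R) \<rho> \<partial>R)"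
    proof (rule nn_integral_cong_AE, use AE_regular[OF ast] in eventually_elim)
      case (elim \<rho>)
      then have \<rho>: "is_run C \<rho>" "\<rho> \<in> space R" "exits \<rho>" by auto
      \<comment> \<open>Membership asks for some terminal time with output in \<open>B\<close>; by
        absorption, all terminal times show the same output.\<close>
      have "\<rho> \<in> output_runs C B \<longleftrightarrow> run_output \<rho> \<in> B"
        unfolding output_runs_def mem_Collect_eq using \<rho> output_eq[OF \<rho>(1,2)] unfolding exits_def by metis
      then show ?case
        using \<rho> by (simp add: indicator_def run_weight_eq)
    qed
    also have "\<dots> / expected_weight C =
        (\<integral>\<^sup>+\<rho>. ennreal (run_weight \<rho>) * indicator (run_output -` B \<inter> space R) \<rho> / expected_weight C \<partial>R)"
      by (rule nn_integral_divide[symmetric]) measurable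
    also have "\<dots> = emeasure ?N B"
      by (simp add: emeasure_distr emeasure_density divide_ennreal_def ac_simps)
    finally show ?thesis .
  qed
  then have "nod C = measure_of (space (out_space C)) (sets (out_space C)) (emeasure ?N)"
    unfolding nod_def by (intro measure_of_eq) (auto simp: sets.sigma_sets_eq sets.space_closed)
  also have "\<dots> = ?N"
    using measure_of_of_measure[of ?N] by simp
  finally show ?thesis .
qed

lemma emeasure_nod:
  assumes ast: "as_terminating C" and B [measurable]: "B \<in> sets (out_space C)"
  shows "emeasure (nod C) B = (\<integral>\<^sup>+\<rho>. ennreal (run_weight \<rho>) * indicator B (run_output \<rho>) \<partial>R) / expected_weight C"
proof -
  have "emeasure (nod C) B = (\<integral>\<^sup>+\<rho>. ennreal (run_weight \<rho>) * indicator (run_output -` B \<inter> space R) \<rho> / expected_weight C \<partial>R)"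
    unfolding nod_eq[OF ast] by (simp add: emeasure_distr emeasure_density divide_ennreal_def ac_simps)
  also have "\<dots> = (\<integral>\<^sup>+\<rho>. ennreal (run_weight \<rho>) * indicator (run_output -` B \<inter> space R) \<rho> \<partial>R) / expected_weight C"
    by (rule nn_integral_divide) measurable
  also have "(\<integral>\<^sup>+\<rho>. ennreal (run_weight \<rho>) * indicator (run_output -` B \<inter> space R) \<rho> \<partial>R)
      = (\<integral>\<^sup>+\<rho>. ennreal (run_weight \<rho>) * indicator B (run_output \<rho>) \<partial>R)"
    by (intro nn_integral_cong) (simp add: indicator_def)
  finally show ?thesis .
qed

section \<open>Expectations at termination\<close>

lemma nn_integral_step:
  assumes s: "s \<in> space S" and \<phi>: "\<phi> \<in> borel_measurable S"
  shows "(\<integral>\<^sup>+s'. \<phi> s' \<partial>step C s) =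
    (\<integral>\<^sup>+z. \<phi> (next_loc C s, apply_upd C (fst s, next_loc C s) (snd s) z)
      \<partial>PiM (sampled_vars C (fst s, next_loc C s)) (\<lambda>v. sample_law (upd C (fst s, next_loc C s) v)))"
proof -
  have "(\<lambda>z. (next_loc C s, apply_upd C (fst s, next_loc C s) (snd s) z)) \<in>
      measurable (PiM (sampled_vars C (fst s, next_loc C s)) (\<lambda>v. sample_law (upd C (fst s, next_loc C s) v))) S"
    using s by (intro measurable_compose[OF measurable_apply_upd measurable_Pair_loc] next_loc_trans' next_loc_in)
      (simp_all add: space_S)
  then show ?thesis
    using nn_integral_distr[of _ _ S \<phi>] \<phi> by (simp add: step_eq_distr[OF s])
qed

lemma nn_integral_step_det:
  assumes s: "s \<in> space S" and \<phi>: "\<phi> \<in> borel_measurable S"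
    and "sampled_vars C (fst s, next_loc C s) = {}"
  shows "(\<integral>\<^sup>+s'. \<phi> s' \<partial>step C s) =
    \<phi> (next_loc C s, apply_upd C (fst s, next_loc C s) (snd s) (\<lambda>_. undefined))"
  using assms(3) by (simp add: nn_integral_step[OF s \<phi>] PiM_empty nn_integral_count_space_finite)

lemma nn_integral_step_out:
  assumes s: "s \<in> space S" "fst s = out_loc C" and \<phi>: "\<phi> \<in> borel_measurable S"
  shows "(\<integral>\<^sup>+s'. \<phi> s' \<partial>step C s) = \<phi> s"
proof -
  have "snd s \<in> extensional (vars C)" using s by (simp add: space_S space_PiM PiE_def)
  then have "apply_upd C (out_loc C, out_loc C) (snd s) z = snd s" for z
    using upd_out by (auto simp: apply_upd_def fun_eq_iff extensional_def)
  moreover have "sampled_vars C (out_loc C, out_loc C) = {}"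
    using upd_out by (auto simp: sampled_vars_def)
  moreover have "(out_loc C, snd s) = s" using s(2) by (simp add: prod_eq_iff)
  ultimately show ?thesis
    using nn_integral_step_det[OF s(1) \<phi>] unfolding next_loc_out[OF s] s(2) by simp
qed

lemma measurable_nn_integral_step [measurable]:
  assumes "\<phi> \<in> borel_measurable S"
  shows "(\<lambda>s. \<integral>\<^sup>+s'. \<phi> s' \<partial>step C s) \<in> borel_measurable S"
  using assms by measurable

text \<open>\<open>hit g s\<close> is the expectation of \<open>g\<close> at the output of a run that starts in the state \<open>s\<close>,
  where a diverging run contributes \<open>0\<close>.\<close>

primrec hitn :: "(('v \<Rightarrow> real) \<Rightarrow> ennreal) \<Rightarrow> nat \<Rightarrow> 'l \<times> ('v \<Rightarrow> real) \<Rightarrow> ennreal" where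
  "hitn g 0 s = (if fst s = out_loc C then g (restrict (snd s) (out_vars C)) else 0)"
| "hitn g (Suc n) s = (\<integral>\<^sup>+s'. hitn g n s' \<partial>step C s)"

definition hit :: "(('v \<Rightarrow> real) \<Rightarrow> ennreal) \<Rightarrow> 'l \<times> ('v \<Rightarrow> real) \<Rightarrow> ennreal" where
  "hit g s = (SUP n. hitn g n s)"

context
  fixes g :: "('v \<Rightarrow> real) \<Rightarrow> ennreal"
  assumes g [measurable]: "g \<in> borel_measurable (out_space C)"
begin

lemma measurable_hitn [measurable]: "hitn g n \<in> borel_measurable S"
proof (induction n)
  case 0
  have "(\<lambda>s. if fst s = out_loc C then g (restrict (snd s) (out_vars C)) else 0) \<in> borel_measurable S"
    using out_loc_in by measurable
  then show ?case by (simp add: fun_eq_iff[symmetric] cong: measurable_cong)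
next
  case (Suc n)
  from measurable_nn_integral_step[OF this] show ?case
    by (simp cong: measurable_cong)
qed

lemma measurable_hit [measurable]: "hit g \<in> borel_measurable S"
  unfolding hit_def[abs_def] by measurable

lemma hitn_out: "s \<in> space S \<Longrightarrow> fst s = out_loc C \<Longrightarrow> hitn g n s = g (restrict (snd s) (out_vars C))"
  by (induction n) (simp_all add: nn_integral_step_out measurable_hitn)

lemma hit_out: "s \<in> space S \<Longrightarrow> fst s = out_loc C \<Longrightarrow> hit g s = g (restrict (snd s) (out_vars C))"
  by (simp add: hit_def hitn_out)

lemma hitn_mono: "s \<in> space S \<Longrightarrow> hitn g n s \<le> hitn g (Suc n) s"
proof (induction n arbitrary: s)
  case 0
  then show ?case
    using hitn_out[OF 0, of 0] hitn_out[OF 0, of "Suc 0"] by (cases "fst s = out_loc C") auto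
next
  case (Suc n)
  then show ?case
    using Suc.IH by (subst (1 2) hitn.simps(2)) (intro nn_integral_mono, simp add: space_step)
qed

text \<open>Harmonicity: \<open>hitn\<close> increases with the number of steps, so monotone
  convergence carries its recursion over to the supremum.\<close>

lemma hit_step:
  assumes s: "s \<in> space S"
  shows "hit g s = (\<integral>\<^sup>+s'. hit g s' \<partial>step C s)"
proof -
  have "(\<integral>\<^sup>+s'. hit g s' \<partial>step C s) = (SUP n. \<integral>\<^sup>+s'. hitn g n s' \<partial>step C s)"
    unfolding hit_def
    by (rule nn_integral_monotone_convergence_SUP_AE)
       (auto intro!: AE_I2 hitn_mono simp: space_step measurable_cong_sets[OF sets_step refl] simp del: hitn.simps)
  also have "\<dots> = (SUP n. hitn g (Suc n) s)" by simp
  also have "\<dots> = hit g s"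
    unfolding hit_def
  proof (rule antisym)
    show "(SUP n. hitn g (Suc n) s) \<le> (SUP n. hitn g n s)"
      by (rule SUP_mono) blast
    show "(SUP n. hitn g n s) \<le> (SUP n. hitn g (Suc n) s)"
      using hitn_mono[OF s] by (intro SUP_mono) blast
  qed
  finally show ?thesis ..
qed

lemma hitn_le: "(\<And>x. g x \<le> c) \<Longrightarrow> s \<in> space S \<Longrightarrow> hitn g n s \<le> c"
proof (induction n arbitrary: s)
  case (Suc n)
  interpret K: prob_space "step C s" using prob_space_step Suc by simp
  have "hitn g (Suc n) s \<le> (\<integral>\<^sup>+s'. c \<partial>step C s)"
    using Suc by (subst hitn.simps(2)) (intro nn_integral_mono, simp add: space_step)
  then show ?case by (simp add: K.emeasure_space_1)
qed simp

lemma hit_le: "(\<And>x. g x \<le> c) \<Longrightarrow> s \<in> space S \<Longrightarrow> hit g s \<le> c"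
  unfolding hit_def by (intro SUP_least hitn_le)

text \<open>Each use of the Markov property trades one step of the run for one kernel application,
  which raises \<open>k\<close>; the induction therefore needs arbitrary \<open>k\<close>.\<close>

lemma nn_integral_hitn_run: "(\<integral>\<^sup>+\<rho>. hitn g k (\<rho> n) \<partial>R) = hitn g (k + n) (init_state C)"
proof (induction n arbitrary: k)
  case 0
  have "(\<integral>\<^sup>+\<rho>. hitn g k (\<rho> 0) \<partial>R) = (\<integral>\<^sup>+\<rho>. hitn g k (init_state C) \<partial>R)"
    using init_run by (intro nn_integral_cong_AE) auto
  then show ?case by (simp add: R.emeasure_space_1)
next
  case (Suc n)
  have "(\<integral>\<^sup>+\<rho>. hitn g k (\<rho> (Suc n)) \<partial>R) = (\<integral>\<^sup>+\<rho>. \<integral>\<^sup>+s. hitn g k s \<partial>step C (\<rho> n) \<partial>R)"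
    by (rule markov) auto
  also have "\<dots> = hitn g (Suc k + n) (init_state C)"
    using Suc[of "Suc k"] by simp
  finally show ?case by simp
qed

text \<open>This connects \<open>hit\<close>, defined by kernels alone, to the run measure. Along a
  run, \<open>hitn g 0\<close> is 0 until termination and equals \<open>g\<close> of the output from
  then on, so it increases to the integrand on the right.\<close>

lemma hit_init: "hit g (init_state C) = (\<integral>\<^sup>+\<rho>. (if exits \<rho> then g (run_output \<rho>) else 0) \<partial>R)"
proof -
  have "hit g (init_state C) = (SUP n. \<integral>\<^sup>+\<rho>. hitn g 0 (\<rho> n) \<partial>R)"
    unfolding hit_def nn_integral_hitn_run by simp
  also have "\<dots> = (\<integral>\<^sup>+\<rho>. (SUP n. hitn g 0 (\<rho> n)) \<partial>R)"
  proof (rule nn_integral_monotone_convergence_SUP_AE[symmetric])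
    show "AE \<rho> in R. hitn g 0 (\<rho> n) \<le> hitn g 0 (\<rho> (Suc n))" for n
      using AE_is_run AE_space
    proof eventually_elim
      case (elim \<rho>)
      show ?case
      proof (cases "fst (\<rho> n) = out_loc C")
        case True
        with run_absorbed[OF elim True, of "Suc n"] show ?thesis by simp
      qed simp
    qed
  qed measurable
  also have "\<dots> = (\<integral>\<^sup>+\<rho>. (if exits \<rho> then g (run_output \<rho>) else 0) \<partial>R)"
  proof (rule nn_integral_cong_AE, use AE_is_run AE_space in eventually_elim)
    case (elim \<rho>)
    note out = exited_iff[OF elim] output_eq[OF elim]
    show ?case
    proof (cases "exits \<rho>")
      case True
      have "(SUP n. hitn g 0 (\<rho> n)) = g (run_output \<rho>)"
      proof (rule antisym)
        show "(SUP n. hitn g 0 (\<rho> n)) \<le> g (run_output \<rho>)"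
          using out(2) by (intro SUP_least) auto
        show "g (run_output \<rho>) \<le> (SUP n. hitn g 0 (\<rho> n))"
          using at_exit_time[OF True] by (intro SUP_upper2[of "exit_time \<rho>"]) (auto simp: run_output_def)
      qed
      with True show ?thesis by simp
    qed (auto simp: exits_def)
  qed
  finally show ?thesis .
qed

end

text \<open>By \<open>step\<close>, the expectation of \<open>F\<close> at the current state and
  accumulated weight does not change with time. Both arguments freeze at termination, so the
  integrand is eventually constant along almost every run, and the bound 1 permits passing to the
  limit. It is used with \<open>F\<close> taken from the restarted graph, where the second argument
  plays the part of the weight variable.\<close>

lemma weighted_stopping:
  fixes F :: "'l \<times> ('v \<Rightarrow> real) \<Rightarrow> real \<Rightarrow> ennreal"
  assumes ast: "as_terminating C"
    and F [measurable]: "case_prod F \<in> borel_measurable (S \<Otimes>\<^sub>M borel)"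
    and bound: "\<And>s w. s \<in> space S \<Longrightarrow> F s w \<le> 1"
    and step: "\<And>s w. s \<in> space S \<Longrightarrow> F s w = (\<integral>\<^sup>+s'. F s' (w * step_weight s) \<partial>step C s)"
  shows "F (init_state C) 1 = (\<integral>\<^sup>+\<rho>. F (\<rho> (exit_time \<rho>)) (run_weight \<rho>) \<partial>R)"
proof -
  define W :: "nat \<Rightarrow> (nat \<Rightarrow> 'l \<times> ('v \<Rightarrow> real)) \<Rightarrow> real" where "W n \<rho> = (\<Prod>i<n. step_weight (\<rho> i))" for n \<rho>
  have Wm [measurable]: "W n \<in> borel_measurable R" for n
    unfolding W_def by measurable
  have const: "F (init_state C) 1 = (\<integral>\<^sup>+\<rho>. F (\<rho> n) (W n \<rho>) \<partial>R)" for n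
  proof (induction n)
    case 0
    have "(\<integral>\<^sup>+\<rho>. F (\<rho> 0) (W 0 \<rho>) \<partial>R) = (\<integral>\<^sup>+\<rho>. F (init_state C) 1 \<partial>R)"
      using init_run by (intro nn_integral_cong_AE) (auto simp: W_def)
    then show ?case by (simp add: R.emeasure_space_1)
  next
    case (Suc n)
    \<comment> \<open>\<open>W (Suc n)\<close> involves only the states up to time \<open>n\<close>,
      as a step weight is determined by the source state. It thus belongs to the past in the Markov
      property.\<close>
    have [measurable]: "W (Suc n) \<in> borel_measurable (PiM UNIV (\<lambda>_. S))"
      using Wm by (simp add: measurable_cong_sets[OF sets_run refl])
    have "(\<integral>\<^sup>+\<rho>. F (\<rho> (Suc n)) (W (Suc n) \<rho>) \<partial>R) = (\<integral>\<^sup>+\<rho>. \<integral>\<^sup>+s. F s (W (Suc n) \<rho>) \<partial>step C (\<rho> n) \<partial>R)"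
    proof (rule markov)
      show "(\<lambda>(\<rho>, s). F s (W (Suc n) \<rho>)) \<in> borel_measurable (PiM UNIV (\<lambda>_. S) \<Otimes>\<^sub>M S)"
        by measurable
    qed (simp add: W_def)
    also have "\<dots> = (\<integral>\<^sup>+\<rho>. F (\<rho> n) (W n \<rho>) \<partial>R)"
      by (intro nn_integral_cong) (simp add: step[OF run_in_space, of _ n] W_def mult.commute)
    finally show ?case using Suc by simp
  qed
  have "(\<lambda>n. \<integral>\<^sup>+\<rho>. F (\<rho> n) (W n \<rho>) \<partial>R) \<longlonglongrightarrow> (\<integral>\<^sup>+\<rho>. F (\<rho> (exit_time \<rho>)) (run_weight \<rho>) \<partial>R)"
  proof (rule nn_integral_dominated_convergence[where w = "\<lambda>_. 1"])
    show "AE \<rho> in R. F (\<rho> n) (W n \<rho>) \<le> 1" for n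
      by (intro AE_I2 bound run_in_space)
    show "AE \<rho> in R. (\<lambda>n. F (\<rho> n) (W n \<rho>)) \<longlonglongrightarrow> F (\<rho> (exit_time \<rho>)) (run_weight \<rho>)"
      using AE_regular[OF ast]
    proof eventually_elim
      case (elim \<rho>)
      then have \<rho>: "is_run C \<rho>" "\<rho> \<in> space R" "exits \<rho>" by auto
      have "F (\<rho> n) (W n \<rho>) = F (\<rho> (exit_time \<rho>)) (run_weight \<rho>)" if "exit_time \<rho> \<le> n" for n
        using that \<rho> run_absorbed[OF \<rho>(1,2) at_exit_time[OF \<rho>(3)] that] exited_iff[OF \<rho>(1,2), of n]
          cum_weight_eq[OF \<rho>(1,2), of n] by (simp add: W_def run_weight_eq)
      then show ?case
        by (intro tendsto_eventually eventually_sequentiallyI[of "exit_time \<rho>"])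
    qed
    show "(\<lambda>\<rho>. F (\<rho> (exit_time \<rho>)) (run_weight \<rho>)) \<in> borel_measurable R"
      by (rule measurable_compose_countable[OF _ measurable_exit_time]) measurable
  qed (auto simp: R.emeasure_space_1)
  with const show ?thesis
    by (simp add: LIMSEQ_const_iff)
qed

end

section \<open>Weighted restarting\<close>

locale restarted = graph C for C :: "('l, 'v) pcfg" +
  fixes M :: real and \<omega> u :: 'v
  assumes fresh: "\<omega> \<notin> vars C" "u \<notin> vars C" "\<omega> \<noteq> u"
    and M_pos: "0 < M"
begin

section \<open>The step kernel of the restarted graph on embedded states\<close>

sublocale Res: graph "restart M \<omega> u C"
  by unfold_locales (rule wf_restart[OF wf fresh])

lemma restart_sel:
  "vars (restart M \<omega> u C) = insert \<omega> (insert u (vars C))" "out_vars (restart M \<omega> u C) = out_vars C"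
  "guard (restart M \<omega> u C) = restart_guard M \<omega> u C" "upd (restart M \<omega> u C) = restart_upd \<omega> u C"
  "init_val (restart M \<omega> u C) = restart_val \<omega> u C"
  "out_loc (restart M \<omega> u C) = Done" "init_loc (restart M \<omega> u C) = Orig (init_loc C)"
  "locs (restart M \<omega> u C) = insert Flip (insert Done (Orig ` locs C))"
  by (simp_all add: restart_def)

text \<open>The value 0 for \<open>u\<close> loses nothing along runs: transitions between original
  locations leave \<open>u\<close> unchanged, and every restart resets it to 0. It is sampled only
  on leaving the old terminal location.\<close>

definition embed :: "'l \<times> ('v \<Rightarrow> real) \<Rightarrow> real \<Rightarrow> 'l restart_loc \<times> ('v \<Rightarrow> real)" where
  "embed s w = (Orig (fst s), (snd s)(\<omega> := w, u := 0))"

lemma extend_space: "x \<in> space (val_space C) \<Longrightarrow> x(\<omega> := w, u := v) \<in> space (val_space (restart M \<omega> u C))"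
  by (auto simp: restart_sel space_PiM PiE_iff extensional_def)

lemma restrict_extend: "x \<in> space (val_space C) \<Longrightarrow> restrict (x(\<omega> := w, u := v)) (vars C) = x"
  using fresh by (auto simp: space_PiM PiE_iff extensional_def fun_eq_iff)

lemma restrict_extend_out: "restrict (x(\<omega> := w, u := v)) (out_vars C) = restrict x (out_vars C)"
  using fresh out_vars_sub by (auto simp: fun_eq_iff)

lemma embed_space: "s \<in> space S \<Longrightarrow> embed s w \<in> space Res.S"
  using extend_space[of "snd s"] unfolding embed_def Res.space_S space_S
  by (simp add: restart_sel(8))

lemma restart_trans_Orig:
  "l \<noteq> out_loc C \<Longrightarrow> (l, l') \<in> trans_rel C \<Longrightarrow> (Orig l, Orig l') \<in> trans_rel (restart M \<omega> u C)"
  by (simp add: restart_def)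

lemma next_loc_embed:
  assumes s: "s \<in> space S" and "fst s \<noteq> out_loc C"
  shows "next_loc (restart M \<omega> u C) (embed s w) = Orig (next_loc C s)"
proof (rule Res.next_loc_eq[OF embed_space[OF s]])
  show "(fst (embed s w), Orig (next_loc C s)) \<in> trans_rel (restart M \<omega> u C)"
    using assms by (simp add: embed_def restart_trans_Orig next_loc_trans')
  show "guard (restart M \<omega> u C) (fst (embed s w), Orig (next_loc C s)) (snd (embed s w))"
    using guard_next_loc[OF s] s by (simp add: restart_sel embed_def restrict_extend space_S del: fun_upd_apply)
qed

lemma sampled_vars_Orig: "sampled_vars (restart M \<omega> u C) (Orig l, Orig l') = sampled_vars C (l, l')"
proof -
  have "is_Sampled (lift_update V a) = is_Sampled a" for V and a :: "'v var_update"
    by (cases a) auto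
  with fresh show ?thesis by (auto simp: sampled_vars_def restart_sel)
qed

lemma sample_law_Orig:
  "v \<in> sampled_vars C (l, l') \<Longrightarrow> sample_law (restart_upd \<omega> u C (Orig l, Orig l') v) = sample_law (upd C (l, l') v)"
  using fresh by (cases "upd C (l, l') v") (auto simp: sampled_vars_def)

lemma apply_upd_Orig:
  assumes x: "x \<in> space (val_space C)"
  shows "apply_upd (restart M \<omega> u C) (Orig l, Orig l') (x(\<omega> := w, u := 0)) z =
    (apply_upd C (l, l') x z)(\<omega> := w * weight C (l, l') x, u := 0)"
proof
  fix v
  consider "v = \<omega>" | "v = u" | "v \<in> vars C" "v \<noteq> \<omega>" "v \<noteq> u" | "v \<notin> vars C" "v \<noteq> \<omega>" "v \<noteq> u" by blast
  then show "apply_upd (restart M \<omega> u C) (Orig l, Orig l') (x(\<omega> := w, u := 0)) z v =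
    ((apply_upd C (l, l') x z)(\<omega> := w * weight C (l, l') x, u := 0)) v"
  proof cases
    case 1
    then show ?thesis using fresh restrict_extend[OF x, of w 0] by (simp add: apply_upd_def restart_sel)
  next
    case 3
    then show ?thesis
      using restrict_extend[OF x, of w 0] by (cases "upd C (l, l') v") (simp_all add: apply_upd_def restart_sel)
  qed (use fresh in \<open>simp_all add: apply_upd_def restart_sel\<close>)
qed

lemma measurable_embed [measurable]: "case_prod embed \<in> measurable (S \<Otimes>\<^sub>M borel) Res.S"
proof -
  have 1: "(\<lambda>p. Orig (fst (fst p))) \<in> measurable (S \<Otimes>\<^sub>M borel) (count_space (insert Flip (insert Done (Orig ` locs C))))"
  proof -
    have "Orig \<in> measurable (count_space (locs C)) (count_space (insert Flip (insert Done (Orig ` locs C))))"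
      by simp
    from measurable_compose[OF measurable_compose[OF measurable_fst measurable_fst_S] this] show ?thesis .
  qed
  let ?f = "\<lambda>v p. if v = u then 0 else if v = \<omega> then snd p else snd (fst p) v"
  have 2: "(\<lambda>p v. ?f v p) \<in> measurable (S \<Otimes>\<^sub>M borel) (real_vals (insert \<omega> (insert u (vars C))))"
  proof (rule measurable_PiM_single'[where f = ?f])
    fix v assume v: "v \<in> insert \<omega> (insert u (vars C))"
    show "?f v \<in> borel_measurable (S \<Otimes>\<^sub>M borel)"
    proof (cases "v \<in> vars C")
      case True
      from measurable_compose[OF measurable_fst measurable_snd_component[OF this]]
      have "(\<lambda>p. snd (fst p) v) \<in> borel_measurable (S \<Otimes>\<^sub>M borel)" .
      moreover have "v \<noteq> u" "v \<noteq> \<omega>" using fresh True by auto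
      ultimately show ?thesis by (simp only: if_False)
    next
      case False
      with v have "v = u \<or> v = \<omega>" by blast
      then show ?thesis using fresh(3) by auto
    qed
  next
    show "(\<lambda>p v. ?f v p) \<in> space (S \<Otimes>\<^sub>M borel) \<rightarrow> (\<Pi>\<^sub>E v\<in>insert \<omega> (insert u (vars C)). space borel)"
    proof
      fix p :: "('l \<times> ('v \<Rightarrow> real)) \<times> real"
      assume "p \<in> space (S \<Otimes>\<^sub>M borel)"
      then have "fst p \<in> space S" by (simp add: space_pair_measure mem_Times_iff)
      then have "snd (fst p) \<in> extensional (vars C)" by (simp add: space_S space_PiM PiE_def)
      then show "(\<lambda>v. ?f v p) \<in> (\<Pi>\<^sub>E v\<in>insert \<omega> (insert u (vars C)). space borel)"
        by (simp add: PiE_iff extensional_def)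
    qed
  qed
  have "case_prod embed = (\<lambda>p. (Orig (fst (fst p)), \<lambda>v. ?f v p))"
    unfolding embed_def fun_upd_def split_beta' ..
  then show ?thesis
    using measurable_Pair[OF 1 2] by (simp only: restart_sel)
qed

text \<open>Away from the old terminal location, \<open>embed\<close> intertwines the two kernels:
  the same variables are sampled from the same laws, and \<open>\<omega>\<close> picks up the weight
  of the transition.\<close>

lemma nn_integral_step_embed:
  assumes s: "s \<in> space S" and nout: "fst s \<noteq> out_loc C" and \<phi>: "\<phi> \<in> borel_measurable Res.S"
  shows "(\<integral>\<^sup>+t. \<phi> t \<partial>step (restart M \<omega> u C) (embed s w)) = (\<integral>\<^sup>+s'. \<phi> (embed s' (w * step_weight s)) \<partial>step C s)"
proof -
  let ?\<tau> = "(fst s, next_loc C s)"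
  have x: "snd s \<in> space (val_space C)" using s by (simp add: space_S)
  have fe: "fst (embed s w) = Orig (fst s)" "snd (embed s w) = (snd s)(\<omega> := w, u := 0)"
    by (simp_all add: embed_def)
  have m: "(\<lambda>s'. \<phi> (embed s' (w * step_weight s))) \<in> borel_measurable S"
    using measurable_compose[OF measurable_compose[OF measurable_Pair2' measurable_embed] \<phi>, of "w * step_weight s"]
    by simp
  have "(\<integral>\<^sup>+t. \<phi> t \<partial>step (restart M \<omega> u C) (embed s w)) =
      (\<integral>\<^sup>+z. \<phi> (Orig (next_loc C s), (apply_upd C ?\<tau> (snd s) z)(\<omega> := w * step_weight s, u := 0))
        \<partial>PiM (sampled_vars C ?\<tau>) (\<lambda>v. sample_law (restart_upd \<omega> u C (Orig (fst s), Orig (next_loc C s)) v)))"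
    unfolding Res.nn_integral_step[OF embed_space[OF s] \<phi>] next_loc_embed[OF s nout] fe
      apply_upd_Orig[OF x] sampled_vars_Orig restart_sel step_weight_def by simp
  also have "PiM (sampled_vars C ?\<tau>) (\<lambda>v. sample_law (restart_upd \<omega> u C (Orig (fst s), Orig (next_loc C s)) v))
      = PiM (sampled_vars C ?\<tau>) (\<lambda>v. sample_law (upd C ?\<tau> v))"
    by (rule PiM_cong) (simp_all add: sample_law_Orig del: restart_upd.simps)
  also have "(\<integral>\<^sup>+z. \<phi> (Orig (next_loc C s), (apply_upd C ?\<tau> (snd s) z)(\<omega> := w * step_weight s, u := 0))
        \<partial>PiM (sampled_vars C ?\<tau>) (\<lambda>v. sample_law (upd C ?\<tau> v))) =
      (\<integral>\<^sup>+s'. \<phi> (embed s' (w * step_weight s)) \<partial>step C s)"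
    unfolding nn_integral_step[OF s m] by (simp add: embed_def del: fun_upd_apply)
  finally show ?thesis .
qed

lemma init_embed: "init_state (restart M \<omega> u C) = embed (init_state C) 1"
  by (simp add: init_state_def embed_def restart_val_def restart_sel)

section \<open>The restart decision and the fixpoint equation\<close>

context
  fixes g :: "('v \<Rightarrow> real) \<Rightarrow> ennreal"
  assumes g: "g \<in> borel_measurable (out_space C)"
begin

lemma g': "g \<in> borel_measurable (out_space (restart M \<omega> u C))"
  using g by (simp add: restart_sel)

lemma hit_Flip:
  assumes x: "x \<in> space (val_space C)"
  shows "Res.hit g (Flip, x(\<omega> := w, u := v)) =
    (if v < 1 - w / M then Res.hit g (init_state (restart M \<omega> u C)) else g (restrict x (out_vars C)))"
proof -
  let ?C = "restart M \<omega> u C" and ?y = "x(\<omega> := w, u := v)"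
  have s: "(Flip, ?y) \<in> space Res.S"
    using extend_space[OF x] unfolding Res.space_S by (simp add: restart_sel(8))
  have y: "?y \<omega> = w" "?y u = v" using fresh by simp_all
  note step = Res.hit_step[OF g' s] Res.nn_integral_step_det[OF s Res.measurable_hit[OF g']]
  show ?thesis
  proof (cases "v < 1 - w / M")
    case True
    have n: "next_loc ?C (Flip, ?y) = Orig (init_loc C)"
      by (rule Res.next_loc_eq[OF s]) (use True fresh in \<open>simp_all add: restart_def\<close>)
    have "restart_val \<omega> u C \<in> extensional (insert \<omega> (insert u (vars C)))"
      using Res.init_state_space unfolding Res.space_S by (simp add: init_state_def restart_sel space_PiM PiE_def)
    then have "apply_upd ?C (Flip, Orig (init_loc C)) ?y z = restart_val \<omega> u C" for z
      by (auto simp: apply_upd_def fun_eq_iff extensional_def restart_sel)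
    moreover have "sampled_vars ?C (Flip, Orig (init_loc C)) = {}"
      by (simp add: sampled_vars_def restart_sel)
    ultimately show ?thesis
      using step True unfolding n fst_conv snd_conv by (simp add: init_state_def restart_sel(5,7))
  next
    case False
    have n: "next_loc ?C (Flip, ?y) = Done"
      by (rule Res.next_loc_eq[OF s]) (use False fresh in \<open>simp_all add: restart_def\<close>)
    have "?y \<in> extensional (insert \<omega> (insert u (vars C)))"
      using s unfolding Res.space_S by (simp add: space_PiM PiE_def restart_sel del: fun_upd_apply)
    then have "apply_upd ?C (Flip, Done) ?y z = ?y" for z
      by (auto simp: apply_upd_def fun_eq_iff extensional_def restart_sel)
    moreover have "sampled_vars ?C (Flip, Done) = {}"
      by (simp add: sampled_vars_def restart_sel)
    moreover have "Res.hit g (Done, ?y) = g (restrict x (out_vars C))"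
      using Res.hit_out[OF g', of "(Done, ?y)"] s unfolding Res.space_S
      by (simp add: restart_sel restrict_extend_out del: fun_upd_apply)
    ultimately show ?thesis
      using step False unfolding n fst_conv snd_conv by simp
  qed
qed

text \<open>Here the bound on the cumulative weight enters: it puts the threshold into the unit
  interval, which it splits into pieces of lengths \<open>1 - w / M\<close> and
  \<open>w / M\<close>.\<close>

lemma nn_integral_uniform_flip:
  assumes w: "0 \<le> w" "w \<le> M"
  shows "(\<integral>\<^sup>+v. (if v < 1 - w / M then a else b) \<partial>uniform_measure lborel {0..1::real}) =
    ennreal (1 - w / M) * a + ennreal (w / M) * b"
proof -
  have p: "0 \<le> w / M" "w / M \<le> 1" using w M_pos by auto
  have "(\<integral>\<^sup>+v. (if v < 1 - w / M then a else b) \<partial>uniform_measure lborel {0..1::real}) =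
      (\<integral>\<^sup>+v. (if v < 1 - w / M then a else b) * indicator {0..1} v \<partial>lborel)"
    by (subst nn_integral_uniform_measure) (auto simp: divide_ennreal_def)
  also have "\<dots> = (\<integral>\<^sup>+v. a * indicator {0..<1 - w / M} v + b * indicator {1 - w / M..1} v \<partial>lborel)"
    using p by (intro nn_integral_cong) (auto simp: indicator_def)
  also have "\<dots> = a * ennreal (1 - w / M) + b * ennreal (w / M)"
    using p by (subst nn_integral_add) (auto simp: nn_integral_cmult_indicator)
  finally show ?thesis by (simp add: mult.commute)
qed

text \<open>Two steps of the restarted graph in one equation: sampling \<open>u\<close> leads to
  \<open>Flip\<close>, whose deterministic outcome \<open>hit_Flip\<close> is then averaged over the
  uniform law. The product measure over \<open>{u}\<close> reduces to that law.\<close>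

lemma hit_out_loc:
  assumes x: "x \<in> space (val_space C)" and w: "0 \<le> w" "w \<le> M"
  shows "Res.hit g (embed (out_loc C, x) w) =
    ennreal (1 - w / M) * Res.hit g (init_state (restart M \<omega> u C)) + ennreal (w / M) * g (restrict x (out_vars C))"
proof -
  let ?C = "restart M \<omega> u C" and ?y = "x(\<omega> := w, u := 0)" and ?U = "uniform_measure lborel {0..1::real}"
  let ?h = "\<lambda>v. if v < 1 - w / M then Res.hit g (init_state ?C) else g (restrict x (out_vars C))"
  have s: "(Orig (out_loc C), ?y) \<in> space Res.S"
    using embed_space[of "(out_loc C, x)" w] x out_loc_in by (simp add: embed_def space_S)
  have n: "next_loc ?C (Orig (out_loc C), ?y) = Flip"
    by (rule Res.next_loc_eq[OF s]) (simp_all add: restart_def)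
  have sv: "sampled_vars ?C (Orig (out_loc C), Flip) = {u}"
    by (auto simp: sampled_vars_def restart_sel)
  have "?y \<in> extensional (insert \<omega> (insert u (vars C)))"
    using s unfolding Res.space_S by (simp add: space_PiM PiE_def restart_sel del: fun_upd_apply)
  then have au: "apply_upd ?C (Orig (out_loc C), Flip) ?y z = x(\<omega> := w, u := z u)" for z
    by (auto simp: apply_upd_def fun_eq_iff extensional_def restart_sel)
  interpret U: prob_space ?U by (rule prob_space_uniform_measure) auto
  interpret UP: product_sigma_finite "\<lambda>_::'v. ?U" by unfold_locales
  have "Res.hit g (embed (out_loc C, x) w) = (\<integral>\<^sup>+s'. Res.hit g s' \<partial>step ?C (Orig (out_loc C), ?y))"
    using Res.hit_step[OF g' s] by (simp add: embed_def)
  also have "\<dots> = (\<integral>\<^sup>+z. Res.hit g (Flip, x(\<omega> := w, u := z u)) \<partial>PiM {u} (\<lambda>v. sample_law (restart_upd \<omega> u C (Orig (out_loc C), Flip) v)))"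
    unfolding Res.nn_integral_step[OF s Res.measurable_hit[OF g']] n fst_conv snd_conv sv au restart_sel ..
  also have "PiM {u} (\<lambda>v. sample_law (restart_upd \<omega> u C (Orig (out_loc C), Flip) v)) = PiM {u} (\<lambda>_. ?U)"
    by (rule PiM_cong) simp_all
  also have "(\<integral>\<^sup>+z. Res.hit g (Flip, x(\<omega> := w, u := z u)) \<partial>PiM {u} (\<lambda>_. ?U)) = (\<integral>\<^sup>+z. ?h (z u) \<partial>PiM {u} (\<lambda>_. ?U))"
    by (simp only: hit_Flip[OF x])
  also have "\<dots> = (\<integral>\<^sup>+v. ?h v \<partial>?U)"
    by (rule UP.product_nn_integral_singleton) measurable
  also have "\<dots> = ennreal (1 - w / M) * Res.hit g (init_state ?C) + ennreal (w / M) * g (restrict x (out_vars C))"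
    by (rule nn_integral_uniform_flip[OF w])
  finally show ?thesis .
qed

lemma hit_init_fixpoint:
  assumes ast: "as_terminating C" and bound: "bounded_cum_weight C M" and g1: "\<And>x. g x \<le> 1"
  shows "Res.hit g (init_state (restart M \<omega> u C)) =
    (\<integral>\<^sup>+\<rho>. ennreal (1 - run_weight \<rho> / M) * Res.hit g (init_state (restart M \<omega> u C))
      + ennreal (run_weight \<rho> / M) * g (run_output \<rho>) \<partial>R)"
proof -
  let ?F = "\<lambda>s w. Res.hit g (embed s w)"
  have "Res.hit g (init_state (restart M \<omega> u C)) = (\<integral>\<^sup>+\<rho>. ?F (\<rho> (exit_time \<rho>)) (run_weight \<rho>) \<partial>R)"
    unfolding init_embed
  proof (rule weighted_stopping[OF ast])
    show "(\<lambda>(s, w). ?F s w) \<in> borel_measurable (S \<Otimes>\<^sub>M borel)"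
      using measurable_compose[OF measurable_embed Res.measurable_hit[OF g']] by (simp add: split_beta')
    fix s w assume s: "s \<in> space S"
    show "?F s w \<le> 1" by (rule Res.hit_le[OF g' g1 embed_space[OF s]])
    have m: "(\<lambda>s'. ?F s' w') \<in> borel_measurable S" for w'
      using measurable_compose[OF measurable_compose[OF measurable_Pair2' measurable_embed] Res.measurable_hit[OF g'], of w'] by simp
    show "?F s w = (\<integral>\<^sup>+s'. ?F s' (w * step_weight s) \<partial>step C s)"
    proof (cases "fst s = out_loc C")
      \<comment> \<open>Here the graphs part ways: the restarted one would move on to
        \<open>Flip\<close>, while the original one idles with weight 1. The required equation
        concerns the original kernel and is therefore immediate.\<close>
      case True
      then show ?thesis using s m by (simp add: nn_integral_step_out step_weight_out)
    next
      case False
      show ?thesis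
        unfolding Res.hit_step[OF g' embed_space[OF s]]
        by (rule nn_integral_step_embed[OF s False Res.measurable_hit[OF g']])
    qed
  qed
  also have "\<dots> = (\<integral>\<^sup>+\<rho>. ennreal (1 - run_weight \<rho> / M) * Res.hit g (init_state (restart M \<omega> u C))
      + ennreal (run_weight \<rho> / M) * g (run_output \<rho>) \<partial>R)"
  proof (rule nn_integral_cong_AE, use AE_regular[OF ast] in eventually_elim)
    case (elim \<rho>)
    then have \<rho>: "is_run C \<rho>" "\<rho> \<in> space R" "exits \<rho>" by auto
    have w: "0 \<le> run_weight \<rho>" "run_weight \<rho> \<le> M"
      using cum_weight_nonneg[OF \<rho>(1,2)] bound \<rho> unfolding run_weight_eq[OF \<rho>, symmetric] bounded_cum_weight_def
      by (auto simp: term_time_exits)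
    have "\<rho> (exit_time \<rho>) = (out_loc C, snd (\<rho> (exit_time \<rho>)))"
      using at_exit_time[OF \<rho>(3)] by (simp add: prod_eq_iff)
    moreover have "snd (\<rho> (exit_time \<rho>)) \<in> space (val_space C)"
      using run_in_space[OF \<rho>(2)] by (simp add: space_S)
    from hit_out_loc[OF this w] show ?case
      by (subst calculation) (simp add: run_output_def)
  qed
  finally show ?thesis .
qed

text \<open>The unknown occurs on both sides of the fixpoint equation. To avoid subtraction in
  \<open>ennreal\<close>, it is also expanded as its own average, split in the proportions
  \<open>1 - W / M\<close> and \<open>W / M\<close>. The restart term is the same in both expansions
  and cancels; what remains is linear in the unknown, with a coefficient \<open>E[W] / M\<close>
  that is positive and finite.\<close>

lemma hit_init_restart:
  assumes ast: "as_terminating C" and int: "integrable_pcfg C" and bound: "bounded_cum_weight C M" and g1: "\<And>x. g x \<le> 1"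
  shows "Res.hit g (init_state (restart M \<omega> u C)) =
    (\<integral>\<^sup>+\<rho>. ennreal (run_weight \<rho>) * g (run_output \<rho>) \<partial>R) / expected_weight C"
proof -
  let ?h = "Res.hit g (init_state (restart M \<omega> u C))"
  have [measurable]: "(\<lambda>\<rho>. g (run_output \<rho>)) \<in> borel_measurable R"
    by (rule measurable_compose[OF measurable_output g])
  have h1: "?h \<le> 1"
    by (rule Res.hit_le[OF g' g1 Res.init_state_space])
  have W: "AE \<rho> in R. 0 \<le> run_weight \<rho> \<and> run_weight \<rho> \<le> M"
    using AE_regular[OF ast]
  proof eventually_elim
    case (elim \<rho>)
    then have \<rho>: "is_run C \<rho>" "\<rho> \<in> space R" "exits \<rho>" by auto
    then show ?case
      using cum_weight_nonneg[OF \<rho>(1,2)] bound unfolding run_weight_eq[OF \<rho>, symmetric] bounded_cum_weight_def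
      by (auto simp: term_time_exits)
  qed
  \<comment> \<open>The contribution of restarting, shared by the two expansions of
    \<open>?h\<close>.\<close>
  define A where "A = (\<integral>\<^sup>+\<rho>. ennreal (1 - run_weight \<rho> / M) * ?h \<partial>R)"
  have scale: "(\<integral>\<^sup>+\<rho>. ennreal (run_weight \<rho> / M) * k \<rho> \<partial>R) = ennreal (1 / M) * (\<integral>\<^sup>+\<rho>. ennreal (run_weight \<rho>) * k \<rho> \<partial>R)"
    if [measurable]: "k \<in> borel_measurable R" for k
  proof -
    have "(\<integral>\<^sup>+\<rho>. ennreal (run_weight \<rho> / M) * k \<rho> \<partial>R) = (\<integral>\<^sup>+\<rho>. ennreal (1 / M) * (ennreal (run_weight \<rho>) * k \<rho>) \<partial>R)"
      using M_pos by (intro nn_integral_cong) (simp add: ennreal_mult'[symmetric] mult.assoc[symmetric])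
    also have "\<dots> = ennreal (1 / M) * (\<integral>\<^sup>+\<rho>. ennreal (run_weight \<rho>) * k \<rho> \<partial>R)"
      by (rule nn_integral_cmult) measurable
    finally show ?thesis .
  qed
  have "?h = (\<integral>\<^sup>+\<rho>. ?h \<partial>R)"
    by (simp add: R.emeasure_space_1)
  also have "\<dots> = (\<integral>\<^sup>+\<rho>. ennreal (1 - run_weight \<rho> / M) * ?h + ennreal (run_weight \<rho> / M) * ?h \<partial>R)"
  proof (rule nn_integral_cong_AE, use W in eventually_elim)
    case (elim \<rho>)
    then have "ennreal (1 - run_weight \<rho> / M) + ennreal (run_weight \<rho> / M) = 1"
      using M_pos by (subst ennreal_plus[symmetric]) auto
    then show ?case by (simp add: distrib_right[symmetric])
  qed
  also have "\<dots> = A + ennreal (1 / M) * (\<integral>\<^sup>+\<rho>. ennreal (run_weight \<rho>) * ?h \<partial>R)"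
    unfolding A_def by (subst nn_integral_add) (simp_all add: scale)
  also have "(\<integral>\<^sup>+\<rho>. ennreal (run_weight \<rho>) * ?h \<partial>R) = expected_weight C * ?h"
    unfolding expected_weight_eq[OF ast] by (rule nn_integral_multc) measurable
  finally have 1: "?h = A + ennreal (1 / M) * (expected_weight C * ?h)" .
  have "?h = A + ennreal (1 / M) * (\<integral>\<^sup>+\<rho>. ennreal (run_weight \<rho>) * g (run_output \<rho>) \<partial>R)"
    unfolding A_def by (subst hit_init_fixpoint[OF ast bound g1], subst nn_integral_add) (simp_all add: scale)
  with 1 have eq: "A + ennreal (1 / M) * (expected_weight C * ?h) =
      A + ennreal (1 / M) * (\<integral>\<^sup>+\<rho>. ennreal (run_weight \<rho>) * g (run_output \<rho>) \<partial>R)"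
    by (rule subst)
  \<comment> \<open>Cancelling \<open>A\<close> requires it to be finite, which follows from
    \<open>?h \<le> 1\<close>.\<close>
  have "A \<le> ?h" by (subst 1) simp
  with h1 have "A \<noteq> top" by (auto simp: top_unique)
  with eq have "ennreal (1 / M) * (expected_weight C * ?h) = ennreal (1 / M) * (\<integral>\<^sup>+\<rho>. ennreal (run_weight \<rho>) * g (run_output \<rho>) \<partial>R)"
    by (simp add: ennreal_add_left_cancel)
  then have "expected_weight C * ?h = (\<integral>\<^sup>+\<rho>. ennreal (run_weight \<rho>) * g (run_output \<rho>) \<partial>R)"
    using M_pos by (simp add: ennreal_mult_cancel_left)
  then have "(\<integral>\<^sup>+\<rho>. ennreal (run_weight \<rho>) * g (run_output \<rho>) \<partial>R) / expected_weight C = ?h * (expected_weight C / expected_weight C)"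
    unfolding divide_ennreal_def by (metis mult.assoc mult.commute)
  moreover have "expected_weight C / expected_weight C = 1"
    using int by (intro ennreal_divide_self) (auto simp: integrable_pcfg_def)
  ultimately show ?thesis by simp
qed

end

text \<open>With the constant 1 for \<open>g\<close>, \<open>hit\<close> is the termination
  probability and the quotient is \<open>E[W] / E[W]\<close>, which is 1 by integrability.\<close>

lemma as_terminating_restart:
  assumes ast: "as_terminating C" and int: "integrable_pcfg C" and bound: "bounded_cum_weight C M"
  shows "as_terminating (restart M \<omega> u C)"
proof -
  let ?C = "restart M \<omega> u C"
  have "emeasure Res.R {\<rho> \<in> space Res.R. Res.exits \<rho>} =
      (\<integral>\<^sup>+\<rho>. indicator {\<rho> \<in> space Res.R. Res.exits \<rho>} \<rho> \<partial>Res.R)"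
    by (rule nn_integral_indicator[symmetric]) measurable
  also have "\<dots> = (\<integral>\<^sup>+\<rho>. (if Res.exits \<rho> then 1 else 0) \<partial>Res.R)"
    by (intro nn_integral_cong) (simp add: indicator_def)
  also have "\<dots> = Res.hit (\<lambda>_. 1) (init_state ?C)"
    by (subst Res.hit_init) simp_all
  also have "\<dots> = (\<integral>\<^sup>+\<rho>. ennreal (run_weight \<rho>) * 1 \<partial>R) / expected_weight C"
    by (rule hit_init_restart[OF _ ast int bound]) simp_all
  also have "\<dots> = 1"
    using int unfolding mult_1_right expected_weight_eq[OF ast, symmetric]
    by (intro ennreal_divide_self) (auto simp: integrable_pcfg_def)
  finally have "Res.R.prob {\<rho> \<in> space Res.R. Res.exits \<rho>} = 1"
    by (simp add: measure_def)
  moreover have "{\<rho> \<in> space Res.R. term_time ?C \<rho> < \<infinity>} = {\<rho> \<in> space Res.R. Res.exits \<rho>}"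
    by (auto simp: Res.term_time_exits)
  ultimately show ?thesis
    by (simp add: as_terminating_def)
qed

lemma measurable_restart_output: "Res.run_output \<in> measurable Res.R (out_space C)"
  using Res.measurable_output unfolding restart_sel(2) .

text \<open>Indicators serve as \<open>g\<close>. Almost sure termination of the restarted graph is
  established beforehand because \<open>hit\<close> counts terminating trajectories only, whereas
  the push-forward also sees the arbitrary value of \<open>run_output\<close> on the others.\<close>

lemma distr_output_restart:
  assumes ast: "as_terminating C" and int: "integrable_pcfg C" and bound: "bounded_cum_weight C M"
  shows "distr Res.R (out_space C) Res.run_output = nod C"
proof (rule measure_eqI)
  show "sets (distr Res.R (out_space C) Res.run_output) = sets (nod C)"
    by (simp add: nod_eq[OF ast])
  fix B assume "B \<in> sets (distr Res.R (out_space C) Res.run_output)"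
  then have B: "B \<in> sets (out_space C)" by simp
  have "emeasure (distr Res.R (out_space C) Res.run_output) B =
      (\<integral>\<^sup>+\<rho>. indicator (Res.run_output -` B \<inter> space Res.R) \<rho> \<partial>Res.R)"
    using B measurable_restart_output by (simp add: emeasure_distr measurable_sets)
  also have "\<dots> = (\<integral>\<^sup>+\<rho>. (if Res.exits \<rho> then indicator B (Res.run_output \<rho>) else 0) \<partial>Res.R)"
    using Res.AE_exits[OF as_terminating_restart[OF assms]] AE_space
    by (intro nn_integral_cong_AE, eventually_elim) (auto simp: indicator_def)
  also have "\<dots> = Res.hit (indicator B) (init_state (restart M \<omega> u C))"
    using B by (subst Res.hit_init) (simp_all add: restart_sel(2))
  also have "\<dots> = emeasure (nod C) B"
    unfolding emeasure_nod[OF ast B] using B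
    by (intro hit_init_restart[OF _ ast int bound]) (auto simp: indicator_def)
  finally show "emeasure (distr Res.R (out_space C) Res.run_output) B = emeasure (nod C) B" .
qed
end

section \<open>Optional stopping\<close>

text \<open>Half of the exponential decay absorbs the power of \<open>n\<close>; the other half
  leaves a geometric series. This serves condition (C4).\<close>

lemma summable_powr_exp:
  fixes c d :: real
  assumes "0 < c"
  shows "summable (\<lambda>n::nat. real n powr d * exp (- c * real n))"
proof (rule summable_comparison_test_bigo)
  show "summable (\<lambda>n::nat. norm (exp (- (c / 2)) ^ n))"
    unfolding norm_power by (rule summable_geometric) (use assms in simp)
  have "(\<lambda>n::nat. real n powr d * exp (- c * real n)) \<in> O(\<lambda>n. exp (- (c / 2) * real n))"
    using assms by real_asymp
  then show "(\<lambda>n::nat. real n powr d * exp (- c * real n)) \<in> O(\<lambda>n. exp (- (c / 2)) ^ n)"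
    by (simp add: exp_of_nat_mult[symmetric] mult.commute)
qed

context graph
begin

lemma is_run_reachable: "is_run C \<rho> \<Longrightarrow> reachable C (\<rho> i)"
proof (induction i)
  case 0
  then show ?case by (simp add: is_run_def reachable_def)
next
  case (Suc i)
  then have "successor C (\<rho> i) (\<rho> (Suc i))" by (simp add: is_run_def)
  with Suc show ?case unfolding reachable_def by (auto intro: rtranclp.rtrancl_into_rtrancl)
qed

text \<open>The event \<open>T > t\<close>, written in terms of the states up to time
  \<open>t\<close>, so that it belongs to the sigma-algebra generated by them.\<close>

definition running :: "nat \<Rightarrow> (nat \<Rightarrow> 'l \<times> ('v \<Rightarrow> real)) set" where
  "running t = {\<rho> \<in> space R. \<forall>i\<le>t. fst (\<rho> i) \<noteq> out_loc C}"

lemma running_sets [measurable]: "running t \<in> sets R"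
  unfolding running_def by measurable

lemma running_iff: "\<rho> \<in> space R \<Longrightarrow> \<rho> \<in> running t \<longleftrightarrow> enat t < term_time C \<rho>"
proof (cases "exits \<rho>")
  case True
  assume "\<rho> \<in> space R"
  moreover have "(\<forall>i\<le>t. fst (\<rho> i) \<noteq> out_loc C) \<longleftrightarrow> t < exit_time \<rho>"
    using before_exit_time at_exit_time[OF True] le_less_trans not_less by metis
  ultimately show ?thesis using True by (simp add: running_def term_time_exits)
qed (simp add: running_def term_time_exits exits_def)

lemma running_exits_iff: "\<rho> \<in> space R \<Longrightarrow> exits \<rho> \<Longrightarrow> \<rho> \<in> running t \<longleftrightarrow> t < exit_time \<rho>"
  by (simp add: running_iff term_time_exits)

lemma subalgebra_run_filtration: "subalgebra R (run_filtration C t)"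
proof -
  have m: "(\<lambda>\<rho>. restrict \<rho> {..t}) \<in> measurable R (PiM {..t} (\<lambda>_. S))"
    unfolding measurable_cong_sets[OF sets_run refl] by (rule measurable_restrict_subset) simp
  have f: "(\<lambda>\<rho>. restrict \<rho> {..t}) \<in> space R \<rightarrow> space (PiM {..t} (\<lambda>_. S))"
    by (intro funcsetI measurable_space[OF m])
  have "sets (run_filtration C t) \<subseteq> sets R"
  proof
    fix B assume "B \<in> sets (run_filtration C t)"
    then obtain A where "A \<in> sets (PiM {..t} (\<lambda>_. S))" "B = (\<lambda>\<rho>. restrict \<rho> {..t}) -` A \<inter> space R"
      unfolding run_filtration_def sets_vimage_algebra2[OF f] by (elim CollectE exE conjE)
    then show "B \<in> sets R" by (simp only: measurable_sets[OF m])
  qed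
  moreover have "space (run_filtration C t) = space R"
    unfolding run_filtration_def by (rule space_vimage_algebra)
  ultimately show ?thesis
    unfolding subalgebra_def by (rule conjI[rotated])
qed

lemma running_run_filtration: "running t \<in> sets (run_filtration C t)"
proof -
  let ?P = "PiM {..t} (\<lambda>_. S)"
  have [measurable]: "Measurable.pred ?P (\<lambda>\<rho>. fst (\<rho> i) \<noteq> out_loc C)" if "i \<in> {..t}" for i
    using measurable_compose[OF measurable_component_singleton[OF that, of "\<lambda>_. S"] measurable_fst_S] out_loc_in
    by measurable
  have "{\<rho> \<in> space ?P. \<forall>i\<in>{..t}. fst (\<rho> i) \<noteq> out_loc C} \<in> sets ?P"
    by measurable
  from in_vimage_algebra[OF this, of "\<lambda>\<rho>. restrict \<rho> {..t}" "space R"]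
  have "(\<lambda>\<rho>. restrict \<rho> {..t}) -` {\<rho> \<in> space ?P. \<forall>i\<in>{..t}. fst (\<rho> i) \<noteq> out_loc C} \<inter> space R \<in> sets (run_filtration C t)"
    by (simp add: run_filtration_def)
  also have "(\<lambda>\<rho>. restrict \<rho> {..t}) -` {\<rho> \<in> space ?P. \<forall>i\<in>{..t}. fst (\<rho> i) \<noteq> out_loc C} \<inter> space R = running t"
    by (auto simp: running_def space_run space_PiM)
  finally show ?thesis .
qed

end

locale ost_graph = graph C for C :: "('l, 'v, 'z) pcfg_scheme" +
  fixes f :: "('v \<Rightarrow> real) \<Rightarrow> real" and \<eta> :: "'l \<Rightarrow> ('v \<Rightarrow> real) \<Rightarrow> real"
  assumes ast: "as_terminating C"
    and f: "f \<in> borel_measurable (out_space C)"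
    and \<eta>: "state_function C \<eta>"
    and ost: "ost_sound C \<eta> f"
begin

abbreviation Y :: "nat \<Rightarrow> (nat \<Rightarrow> 'l \<times> ('v \<Rightarrow> real)) \<Rightarrow> real" where
  "Y \<equiv> run_value C f \<eta>"

definition state_value :: "'l \<times> ('v \<Rightarrow> real) \<Rightarrow> real" where
  "state_value s = plus_output C f \<eta> (fst s) (snd s)"

lemma Y_eq: "Y i \<rho> = state_value (\<rho> i)"
  by (simp add: run_value_def state_value_def)

lemma measurable_plus_output: "l \<in> locs C \<Longrightarrow> plus_output C f \<eta> l \<in> borel_measurable (val_space C)"
  unfolding plus_output_def using \<eta> measurable_compose[OF measurable_restrict_subset[OF out_vars_sub] f]
  by (intro borel_measurable_add) (auto simp: state_function_def)

lemma measurable_state_value [measurable]: "state_value \<in> borel_measurable S"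
proof (rule measurable_pair_measure_countable1)
  show "countable (locs C)" using wf_pcfgD(1)[OF wf] by (rule countable_finite)
qed (simp add: state_value_def measurable_plus_output)

lemma integrable_Y: "integrable R (Y i)"
  using ost by (simp add: ost_sound_def Let_def)

lemma measurable_Y [measurable]: "Y i \<in> borel_measurable R"
  using integrable_Y by blast

section \<open>An integrable bound for the stopped process\<close>

definition stopped :: "nat \<Rightarrow> (nat \<Rightarrow> 'l \<times> ('v \<Rightarrow> real)) \<Rightarrow> real" where
  "stopped t \<rho> = Y (min t (exit_time \<rho>)) \<rho>"

lemma measurable_stopped [measurable]: "stopped t \<in> borel_measurable R"
  unfolding stopped_def
  by (rule measurable_compose_countable[OF _ measurable_exit_time]) measurable

definition increment :: "nat \<Rightarrow> (nat \<Rightarrow> 'l \<times> ('v \<Rightarrow> real)) \<Rightarrow> real" where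
  "increment t \<rho> = indicator (running t) \<rho> * (Y (Suc t) \<rho> - Y t \<rho>)"

lemma integrable_increment: "integrable R (increment t)"
  unfolding increment_def
  using integrable_mult_indicator[OF running_sets Bochner_Integration.integrable_diff[OF integrable_Y integrable_Y], of t "Suc t" t]
  by simp

lemma measurable_increment [measurable]: "increment t \<in> borel_measurable R"
  using integrable_increment by blast

lemma stopped_Suc:
  assumes "\<rho> \<in> space R" "exits \<rho>"
  shows "stopped (Suc t) \<rho> = stopped t \<rho> + increment t \<rho>"
  using running_exits_iff[OF assms, of t]
  by (cases "t < exit_time \<rho>") (simp_all add: stopped_def increment_def min_def)

lemma AE_stopped_sum: "AE \<rho> in R. \<forall>t. stopped t \<rho> = Y 0 \<rho> + (\<Sum>i<t. increment i \<rho>)"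
  using AE_regular[OF ast]
proof eventually_elim
  case (elim \<rho>)
  show ?case
  proof
    fix t show "stopped t \<rho> = Y 0 \<rho> + (\<Sum>i<t. increment i \<rho>)"
      using elim by (induction t) (simp_all add: stopped_Suc, simp add: stopped_def)
  qed
qed

text \<open>By telescoping, the initial value and the sum of all absolute increments bound the
  stopped process. By Tonelli the expectation of this sum is the series in the hypothesis.\<close>

lemma stopped_dominated_by_increments:
  assumes "(\<Sum>i. \<integral>\<^sup>+\<rho>. ennreal \<bar>increment i \<rho>\<bar> \<partial>R) < \<infinity>"
  shows "\<exists>D. integrable R D \<and> (\<forall>t. AE \<rho> in R. \<bar>stopped t \<rho>\<bar> \<le> D \<rho>)"
proof -
  \<comment> \<open>The sum is formed in \<open>ennreal\<close>, where it always exists; it is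
    finite almost everywhere, so \<open>enn2real\<close> alters it on a null set only.\<close>
  let ?D = "\<lambda>\<rho>. \<Sum>i. ennreal \<bar>increment i \<rho>\<bar>"
  have "(\<integral>\<^sup>+\<rho>. ?D \<rho> \<partial>R) = (\<Sum>i. \<integral>\<^sup>+\<rho>. ennreal \<bar>increment i \<rho>\<bar> \<partial>R)"
    by (rule nn_integral_suminf) measurable
  with assms have fin: "(\<integral>\<^sup>+\<rho>. ?D \<rho> \<partial>R) < \<infinity>" by simp
  have [measurable]: "?D \<in> borel_measurable R" by measurable
  have AE_fin: "AE \<rho> in R. ?D \<rho> \<noteq> \<infinity>"
    by (rule nn_integral_PInf_AE) (use fin in auto)
  have int: "integrable R (\<lambda>\<rho>. enn2real (?D \<rho>))"
  proof (rule integrableI_nonneg)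
    have "(\<integral>\<^sup>+\<rho>. ennreal (enn2real (?D \<rho>)) \<partial>R) = (\<integral>\<^sup>+\<rho>. ?D \<rho> \<partial>R)"
      using AE_fin by (intro nn_integral_cong_AE, eventually_elim) (simp add: less_top)
    with fin show "(\<integral>\<^sup>+\<rho>. ennreal (enn2real (?D \<rho>)) \<partial>R) < \<infinity>" by simp
  qed auto
  show ?thesis
  proof (intro exI[of _ "\<lambda>\<rho>. \<bar>Y 0 \<rho>\<bar> + enn2real (?D \<rho>)"] conjI allI)
    show "integrable R (\<lambda>\<rho>. \<bar>Y 0 \<rho>\<bar> + enn2real (?D \<rho>))"
      using int integrable_Y by (intro Bochner_Integration.integrable_add integrable_abs)
    fix t
    show "AE \<rho> in R. \<bar>stopped t \<rho>\<bar> \<le> \<bar>Y 0 \<rho>\<bar> + enn2real (?D \<rho>)"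
      using AE_stopped_sum AE_fin
    proof eventually_elim
      case (elim \<rho>)
      have "ennreal (\<Sum>i<t. \<bar>increment i \<rho>\<bar>) = (\<Sum>i<t. ennreal \<bar>increment i \<rho>\<bar>)"
        by simp
      also have "\<dots> \<le> ?D \<rho>" by (rule sum_le_suminf) auto
      also have "\<dots> = ennreal (enn2real (?D \<rho>))" using elim by (simp add: less_top)
      finally have "(\<Sum>i<t. \<bar>increment i \<rho>\<bar>) \<le> enn2real (?D \<rho>)" by simp
      moreover have "\<bar>\<Sum>i<t. increment i \<rho>\<bar> \<le> (\<Sum>i<t. \<bar>increment i \<rho>\<bar>)" by (rule sum_abs)
      moreover have "stopped t \<rho> = Y 0 \<rho> + (\<Sum>i<t. increment i \<rho>)" using elim by blast
      ultimately show ?case by linarith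
    qed
  qed
qed

text \<open>Conditions (C3) and (C4) say nothing about time 0, and the tail estimate in (C4) holds
  only eventually. The finitely many increments left out are integrable anyway.\<close>

lemma increments_finite_if_tail_finite:
  assumes "(\<Sum>i. \<integral>\<^sup>+\<rho>. ennreal \<bar>increment (i + k) \<rho>\<bar> \<partial>R) < \<infinity>"
  shows "(\<Sum>i. \<integral>\<^sup>+\<rho>. ennreal \<bar>increment i \<rho>\<bar> \<partial>R) < \<infinity>"
proof -
  have "(\<integral>\<^sup>+\<rho>. ennreal \<bar>increment i \<rho>\<bar> \<partial>R) < \<infinity>" for i
    using integrable_increment[of i] by (simp add: integrable_iff_bounded)
  then have "(\<Sum>i<k. \<integral>\<^sup>+\<rho>. ennreal \<bar>increment i \<rho>\<bar> \<partial>R) < \<infinity>"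
    by (simp add: less_top)
  with assms show ?thesis
    using suminf_offset[of "\<lambda>i. \<integral>\<^sup>+\<rho>. ennreal \<bar>increment i \<rho>\<bar> \<partial>R" k] by (simp add: less_top)
qed

lemma nn_integral_increment_running:
  assumes "AE \<rho> in R. \<bar>Y (Suc n) \<rho> - Y n \<rho>\<bar> \<le> c"
  shows "(\<integral>\<^sup>+\<rho>. ennreal \<bar>increment n \<rho>\<bar> \<partial>R) \<le> ennreal c * emeasure R (running n)"
proof -
  have "(\<integral>\<^sup>+\<rho>. ennreal \<bar>increment n \<rho>\<bar> \<partial>R) \<le> (\<integral>\<^sup>+\<rho>. ennreal c * indicator (running n) \<rho> \<partial>R)"
    using assms by (intro nn_integral_mono_AE, eventually_elim) (auto simp: increment_def indicator_def ennreal_leI)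
  also have "\<dots> = ennreal c * emeasure R (running n)"
    by (rule nn_integral_cmult_indicator) measurable
  finally show ?thesis .
qed

text \<open>Since \<open>running n\<close> lies in the sigma-algebra of the first \<open>n\<close>
  steps, the absolute increment may be replaced by its conditional expectation when integrating over
  this event.\<close>

lemma nn_integral_increment_cond_exp:
  assumes "AE \<rho> in R. real_cond_exp R (run_filtration C n) (\<lambda>\<rho>. \<bar>Y (Suc n) \<rho> - Y n \<rho>\<bar>) \<rho> \<le> c"
  shows "(\<integral>\<^sup>+\<rho>. ennreal \<bar>increment n \<rho>\<bar> \<partial>R) \<le> ennreal c * emeasure R (running n)"
proof -
  interpret F: finite_measure_subalgebra R "run_filtration C n"
    by unfold_locales (rule subalgebra_run_filtration)
  let ?d = "\<lambda>\<rho>. \<bar>Y (Suc n) \<rho> - Y n \<rho>\<bar>"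
  let ?e = "real_cond_exp R (run_filtration C n) ?d"
  have d: "integrable R ?d"
    by (intro integrable_abs Bochner_Integration.integrable_diff integrable_Y)
  have e: "integrable R ?e" by (rule F.real_cond_exp_int(1)[OF d])
  have "(\<integral>\<^sup>+\<rho>. ennreal \<bar>increment n \<rho>\<bar> \<partial>R) = ennreal (\<integral>\<rho>. \<bar>increment n \<rho>\<bar> \<partial>R)"
    by (rule nn_integral_eq_integral) (auto intro: integrable_abs integrable_increment)
  also have "(\<integral>\<rho>. \<bar>increment n \<rho>\<bar> \<partial>R) = (\<integral>\<rho>\<in>running n. ?d \<rho> \<partial>R)"
    unfolding set_lebesgue_integral_def increment_def by (intro Bochner_Integration.integral_cong) (auto simp: abs_mult)
  also have "\<dots> = (\<integral>\<rho>\<in>running n. ?e \<rho> \<partial>R)"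
    by (rule F.real_cond_exp_intA[OF d running_run_filtration])
  also have "ennreal \<dots> \<le> ennreal (\<integral>\<rho>. c * indicator (running n) \<rho> \<partial>R)"
    unfolding set_lebesgue_integral_def
  proof (intro ennreal_leI integral_mono_AE)
    show "integrable R (\<lambda>\<rho>. indicator (running n) \<rho> *\<^sub>R ?e \<rho>)"
      by (rule integrable_mult_indicator[OF running_sets e])
    show "integrable R (\<lambda>\<rho>. c * indicator (running n) \<rho>)"
      by (intro integrable_mult_right R.integrable_const_bound[where B = 1]) auto
    show "AE \<rho> in R. indicator (running n) \<rho> *\<^sub>R ?e \<rho> \<le> c * indicator (running n) \<rho>"
      using assms by eventually_elim (auto simp: indicator_def)
  qed
  also have "(\<integral>\<rho>. c * indicator (running n) \<rho> \<partial>R) = c * R.prob (running n)"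
    by simp
  also have "ennreal (c * R.prob (running n)) = ennreal c * emeasure R (running n)"
    by (simp add: ennreal_mult'' R.emeasure_eq_measure)
  finally show ?thesis .
qed

text \<open>The tail formula \<open>E[T] = \<Sum>n. P(T > n)\<close>.\<close>

lemma suminf_running: "(\<Sum>n. emeasure R (running n)) = (\<integral>\<^sup>+\<rho>. ennreal_of_enat (term_time C \<rho>) \<partial>R)"
proof -
  have "(\<Sum>n. emeasure R (running n)) = (\<Sum>n. \<integral>\<^sup>+\<rho>. indicator (running n) \<rho> \<partial>R)"
    by simp
  also have "\<dots> = (\<integral>\<^sup>+\<rho>. (\<Sum>n. indicator (running n) \<rho>) \<partial>R)"
    by (rule nn_integral_suminf[symmetric]) measurable
  also have "\<dots> = (\<integral>\<^sup>+\<rho>. ennreal_of_enat (term_time C \<rho>) \<partial>R)"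
  proof (rule nn_integral_cong_AE, use AE_regular[OF ast] in eventually_elim)
    case (elim \<rho>)
    then have "(\<Sum>n. indicator (running n) \<rho> :: ennreal) = (\<Sum>n<exit_time \<rho>. indicator (running n) \<rho>)"
      by (intro suminf_finite) (auto simp: running_exits_iff)
    also have "\<dots> = (\<Sum>n<exit_time \<rho>. 1)"
      using elim by (intro sum.cong) (auto simp: running_exits_iff)
    finally show ?case
      using elim by (simp add: term_time_exits)
  qed
  finally show ?thesis .
qed

lemma stopped_dominated: "\<exists>D. integrable R D \<and> (\<forall>t. AE \<rho> in R. \<bar>stopped t \<rho>\<bar> \<le> D \<rho>)"
proof -
  consider (C1) c where "AE \<rho> in R. term_time C \<rho> \<le> enat c"
    | (C2) c where "\<forall>t\<ge>1. \<forall>\<rho>. is_run C \<rho> \<longrightarrow> \<bar>Y (the_enat (min (enat t) (term_time C \<rho>))) \<rho>\<bar> \<le> c"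
    | (C3) c where "(\<integral>\<^sup>+\<rho>. ennreal_of_enat (term_time C \<rho>) \<partial>R) < \<infinity>"
        "\<forall>t\<ge>1. AE \<rho> in R. real_cond_exp R (run_filtration C t) (\<lambda>\<rho>. \<bar>Y (t + 1) \<rho> - Y t \<rho>\<bar>) \<rho> \<le> c"
    | (C4) M c1 c2 d :: real where "0 < c2"
        "\<forall>\<^sub>F n in sequentially. \<P>(\<rho> in R. term_time C \<rho> > enat n) \<le> c1 * exp (- c2 * real n)"
        "\<forall>n\<ge>1. AE \<rho> in R. \<bar>Y (n + 1) \<rho> - Y n \<rho>\<bar> \<le> M * real n powr d"
    using ost unfolding ost_sound_def Let_def by blast
  then show ?thesis
  proof cases
    case C1
    have "AE \<rho> in R. \<bar>stopped t \<rho>\<bar> \<le> (\<Sum>i\<le>c. \<bar>Y i \<rho>\<bar>)" for t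
      using AE_regular[OF ast] C1
    proof eventually_elim
      case (elim \<rho>)
      then have "min t (exit_time \<rho>) \<le> c" by (simp add: term_time_exits)
      then show ?case unfolding stopped_def by (intro member_le_sum) auto
    qed
    moreover have "integrable R (\<lambda>\<rho>. \<Sum>i\<le>c. \<bar>Y i \<rho>\<bar>)"
      by (intro Bochner_Integration.integrable_sum integrable_abs integrable_Y)
    ultimately show ?thesis by blast
  next
    case C2
    \<comment> \<open>The summand for \<open>Y 0\<close> is there because (C2) bounds the process
      from time 1 on only.\<close>
    have "AE \<rho> in R. \<bar>stopped t \<rho>\<bar> \<le> \<bar>c\<bar> + \<bar>Y 0 \<rho>\<bar>" for t
      using AE_regular[OF ast]
    proof eventually_elim
      case (elim \<rho>)
      show ?case
      proof (cases "t = 0")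
        case False
        with C2 elim have "\<bar>Y (the_enat (min (enat t) (term_time C \<rho>))) \<rho>\<bar> \<le> c" by simp
        then have "\<bar>stopped t \<rho>\<bar> \<le> c"
          using elim by (simp add: stopped_def term_time_exits)
        then show ?thesis by simp
      qed (simp add: stopped_def)
    qed
    moreover have "integrable R (\<lambda>\<rho>. \<bar>c\<bar> + \<bar>Y 0 \<rho>\<bar>)"
      by (intro Bochner_Integration.integrable_add integrable_abs integrable_Y) simp
    ultimately show ?thesis by (intro exI[of _ "\<lambda>\<rho>. \<bar>c\<bar> + \<bar>Y 0 \<rho>\<bar>"]) simp
  next
    case C3
    have "(\<Sum>i. \<integral>\<^sup>+\<rho>. ennreal \<bar>increment (i + 1) \<rho>\<bar> \<partial>R) \<le> (\<Sum>i. ennreal c * emeasure R (running (i + 1)))"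
      using C3(2) by (intro suminf_le allI nn_integral_increment_cond_exp) auto
    also have "\<dots> = ennreal c * (\<Sum>i. emeasure R (running (i + 1)))"
      by simp
    also have "\<dots> \<le> ennreal c * (\<Sum>i. emeasure R (running i))"
      using suminf_offset[of "\<lambda>i. emeasure R (running i)" 1] by (intro mult_left_mono) auto
    also have "\<dots> < \<infinity>"
      using C3(1) by (simp add: suminf_running ennreal_mult_less_top)
    finally show ?thesis
      by (intro stopped_dominated_by_increments increments_finite_if_tail_finite)
  next
    case C4
    \<comment> \<open>The absolute values make the bound nonnegative, since no sign is prescribed
      for the constants \<open>M\<close> and \<open>c1\<close>.\<close>
    let ?b = "\<lambda>n::nat. \<bar>M\<bar> * real n powr d * (\<bar>c1\<bar> * exp (- c2 * real n))"
    from C4(2) obtain N where N: "\<And>n. N \<le> n \<Longrightarrow> \<P>(\<rho> in R. term_time C \<rho> > enat n) \<le> c1 * exp (- c2 * real n)"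
      unfolding eventually_sequentially by blast
    have "summable (\<lambda>n. \<bar>M\<bar> * \<bar>c1\<bar> * (real n powr d * exp (- c2 * real n)))"
      by (rule summable_mult[OF summable_powr_exp[OF C4(1)]])
    then have sb: "summable ?b" by (simp add: ac_simps)
    \<comment> \<open>The increment bound needs \<open>n \<ge> 1\<close> and the tail bound
      \<open>n \<ge> N\<close>; a tail starting at \<open>N + 1\<close> meets both.\<close>
    have bound: "(\<integral>\<^sup>+\<rho>. ennreal \<bar>increment n \<rho>\<bar> \<partial>R) \<le> ennreal (?b n)" if n: "1 \<le> n" "N \<le> n" for n
    proof -
      have "running n = {\<rho> \<in> space R. term_time C \<rho> > enat n}"
        using running_iff by (auto simp: running_def)
      then have "R.prob (running n) \<le> c1 * exp (- c2 * real n)" using N[OF n(2)] by simp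
      also have "\<dots> \<le> \<bar>c1\<bar> * exp (- c2 * real n)" by (intro mult_right_mono) auto
      finally have pr: "R.prob (running n) \<le> \<bar>c1\<bar> * exp (- c2 * real n)" .
      have "AE \<rho> in R. \<bar>Y (Suc n) \<rho> - Y n \<rho>\<bar> \<le> M * real n powr d"
        using C4(3) n(1) by simp
      then have "AE \<rho> in R. \<bar>Y (Suc n) \<rho> - Y n \<rho>\<bar> \<le> \<bar>M\<bar> * real n powr d"
        by eventually_elim (erule order_trans, intro mult_right_mono, auto)
      from nn_integral_increment_running[OF this]
      have "(\<integral>\<^sup>+\<rho>. ennreal \<bar>increment n \<rho>\<bar> \<partial>R) \<le> ennreal (\<bar>M\<bar> * real n powr d) * ennreal (R.prob (running n))"
        by (simp add: R.emeasure_eq_measure)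
      also have "\<dots> \<le> ennreal (?b n)"
        using pr by (subst ennreal_mult[symmetric]) (auto intro!: ennreal_leI mult_left_mono)
      finally show ?thesis .
    qed
    have "(\<Sum>i. \<integral>\<^sup>+\<rho>. ennreal \<bar>increment (i + (N + 1)) \<rho>\<bar> \<partial>R) \<le> (\<Sum>i. ennreal (?b (i + (N + 1))))"
      by (intro suminf_le allI bound) auto
    also have "\<dots> = ennreal (\<Sum>i. ?b (i + (N + 1)))"
      using summable_ignore_initial_segment[OF sb, of "N + 1"] by (intro suminf_ennreal2) auto
    also have "\<dots> < \<infinity>" by simp
    finally show ?thesis
      by (intro stopped_dominated_by_increments increments_finite_if_tail_finite)
  qed
qed

section \<open>The supermartingale inequality and passage to the limit\<close>

lemma AE_stopped_limit: "AE \<rho> in R. (\<lambda>t. stopped t \<rho>) \<longlonglongrightarrow> state_value (\<rho> (exit_time \<rho>))"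
  using AE_regular[OF ast]
proof eventually_elim
  case (elim \<rho>)
  have "stopped t \<rho> = state_value (\<rho> (exit_time \<rho>))" if "exit_time \<rho> \<le> t" for t
    using that by (simp add: stopped_def Y_eq min_def)
  then show ?case
    by (intro tendsto_eventually eventually_sequentiallyI[of "exit_time \<rho>"])
qed

lemma measurable_state_value_exit [measurable]: "(\<lambda>\<rho>. state_value (\<rho> (exit_time \<rho>))) \<in> borel_measurable R"
  by (rule measurable_compose_countable[OF _ measurable_exit_time]) measurable

text \<open>The positive and negative parts are arranged so that no subtraction of infinities can occur.\<close>

lemma step_expectation:
  assumes inv: "invariant C I" and U: "uesm C I f \<eta>" and s: "s \<in> space S" and reach: "reachable C s"
  shows "(\<integral>\<^sup>+s'. ennreal (state_value s') \<partial>step C s) + ennreal (- state_value s) \<le> ennreal (state_value s) + (\<integral>\<^sup>+s'. ennreal (- state_value s') \<partial>step C s)"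
proof -
  let ?l = "next_loc C s" and ?N = "next_val C (fst s, next_loc C s) (snd s)"
  let ?p = "\<integral>\<^sup>+x. ennreal (plus_output C f \<eta> ?l x) \<partial>?N" and ?n = "\<integral>\<^sup>+x. ennreal (- plus_output C f \<eta> ?l x) \<partial>?N"
  have "I (fst s) (snd s)" using inv reach unfolding invariant_def by simp
  moreover have "snd s \<in> space (val_space C)" using s by (simp add: space_S)
  moreover have "\<forall>(l, l')\<in>trans_rel C. \<forall>x\<in>space (val_space C). I l x \<and> guard C (l, l') x \<longrightarrow>
        has_expectation (next_val C (l, l') x) (plus_output C f \<eta> l') \<and>
        ereal (plus_output C f \<eta> l x) \<ge> ext_expectation (next_val C (l, l') x) (plus_output C f \<eta> l')"
    using U unfolding uesm_def by simp
  ultimately have "has_expectation ?N (plus_output C f \<eta> ?l) \<and>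
      ext_expectation ?N (plus_output C f \<eta> ?l) \<le> ereal (plus_output C f \<eta> (fst s) (snd s))"
    using next_loc_trans'[OF s] guard_next_loc[OF s] by fastforce
  then have he: "?p < \<infinity> \<or> ?n < \<infinity>" and le: "enn2ereal ?p - enn2ereal ?n \<le> ereal (state_value s)"
    by (simp_all add: has_expectation_def ext_expectation_def state_value_def)
  have int: "(\<integral>\<^sup>+s'. \<phi> s' \<partial>step C s) = (\<integral>\<^sup>+x. \<phi> (?l, x) \<partial>?N)" if "\<phi> \<in> borel_measurable S" for \<phi> :: "'l \<times> ('v \<Rightarrow> real) \<Rightarrow> ennreal"
    unfolding step_def
  proof (rule nn_integral_distr[OF _ ])
    show "Pair ?l \<in> measurable ?N S"
      using measurable_Pair_loc[OF next_loc_in[OF s]] by (simp add: next_val_def)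
  qed (use that in simp)
  have p: "(\<integral>\<^sup>+s'. ennreal (state_value s') \<partial>step C s) = ?p" and n: "(\<integral>\<^sup>+s'. ennreal (- state_value s') \<partial>step C s) = ?n"
    by (subst int, measurable, simp add: state_value_def)+
  have real_case: "ennreal a + ennreal (- c) \<le> ennreal c + ennreal b" if "0 \<le> a" "0 \<le> b" "a - b \<le> c" for a b c
    using that by (cases "0 \<le> c") (simp_all add: ennreal_neg ennreal_plus[symmetric] ennreal_leI del: ennreal_plus)
  \<comment> \<open>Both parts infinite is excluded by \<open>he\<close>, and an infinite positive
    part alone by \<open>le\<close>. An infinite negative part makes the right-hand side infinite,
    which leaves real arithmetic.\<close>
  show ?thesis
    unfolding p n using he le
    by (cases "?p" rule: ennreal_cases; cases "?n" rule: ennreal_cases) (auto intro: real_case)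
qed

text \<open>Integrating the one-step inequality over \<open>running t\<close> compares the positive
  and negative parts of \<open>Y\<close> at times \<open>t\<close> and \<open>Suc t\<close>. Unlike
  those of a single step, these integrals are finite because each \<open>Y i\<close> is integrable,
  so the sums can be rearranged into a difference of real expectations.\<close>

lemma increment_nonpos:
  assumes inv: "invariant C I" and U: "uesm C I f \<eta>"
  shows "(\<integral>\<rho>. increment t \<rho> \<partial>R) \<le> 0"
proof -
  let ?A = "running t"
  define a where "a k \<rho> = indicator ?A \<rho> * Y k \<rho>" for k \<rho>
  have a: "integrable R (a k)" for k
    unfolding a_def using integrable_mult_indicator[OF running_sets integrable_Y, of t k] by simp
  then have am [measurable]: "a k \<in> borel_measurable R" for k by blast
  define p where "p k = (\<integral>\<^sup>+\<rho>. ennreal (a k \<rho>) \<partial>R)" for k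
  define n where "n k = (\<integral>\<^sup>+\<rho>. ennreal (- a k \<rho>) \<partial>R)" for k
  have fin: "p k \<noteq> \<infinity>" "n k \<noteq> \<infinity>" for k
    using a[of k] by (auto simp: real_integrable_def p_def n_def)
  have ind: "ennreal (indicator ?A \<rho> * b) = indicator ?A \<rho> * ennreal b"
    "ennreal (- (indicator ?A \<rho> * b)) = indicator ?A \<rho> * ennreal (- b)" for \<rho> b
    by (auto simp: indicator_def)
  have markov': "(\<integral>\<^sup>+\<rho>. indicator ?A \<rho> * \<phi> (\<rho> (Suc t)) \<partial>R) = (\<integral>\<^sup>+\<rho>. indicator ?A \<rho> * (\<integral>\<^sup>+s. \<phi> s \<partial>step C (\<rho> t)) \<partial>R)"
    if \<phi> [measurable]: "\<phi> \<in> borel_measurable S" for \<phi> :: "'l \<times> ('v \<Rightarrow> real) \<Rightarrow> ennreal"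
  proof -
    \<comment> \<open>The Markov property wants a function of the coordinates up to \<open>t\<close>
      alone, whereas membership in \<open>running t\<close> also tests that the whole sequence lies
      in \<open>space R\<close>.\<close>
    define Q :: "(nat \<Rightarrow> 'l \<times> ('v \<Rightarrow> real)) \<Rightarrow> ennreal" where "Q \<rho> = of_bool (\<forall>i\<le>t. fst (\<rho> i) \<noteq> out_loc C)" for \<rho>
    have Q: "indicator ?A \<rho> = Q \<rho>" if "\<rho> \<in> space R" for \<rho>
      using that by (simp add: running_def indicator_def Q_def)
    have "Q \<in> borel_measurable R"
      using measurable_cong[of R Q "indicator ?A" borel] Q by simp
    then have [measurable]: "Q \<in> borel_measurable (PiM UNIV (\<lambda>_. S))"
      by (simp add: measurable_cong_sets[OF sets_run refl])
    have "(\<integral>\<^sup>+\<rho>. Q \<rho> * \<phi> (\<rho> (Suc t)) \<partial>R) = (\<integral>\<^sup>+\<rho>. \<integral>\<^sup>+s. Q \<rho> * \<phi> s \<partial>step C (\<rho> t) \<partial>R)"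
    proof (rule markov)
      show "(\<lambda>(\<rho>, s). Q \<rho> * \<phi> s) \<in> borel_measurable (PiM UNIV (\<lambda>_. S) \<Otimes>\<^sub>M S)"
        by measurable
    qed (simp add: Q_def)
    also have "\<dots> = (\<integral>\<^sup>+\<rho>. Q \<rho> * (\<integral>\<^sup>+s. \<phi> s \<partial>step C (\<rho> t)) \<partial>R)"
      by (intro nn_integral_cong nn_integral_cmult) (simp add: measurable_cong_sets[OF sets_step refl])
    finally show ?thesis by (simp add: Q cong: nn_integral_cong_simp)
  qed
  have "p (Suc t) + n t = (\<integral>\<^sup>+\<rho>. indicator ?A \<rho> * (\<integral>\<^sup>+s. ennreal (state_value s) \<partial>step C (\<rho> t)) \<partial>R) + n t"
    unfolding p_def a_def ind Y_eq by (subst markov') auto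
  also have "\<dots> = (\<integral>\<^sup>+\<rho>. indicator ?A \<rho> * ((\<integral>\<^sup>+s. ennreal (state_value s) \<partial>step C (\<rho> t)) + ennreal (- state_value (\<rho> t))) \<partial>R)"
    unfolding n_def a_def ind Y_eq distrib_left by (rule nn_integral_add[symmetric]) measurable
  \<comment> \<open>The one-step inequality is available at reachable states only; almost every
    trajectory is a run and therefore visits no others.\<close>
  also have "\<dots> \<le> (\<integral>\<^sup>+\<rho>. indicator ?A \<rho> * (ennreal (state_value (\<rho> t)) + (\<integral>\<^sup>+s. ennreal (- state_value s) \<partial>step C (\<rho> t))) \<partial>R)"
    using AE_is_run AE_space
    by (intro nn_integral_mono_AE, eventually_elim)
       (intro mult_left_mono step_expectation[OF inv U] run_in_space is_run_reachable, auto)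
  also have "\<dots> = p t + (\<integral>\<^sup>+\<rho>. indicator ?A \<rho> * (\<integral>\<^sup>+s. ennreal (- state_value s) \<partial>step C (\<rho> t)) \<partial>R)"
    unfolding p_def a_def ind Y_eq distrib_left by (rule nn_integral_add) measurable
  also have "\<dots> = p t + n (Suc t)"
    unfolding n_def a_def ind Y_eq by (subst markov') auto
  finally have le: "p (Suc t) + n t \<le> p t + n (Suc t)" .
  have "enn2real (p (Suc t)) + enn2real (n t) \<le> enn2real (p t) + enn2real (n (Suc t))"
    using enn2real_mono[OF le] fin by (simp add: enn2real_plus less_top)
  then have "(\<integral>\<rho>. a (Suc t) \<rho> \<partial>R) \<le> (\<integral>\<rho>. a t \<rho> \<partial>R)"
    unfolding real_lebesgue_integral_def[OF a] p_def n_def by simp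
  moreover have "increment t = (\<lambda>\<rho>. a (Suc t) \<rho> - a t \<rho>)"
    by (simp add: increment_def a_def fun_eq_iff algebra_simps)
  ultimately show ?thesis using a by simp
qed

lemma optional_stopping:
  assumes inv: "invariant C I" and U: "uesm C I f \<eta>"
  shows "(\<integral>\<rho>. f (run_output \<rho>) \<partial>R) \<le> \<eta> (init_loc C) (init_val C) + f (restrict (init_val C) (out_vars C))"
proof -
  have dec: "(\<integral>\<rho>. increment t \<rho> \<partial>R) \<le> 0" for t
    using increment_nonpos[OF assms] .
  have stopped_le: "(\<integral>\<rho>. stopped t \<rho> \<partial>R) \<le> state_value (init_state C)" for t
  proof -
    have "(\<integral>\<rho>. stopped t \<rho> \<partial>R) = (\<integral>\<rho>. Y 0 \<rho> + (\<Sum>i<t. increment i \<rho>) \<partial>R)"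
      using AE_stopped_sum by (intro integral_cong_AE) auto
    also have "\<dots> = (\<integral>\<rho>. Y 0 \<rho> \<partial>R) + (\<Sum>i<t. \<integral>\<rho>. increment i \<rho> \<partial>R)"
      using integrable_Y integrable_increment
      by (subst Bochner_Integration.integral_add) (auto intro!: Bochner_Integration.integrable_sum simp: Bochner_Integration.integral_sum)
    also have "\<dots> \<le> (\<integral>\<rho>. Y 0 \<rho> \<partial>R)"
      using dec by (simp add: sum_nonpos)
    also have "(\<integral>\<rho>. Y 0 \<rho> \<partial>R) = (\<integral>\<rho>. state_value (init_state C) \<partial>R)"
      using init_run by (intro integral_cong_AE) (auto simp: Y_eq)
    also have "\<dots> = state_value (init_state C)"
      by (simp add: R.prob_space)
    finally show ?thesis .
  qed
  obtain D where D: "integrable R D" "\<And>t. AE \<rho> in R. norm (stopped t \<rho>) \<le> D \<rho>"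
    using stopped_dominated by auto
  note dom = measurable_state_value_exit measurable_stopped D(1) AE_stopped_limit D(2)
  \<comment> \<open>The exit state of a run is reachable, so the invariant holds there and
    \<open>\<eta>\<close> vanishes, leaving \<open>f\<close> of the output.\<close>
  have out: "AE \<rho> in R. state_value (\<rho> (exit_time \<rho>)) = f (run_output \<rho>)"
    using AE_regular[OF ast]
  proof eventually_elim
    case (elim \<rho>)
    let ?s = "\<rho> (exit_time \<rho>)"
    have "reachable C (fst ?s, snd ?s)" using is_run_reachable[of \<rho>] elim by simp
    then have "I (fst ?s) (snd ?s)" using inv unfolding invariant_def by blast
    then have "\<eta> (fst ?s) (snd ?s) = 0"
      using U at_exit_time[of \<rho>] elim run_in_space[of \<rho> "exit_time \<rho>"] by (auto simp: uesm_def space_S)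
    then show ?case by (simp add: state_value_def plus_output_def run_output_def)
  qed
  have m: "(\<lambda>\<rho>. f (run_output \<rho>)) \<in> borel_measurable R"
    by (rule measurable_compose[OF measurable_output f])
  have "(\<integral>\<rho>. f (run_output \<rho>) \<partial>R) = (\<integral>\<rho>. state_value (\<rho> (exit_time \<rho>)) \<partial>R)"
    using integral_cong_AE[OF measurable_state_value_exit m out] by simp
  also have "\<dots> \<le> state_value (init_state C)"
    by (rule LIMSEQ_le_const2[OF integral_dominated_convergence[OF dom]]) (use stopped_le in auto)
  finally show "(\<integral>\<rho>. f (run_output \<rho>) \<partial>R) \<le> \<eta> (init_loc C) (init_val C) + f (restrict (init_val C) (out_vars C))"
    by (simp add: state_value_def init_state_def plus_output_def)
qed

end

section \<open>Bounds on the normalized output distribution\<close>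

lemma plus_output_uminus:
  "plus_output C (\<lambda>x. - f x) (\<lambda>l x. - \<eta> l x) = (\<lambda>l x. - plus_output C f \<eta> l x)"
  by (simp add: plus_output_def fun_eq_iff)

lemma run_value_uminus:
  "run_value C (\<lambda>x. - f x) (\<lambda>l x. - \<eta> l x) = (\<lambda>i \<rho>. - run_value C f \<eta> i \<rho>)"
  by (simp add: run_value_def plus_output_uminus fun_eq_iff)

text \<open>Integrability and each of (C1) to (C4) depend on \<open>Y\<close> only through absolute
  values, if at all.\<close>

lemma ost_sound_uminus:
  assumes "ost_sound C \<eta> f"
  shows "ost_sound C (\<lambda>l x. - \<eta> l x) (\<lambda>x. - f x)"
proof -
  have "\<bar>- a - - b\<bar> = \<bar>a - b\<bar>" for a b :: real by simp
  with assms show ?thesis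
    unfolding ost_sound_def run_value_uminus Let_def abs_minus_cancel by simp
qed

lemma has_expectation_uminus: "has_expectation N (\<lambda>x. - g x) \<longleftrightarrow> has_expectation N g"
  by (auto simp: has_expectation_def)

text \<open>The hypothesis rules out a difference of two infinities. In \<open>ereal\<close> that
  difference is \<open>\<infinity>\<close> in either order, so the sign would be lost.\<close>

lemma ext_expectation_uminus:
  assumes "has_expectation N g"
  shows "ext_expectation N (\<lambda>x. - g x) = - ext_expectation N g"
  using assms unfolding has_expectation_def ext_expectation_def
  by (cases "\<integral>\<^sup>+x. ennreal (g x) \<partial>N" rule: ennreal_cases;
      cases "\<integral>\<^sup>+x. ennreal (- g x) \<partial>N" rule: ennreal_cases) (auto simp: enn2ereal_ennreal)

text \<open>The reduction of the lower bound to the upper one: negating both \<open>f\<close> and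
  \<open>L\<close> reverses the one-step inequality, while the terminal value 0 is
  preserved.\<close>

lemma uesm_uminus:
  assumes "lesm C I f L"
  shows "uesm C I (\<lambda>x. - f x) (\<lambda>l x. - L l x)"
  unfolding uesm_def plus_output_uminus
proof (intro conjI ballI, safe)
  show "state_function C (\<lambda>l x. - L l x)"
    using assms by (auto simp: lesm_def state_function_def)
  fix x assume x: "x \<in> space (val_space C)"
  show "- L (out_loc C) x = 0" if "I (out_loc C) x"
    using assms x that by (auto simp: lesm_def)
  fix l l' assume "(l, l') \<in> trans_rel C" "I l x" "guard C (l, l') x"
  with assms x have *: "has_expectation (next_val C (l, l') x) (plus_output C f L l')"
    "ereal (plus_output C f L l x) \<le> ext_expectation (next_val C (l, l') x) (plus_output C f L l')"
    unfolding lesm_def by fast+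
  then show "has_expectation (next_val C (l, l') x) (\<lambda>x. - plus_output C f L l' x)"
    by (simp add: has_expectation_uminus)
  show "ext_expectation (next_val C (l, l') x) (\<lambda>x. - plus_output C f L l' x) \<le> ereal (- plus_output C f L l x)"
    using * by (simp add: ext_expectation_uminus flip: uminus_ereal.simps(1))
qed

context restarted
begin

lemma nod_upper_bound:
  assumes ast: "as_terminating C" and int: "integrable_pcfg C" and bound: "bounded_cum_weight C M"
    and f: "f \<in> borel_measurable (out_space C)"
    and inv: "invariant (restart M \<omega> u C) I" and U: "uesm (restart M \<omega> u C) I f \<eta>"
    and ost: "ost_sound (restart M \<omega> u C) \<eta> f"
  shows "(\<integral>x. f x \<partial>nod C) \<le> \<eta> (init_loc (restart M \<omega> u C)) (init_val (restart M \<omega> u C))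
      + f (restrict (init_val (restart M \<omega> u C)) (out_vars C))"
proof -
  interpret E: ost_graph "restart M \<omega> u C" f \<eta>
    using as_terminating_restart[OF ast int bound] f ost U
    by unfold_locales (simp_all add: restart_sel(2) uesm_def)
  note stopping = E.optional_stopping[OF inv U]
  show "(\<integral>x. f x \<partial>nod C) \<le> \<eta> (init_loc (restart M \<omega> u C)) (init_val (restart M \<omega> u C))
      + f (restrict (init_val (restart M \<omega> u C)) (out_vars C))"
    using stopping by (simp add: distr_output_restart[OF ast int bound, symmetric] integral_distr[OF measurable_restart_output f] restart_sel(2))
qed

lemma nod_lower_bound:
  assumes ast: "as_terminating C" and int: "integrable_pcfg C" and bound: "bounded_cum_weight C M"
    and f: "f \<in> borel_measurable (out_space C)"
    and inv: "invariant (restart M \<omega> u C) I" and L: "lesm (restart M \<omega> u C) I f \<eta>"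
    and ost: "ost_sound (restart M \<omega> u C) \<eta> f"
  shows "\<eta> (init_loc (restart M \<omega> u C)) (init_val (restart M \<omega> u C))
      + f (restrict (init_val (restart M \<omega> u C)) (out_vars C)) \<le> (\<integral>x. f x \<partial>nod C)"
  using nod_upper_bound[OF ast int bound borel_measurable_uminus[OF f] inv uesm_uminus[OF L] ost_sound_uminus[OF ost]]
  by simp

end

lemma space_nod: "space (nod C) = space (out_space C)"
  by (simp add: nod_def space_measure_of_conv)

lemma sets_nod: "sets (nod C) = sets (out_space C)"
  by (simp add: nod_def sets.sigma_sets_eq sets.space_closed)

theorem theorem7:
  fixes P1 P2 :: "'v prog"
    and M1 M2 :: real
    and \<omega>1 u1 \<omega>2 u2 :: 'v
    and Vout :: "'v set"
    and C1 C2 :: "(nat restart_loc, 'v) pcfg"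
    and f :: "('v \<Rightarrow> real) \<Rightarrow> real"
    and U L :: "nat restart_loc \<Rightarrow> ('v \<Rightarrow> real) \<Rightarrow> real"
  assumes "wf_prog P1" and "wf_prog P2"
    and "as_terminating (cfg P1)" and "as_terminating (cfg P2)"
    and "integrable_pcfg (cfg P1)" and "integrable_pcfg (cfg P2)"
    and "prog_out P1 = Vout" and "prog_out P2 = Vout"
    and "bounded_cum_weight (cfg P1) M1" and "bounded_cum_weight (cfg P2) M2"
    and "\<omega>1 \<notin> prog_vars P1" and "u1 \<notin> prog_vars P1" and "\<omega>1 \<noteq> u1"
    and "\<omega>2 \<notin> prog_vars P2" and "u2 \<notin> prog_vars P2" and "\<omega>2 \<noteq> u2"
    and "C1 = restart M1 \<omega>1 u1 (cfg P1)" and "C2 = restart M2 \<omega>2 u2 (cfg P2)"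
    and "f \<in> borel_measurable (real_vals Vout)"
    and "\<exists>I. invariant C1 I \<and> uesm C1 I f U" and "ost_sound C1 U f"
    and "\<exists>I. invariant C2 I \<and> lesm C2 I f L" and "ost_sound C2 L f"
    and "U (init_loc C1) (init_val C1) + f (restrict (init_val C1) Vout)
         < L (init_loc C2) (init_val C2) + f (restrict (init_val C2) Vout)"
  shows "nod (cfg P1) \<noteq> nod (cfg P2) \<and>
    (\<forall>d. Metric_space (space (real_vals Vout)) d \<and>
         finite_first_moment d (nod (cfg P1)) \<and> finite_first_moment d (nod (cfg P2)) \<and>
         lipschitz1 (space (real_vals Vout)) d f \<longrightarrow>
         kantorovich d (nod (cfg P1)) (nod (cfg P2)) \<ge>
           ereal (L (init_loc C2) (init_val C2) + f (restrict (init_val C2) Vout)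
                  - U (init_loc C1) (init_val C1) - f (restrict (init_val C1) Vout)))"
proof -
  define up where "up = U (init_loc C1) (init_val C1) + f (restrict (init_val C1) Vout)"
  define lo where "lo = L (init_loc C2) (init_val C2) + f (restrict (init_val C2) Vout)"
  let ?\<mu>1 = "nod (cfg P1)" and ?\<mu>2 = "nod (cfg P2)"
  have out: "out_vars (cfg P1) = Vout" "out_vars (cfg P2) = Vout"
    using assms(7,8) by (simp_all add: cfg_def)
  have vars: "vars (cfg P1) = prog_vars P1" "vars (cfg P2) = prog_vars P2"
    by (simp_all add: cfg_def)
  interpret A: restarted "cfg P1" M1 \<omega>1 u1
    using assms(9,11-13) wf_cfg[OF assms(1)]
    by unfold_locales (simp_all add: vars bounded_cum_weight_def)
  interpret B: restarted "cfg P2" M2 \<omega>2 u2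
    using assms(10,14-16) wf_cfg[OF assms(2)]
    by unfold_locales (simp_all add: vars bounded_cum_weight_def)
  obtain I J where I: "invariant C1 I" "uesm C1 I f U" and J: "invariant C2 J" "lesm C2 J f L"
    using assms(20,22) by blast
  have upper: "(\<integral>x. f x \<partial>?\<mu>1) \<le> up"
    using A.nod_upper_bound[of f I U] assms(3,5,9,17,19,21) I by (simp add: out up_def)
  have lower: "lo \<le> (\<integral>x. f x \<partial>?\<mu>2)"
    using B.nod_lower_bound[of f J L] assms(4,6,10,18,19,23) J by (simp add: out lo_def)
  have less: "up < lo" using assms(24) by (simp add: up_def lo_def)
  show ?thesis
  proof (intro conjI allI impI)
    \<comment> \<open>Equality of the measures would force \<open>lo \<le> up\<close>, both being
      compared with the same integral of \<open>f\<close>.\<close>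
    show "?\<mu>1 \<noteq> ?\<mu>2" using upper lower less by auto
    fix d assume d: "Metric_space (space (real_vals Vout)) d \<and> finite_first_moment d ?\<mu>1 \<and>
      finite_first_moment d ?\<mu>2 \<and> lipschitz1 (space (real_vals Vout)) d f"
    \<comment> \<open>\<open>f\<close> itself competes in the supremum.\<close>
    have "f \<in> {g \<in> borel_measurable ?\<mu>1. lipschitz1 (space ?\<mu>1) d g}"
      using d assms(19) by (simp add: space_nod out measurable_cong_sets[OF sets_nod refl])
    then have "ereal \<bar>(\<integral>x. f x \<partial>?\<mu>1) - (\<integral>x. f x \<partial>?\<mu>2)\<bar> \<le> kantorovich d ?\<mu>1 ?\<mu>2"
      unfolding kantorovich_def by (rule SUP_upper)
    moreover have "lo - up \<le> \<bar>(\<integral>x. f x \<partial>?\<mu>1) - (\<integral>x. f x \<partial>?\<mu>2)\<bar>"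
      using upper lower by linarith
    moreover have "lo - up = L (init_loc C2) (init_val C2) + f (restrict (init_val C2) Vout)
        - U (init_loc C1) (init_val C1) - f (restrict (init_val C1) Vout)"
      by (simp add: lo_def up_def)
    ultimately show "kantorovich d ?\<mu>1 ?\<mu>2 \<ge> ereal (L (init_loc C2) (init_val C2) + f (restrict (init_val C2) Vout)
        - U (init_loc C1) (init_val C1) - f (restrict (init_val C1) Vout))"
      by (metis ereal_less_eq(3) order_trans)
  qed
qed

end
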